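(* Let $U$ be a completely simple semigroup with finitely many left ideals and let $H$ be a maximal subgroup of $U$. Then $U$ is of type left-$\mathrm{FP}_n$ if and only if $U$ has finitely many right ideals and the group $H$ is of type $\mathrm{FP}_n$.
   Context: For a monoid $S$, $\mathbb{Z}S$ denotes the integral monoid ring, and $\mathbb{Z}$ is regarded as the trivial left $\mathbb{Z}S$-module via the augmentation $\epsilon_S:\mathbb{Z}S\to\mathbb{Z}$, $s\mapsto 1$ ($s\in S$). For $n\geq 0$ the monoid $S$ is of type left-$\mathrm{FP}_n$ if there is an exact sequence $A_n\to A_{n-1}\to\cdots\to A_0\to\mathbb{Z}\to 0$ of left $\mathbb{Z}S$-modules with $A_0,\ldots,A_n$ finitely generated free left $\mathbb{Z}S$-modules. A semigroup $S$ without a two-sided identity is of type left-$\mathrm{FP}_n$ if the monoid $S^1=S\cup\{1\}$, obtained by adjoining an identity element, is. For a group, left-$\mathrm{FP}_n$ and its right-hand dual are equivalent and one says "type $\mathrm{FP}_n$". A semigroup is simple if it has no proper two-sided ideals, and completely simple if it is simple and has minimal left and minimal right ideals. For an idempotent $e\in U$, the maximal subgroup of $U$ containing $e$ is the group of units of $eUe$.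
   Formalization: The formal theorem assumes n ≥ 1; at n = 0 the claim is false, since every monoid is of type left-FP_0, while an infinite left zero semigroup (xy = x) is completely simple with one left ideal but infinitely many right ideals. *)

theory Defs
  imports "HOL-Algebra.Module"
begin

section \<open>Completely simple semigroups\<close>

text \<open>
  A semigroup is represented by a monoid record of which only the fields \<open>carrier\<close> and
  \<open>mult\<close> are looked at; its field \<open>one\<close> carries no information.
\<close>

locale mult_semigroup =
  fixes U (structure)
  assumes m_closed: "\<lbrakk>x \<in> carrier U; y \<in> carrier U\<rbrakk> \<Longrightarrow> x \<otimes> y \<in> carrier U"
    and m_assoc: "\<lbrakk>x \<in> carrier U; y \<in> carrier U; z \<in> carrier U\<rbrakk>
      \<Longrightarrow> (x \<otimes> y) \<otimes> z = x \<otimes> (y \<otimes> z)"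

text \<open>Ideals are nonempty; otherwise no nonempty semigroup would be simple.\<close>

definition left_ideal :: "'a set \<Rightarrow> ('a, 'b) monoid_scheme \<Rightarrow> bool" where
  "left_ideal I U \<longleftrightarrow> I \<subseteq> carrier U \<and> I \<noteq> {} \<and>
     (\<forall>s\<in>carrier U. \<forall>x\<in>I. s \<otimes>\<^bsub>U\<^esub> x \<in> I)"

definition right_ideal :: "'a set \<Rightarrow> ('a, 'b) monoid_scheme \<Rightarrow> bool" where
  "right_ideal I U \<longleftrightarrow> I \<subseteq> carrier U \<and> I \<noteq> {} \<and>
     (\<forall>s\<in>carrier U. \<forall>x\<in>I. x \<otimes>\<^bsub>U\<^esub> s \<in> I)"

definition two_sided_ideal :: "'a set \<Rightarrow> ('a, 'b) monoid_scheme \<Rightarrow> bool" where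
  "two_sided_ideal I U \<longleftrightarrow> left_ideal I U \<and> right_ideal I U"

definition minimal_left_ideal :: "'a set \<Rightarrow> ('a, 'b) monoid_scheme \<Rightarrow> bool" where
  "minimal_left_ideal I U \<longleftrightarrow> left_ideal I U \<and> (\<forall>J. left_ideal J U \<and> J \<subseteq> I \<longrightarrow> J = I)"

definition minimal_right_ideal :: "'a set \<Rightarrow> ('a, 'b) monoid_scheme \<Rightarrow> bool" where
  "minimal_right_ideal I U \<longleftrightarrow> right_ideal I U \<and> (\<forall>J. right_ideal J U \<and> J \<subseteq> I \<longrightarrow> J = I)"

definition simple_semigroup :: "('a, 'b) monoid_scheme \<Rightarrow> bool" where
  "simple_semigroup U \<longleftrightarrow> mult_semigroup U \<and> (\<forall>I. two_sided_ideal I U \<longrightarrow> I = carrier U)"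

definition completely_simple :: "('a, 'b) monoid_scheme \<Rightarrow> bool" where
  "completely_simple U \<longleftrightarrow> simple_semigroup U \<and>
     (\<exists>I. minimal_left_ideal I U) \<and> (\<exists>I. minimal_right_ideal I U)"

definition idempotent_in :: "'a \<Rightarrow> ('a, 'b) monoid_scheme \<Rightarrow> bool" where
  "idempotent_in e U \<longleftrightarrow> e \<in> carrier U \<and> e \<otimes>\<^bsub>U\<^esub> e = e"

definition local_monoid :: "('a, 'b) monoid_scheme \<Rightarrow> 'a \<Rightarrow> 'a monoid" where
  "local_monoid U e =
     \<lparr>carrier = {e \<otimes>\<^bsub>U\<^esub> u \<otimes>\<^bsub>U\<^esub> e | u. u \<in> carrier U}, mult = mult U, one = e\<rparr>"

definition maximal_subgroup :: "'a monoid \<Rightarrow> ('a, 'b) monoid_scheme \<Rightarrow> bool" where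
  "maximal_subgroup H U \<longleftrightarrow> (\<exists>e. idempotent_in e U \<and> H = units_of (local_monoid U e))"

lemma local_monoid_monoid:
  assumes "mult_semigroup U" "idempotent_in e U"
  shows "monoid (local_monoid U e)"
proof -
  interpret mult_semigroup U by fact
  have e: "e \<in> carrier U" "e \<otimes>\<^bsub>U\<^esub> e = e"
    using assms(2) by (auto simp: idempotent_in_def)
  show ?thesis
  proof
    fix x y assume "x \<in> carrier (local_monoid U e)" "y \<in> carrier (local_monoid U e)"
    then obtain u v where u: "u \<in> carrier U" "x = e \<otimes>\<^bsub>U\<^esub> u \<otimes>\<^bsub>U\<^esub> e"
      and v: "v \<in> carrier U" "y = e \<otimes>\<^bsub>U\<^esub> v \<otimes>\<^bsub>U\<^esub> e"
      by (auto simp: local_monoid_def)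
    have "x \<otimes>\<^bsub>U\<^esub> y = e \<otimes>\<^bsub>U\<^esub> (u \<otimes>\<^bsub>U\<^esub> e \<otimes>\<^bsub>U\<^esub> (e \<otimes>\<^bsub>U\<^esub> v)) \<otimes>\<^bsub>U\<^esub> e"
      using u v e by (simp add: m_assoc m_closed)
    moreover have "u \<otimes>\<^bsub>U\<^esub> e \<otimes>\<^bsub>U\<^esub> (e \<otimes>\<^bsub>U\<^esub> v) \<in> carrier U"
      using u(1) v(1) e(1) by (intro m_closed)
    ultimately show "x \<otimes>\<^bsub>local_monoid U e\<^esub> y \<in> carrier (local_monoid U e)"
      unfolding local_monoid_def by auto
  next
    fix x assume "x \<in> carrier (local_monoid U e)"
    then obtain u where u: "u \<in> carrier U" "x = e \<otimes>\<^bsub>U\<^esub> u \<otimes>\<^bsub>U\<^esub> e"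
      by (auto simp: local_monoid_def)
    show "x \<otimes>\<^bsub>local_monoid U e\<^esub> \<one>\<^bsub>local_monoid U e\<^esub> = x"
      using u e by (simp add: local_monoid_def m_assoc m_closed)
    show "\<one>\<^bsub>local_monoid U e\<^esub> \<otimes>\<^bsub>local_monoid U e\<^esub> x = x"
      using u e by (simp add: local_monoid_def m_closed flip: m_assoc)
  next
    fix x y z
    assume "x \<in> carrier (local_monoid U e)" "y \<in> carrier (local_monoid U e)"
      "z \<in> carrier (local_monoid U e)"
    then have "x \<in> carrier U" "y \<in> carrier U" "z \<in> carrier U"
      using e by (auto simp: local_monoid_def m_closed)
    then show "x \<otimes>\<^bsub>local_monoid U e\<^esub> y \<otimes>\<^bsub>local_monoid U e\<^esub> z =
        x \<otimes>\<^bsub>local_monoid U e\<^esub> (y \<otimes>\<^bsub>local_monoid U e\<^esub> z)"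
      by (simp add: local_monoid_def m_assoc)
  next
    have "e = e \<otimes>\<^bsub>U\<^esub> e \<otimes>\<^bsub>U\<^esub> e" using e by simp
    then show "\<one>\<^bsub>local_monoid U e\<^esub> \<in> carrier (local_monoid U e)"
      using e(1) by (auto simp: local_monoid_def)
  qed
qed

lemma maximal_subgroup_group:
  assumes "mult_semigroup U" "maximal_subgroup H U"
  shows "group H"
  using assms(2) monoid.units_group[OF local_monoid_monoid[OF assms(1)]]
  by (auto simp: maximal_subgroup_def)


section \<open>Left modules over a not necessarily commutative ring\<close>

locale left_module = R?: ring R + M?: abelian_group M
  for R :: "('r, 'c) ring_scheme" (structure) and M :: "('r, 'm, 'd) module_scheme" (structure) +
  assumes smult_closed: "\<lbrakk>a \<in> carrier R; x \<in> carrier M\<rbrakk> \<Longrightarrow> a \<odot>\<^bsub>M\<^esub> x \<in> carrier M"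
    and smult_l_distr: "\<lbrakk>a \<in> carrier R; b \<in> carrier R; x \<in> carrier M\<rbrakk> \<Longrightarrow>
      (a \<oplus>\<^bsub>R\<^esub> b) \<odot>\<^bsub>M\<^esub> x = a \<odot>\<^bsub>M\<^esub> x \<oplus>\<^bsub>M\<^esub> b \<odot>\<^bsub>M\<^esub> x"
    and smult_r_distr: "\<lbrakk>a \<in> carrier R; x \<in> carrier M; y \<in> carrier M\<rbrakk> \<Longrightarrow>
      a \<odot>\<^bsub>M\<^esub> (x \<oplus>\<^bsub>M\<^esub> y) = a \<odot>\<^bsub>M\<^esub> x \<oplus>\<^bsub>M\<^esub> a \<odot>\<^bsub>M\<^esub> y"
    and smult_assoc: "\<lbrakk>a \<in> carrier R; b \<in> carrier R; x \<in> carrier M\<rbrakk> \<Longrightarrow>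
      (a \<otimes>\<^bsub>R\<^esub> b) \<odot>\<^bsub>M\<^esub> x = a \<odot>\<^bsub>M\<^esub> (b \<odot>\<^bsub>M\<^esub> x)"
    and smult_one: "x \<in> carrier M \<Longrightarrow> \<one>\<^bsub>R\<^esub> \<odot>\<^bsub>M\<^esub> x = x"

definition left_module_hom ::
  "('r, 'c) ring_scheme \<Rightarrow> ('r, 'm, 'd) module_scheme \<Rightarrow> ('r, 'k, 'e) module_scheme \<Rightarrow>
    ('m \<Rightarrow> 'k) set" where
  "left_module_hom R M N = {h \<in> carrier M \<rightarrow> carrier N.
     (\<forall>x\<in>carrier M. \<forall>y\<in>carrier M. h (x \<oplus>\<^bsub>M\<^esub> y) = h x \<oplus>\<^bsub>N\<^esub> h y) \<and>
     (\<forall>a\<in>carrier R. \<forall>x\<in>carrier M. h (a \<odot>\<^bsub>M\<^esub> x) = a \<odot>\<^bsub>N\<^esub> h x)}"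

definition module_kernel ::
  "('r, 'm, 'd) module_scheme \<Rightarrow> ('r, 'k, 'e) module_scheme \<Rightarrow> ('m \<Rightarrow> 'k) \<Rightarrow> 'm set" where
  "module_kernel M N h = {x \<in> carrier M. h x = \<zero>\<^bsub>N\<^esub>}"

definition finite_basis ::
  "('r, 'c) ring_scheme \<Rightarrow> ('r, 'm, 'd) module_scheme \<Rightarrow> 'm set \<Rightarrow> bool" where
  "finite_basis R M B \<longleftrightarrow> finite B \<and> B \<subseteq> carrier M \<and>
     (\<forall>x\<in>carrier M. \<exists>!c. c \<in> B \<rightarrow>\<^sub>E carrier R \<and> x = (\<Oplus>\<^bsub>M\<^esub>b\<in>B. c b \<odot>\<^bsub>M\<^esub> b))"

definition fg_free :: "('r, 'c) ring_scheme \<Rightarrow> ('r, 'm, 'd) module_scheme \<Rightarrow> bool" where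
  "fg_free R M \<longleftrightarrow> left_module R M \<and> (\<exists>B. finite_basis R M B)"


section \<open>The integral monoid ring and its trivial module\<close>

text \<open>
  Elements of the monoid ring are the finitely supported integer functions on the monoid,
  extended by zero outside the carrier.
\<close>

definition monoid_ring :: "('a, 'b) monoid_scheme \<Rightarrow> ('a \<Rightarrow> int) ring" where
  "monoid_ring S =
     \<lparr>carrier = {f. finite {s. f s \<noteq> 0} \<and> {s. f s \<noteq> 0} \<subseteq> carrier S},
      mult = (\<lambda>f g s. \<Sum>a | f a \<noteq> 0. \<Sum>b | g b \<noteq> 0. if a \<otimes>\<^bsub>S\<^esub> b = s then f a * g b else 0),
      one = (\<lambda>s. if s = \<one>\<^bsub>S\<^esub> then 1 else 0),
      zero = (\<lambda>s. 0),
      add = (\<lambda>f g s. f s + g s)\<rparr>"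

definition augmentation :: "('a \<Rightarrow> int) \<Rightarrow> int" where
  "augmentation f = (\<Sum>s | f s \<noteq> 0. f s)"

definition trivial_module :: "('a \<Rightarrow> int, int) module" where
  "trivial_module =
     \<lparr>carrier = UNIV, mult = (*), one = 1, zero = 0, add = (+), smult = (\<lambda>f z. augmentation f * z)\<rparr>"


section \<open>Type left-FP\<open>\<^sub>n\<close>\<close>

text \<open>
  An exact sequence \<open>A n \<rightarrow> \<dots> \<rightarrow> A 0 \<rightarrow> \<int> \<rightarrow> 0\<close> with finitely generated free terms. The map
  \<open>d i\<close> goes from \<open>A (Suc i)\<close> to \<open>A i\<close>; the values \<open>A i\<close> for \<open>i > n\<close> and \<open>d i\<close> for \<open>i \<ge> n\<close> are
  irrelevant.
\<close>

definition partial_free_resolution ::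
  "('a, 'b) monoid_scheme \<Rightarrow> nat \<Rightarrow> (nat \<Rightarrow> ('a \<Rightarrow> int, 'm) module) \<Rightarrow> (nat \<Rightarrow> 'm \<Rightarrow> 'm) \<Rightarrow>
    ('m \<Rightarrow> int) \<Rightarrow> bool" where
  "partial_free_resolution S n A d \<epsilon> \<longleftrightarrow>
     (\<forall>i\<le>n. fg_free (monoid_ring S) (A i)) \<and>
     \<epsilon> \<in> left_module_hom (monoid_ring S) (A 0) trivial_module \<and>
     (\<forall>i<n. d i \<in> left_module_hom (monoid_ring S) (A (Suc i)) (A i)) \<and>
     \<epsilon> ` carrier (A 0) = carrier (trivial_module :: ('a \<Rightarrow> int, int) module) \<and>
     (0 < n \<longrightarrow> d 0 ` carrier (A 1) =
        module_kernel (A 0) (trivial_module :: ('a \<Rightarrow> int, int) module) \<epsilon>) \<and>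
     (\<forall>i. Suc i < n \<longrightarrow> d (Suc i) ` carrier (A (Suc (Suc i))) =
        module_kernel (A (Suc i)) (A i) (d i))"

text \<open>
  An existential quantifier cannot range over types, so the modules are taken with elements in
  \<open>nat \<Rightarrow> 'a \<Rightarrow> int\<close>. This type has room for every finite power of the monoid ring;
  \<open>left_FP_I\<close> below shows that modules with elements of any other type give nothing more.
  For a group, type \<open>FP\<^sub>n\<close> is \<open>left_FP\<close>, since the left and right versions are equivalent there.
\<close>

definition left_FP :: "('a, 'b) monoid_scheme \<Rightarrow> nat \<Rightarrow> bool" where
  "left_FP S n \<longleftrightarrow> (\<exists>(A :: nat \<Rightarrow> ('a \<Rightarrow> int, nat \<Rightarrow> 'a \<Rightarrow> int) module) d \<epsilon>.
     partial_free_resolution S n A d \<epsilon>)"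

definition is_identity :: "'a \<Rightarrow> ('a, 'b) monoid_scheme \<Rightarrow> bool" where
  "is_identity e U \<longleftrightarrow> e \<in> carrier U \<and> (\<forall>x\<in>carrier U. e \<otimes>\<^bsub>U\<^esub> x = x \<and> x \<otimes>\<^bsub>U\<^esub> e = x)"

definition adjoin_identity :: "('a, 'b) monoid_scheme \<Rightarrow> 'a option monoid" where
  "adjoin_identity U =
     \<lparr>carrier = insert None (Some ` carrier U),
      mult = (\<lambda>x y. case x of None \<Rightarrow> y
                | Some u \<Rightarrow> (case y of None \<Rightarrow> x | Some v \<Rightarrow> Some (u \<otimes>\<^bsub>U\<^esub> v))),
      one = None\<rparr>"

text \<open>An identity is adjoined only if there is none already.\<close>

definition semigroup_left_FP :: "('a, 'b) monoid_scheme \<Rightarrow> nat \<Rightarrow> bool" where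
  "semigroup_left_FP U n \<longleftrightarrow>
     (if \<exists>e. is_identity e U then left_FP (U\<lparr>one := THE e. is_identity e U\<rparr>) n
      else left_FP (adjoin_identity U) n)"


section \<open>Consistency of the definitions\<close>

lemma monoid_ring_mult:
  assumes "finite A" "finite B" "{s. f s \<noteq> 0} \<subseteq> A" "{s. g s \<noteq> 0} \<subseteq> B"
  shows "(f \<otimes>\<^bsub>monoid_ring S\<^esub> g) s =
    (\<Sum>a\<in>A. \<Sum>b\<in>B. if a \<otimes>\<^bsub>S\<^esub> b = s then f a * g b else 0)"
proof -
  have "(\<Sum>a | f a \<noteq> 0. \<Sum>b | g b \<noteq> 0. if a \<otimes>\<^bsub>S\<^esub> b = s then f a * g b else 0) =
      (\<Sum>a | f a \<noteq> 0. \<Sum>b\<in>B. if a \<otimes>\<^bsub>S\<^esub> b = s then f a * g b else 0)"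
    using assms by (intro sum.cong sum.mono_neutral_left) auto
  also have "\<dots> = (\<Sum>a\<in>A. \<Sum>b\<in>B. if a \<otimes>\<^bsub>S\<^esub> b = s then f a * g b else 0)"
    using assms by (intro sum.mono_neutral_left) (auto intro!: sum.neutral split: if_splits)
  finally show ?thesis by (simp add: monoid_ring_def)
qed

lemma monoid_ring_mult_support:
  assumes "f \<in> carrier (monoid_ring S)" "g \<in> carrier (monoid_ring S)"
  shows "{s. (f \<otimes>\<^bsub>monoid_ring S\<^esub> g) s \<noteq> 0} \<subseteq>
    (\<lambda>(a, b). a \<otimes>\<^bsub>S\<^esub> b) ` ({s. f s \<noteq> 0} \<times> {s. g s \<noteq> 0})"
proof
  fix s assume "s \<in> {s. (f \<otimes>\<^bsub>monoid_ring S\<^esub> g) s \<noteq> 0}"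
  then have "(\<Sum>a | f a \<noteq> 0. \<Sum>b | g b \<noteq> 0. if a \<otimes>\<^bsub>S\<^esub> b = s then f a * g b else 0) \<noteq> 0"
    by (simp add: monoid_ring_def)
  then obtain a where a: "f a \<noteq> 0"
    and "(\<Sum>b | g b \<noteq> 0. if a \<otimes>\<^bsub>S\<^esub> b = s then f a * g b else 0) \<noteq> 0"
    using sum.not_neutral_contains_not_neutral by blast
  then obtain b where "g b \<noteq> 0" "(if a \<otimes>\<^bsub>S\<^esub> b = s then f a * g b else 0) \<noteq> 0"
    using sum.not_neutral_contains_not_neutral by blast
  with a show "s \<in> (\<lambda>(a, b). a \<otimes>\<^bsub>S\<^esub> b) ` ({s. f s \<noteq> 0} \<times> {s. g s \<noteq> 0})"
    by (auto split: if_splits)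
qed

lemma monoid_ring_carrierD:
  assumes "f \<in> carrier (monoid_ring S)"
  shows "finite {s. f s \<noteq> 0}" "{s. f s \<noteq> 0} \<subseteq> carrier S"
  using assms by (auto simp: monoid_ring_def)

lemma monoid_ring_mult_closed:
  assumes "monoid S" "f \<in> carrier (monoid_ring S)" "g \<in> carrier (monoid_ring S)"
  shows "f \<otimes>\<^bsub>monoid_ring S\<^esub> g \<in> carrier (monoid_ring S)"
proof -
  interpret S: monoid S by fact
  note sup = monoid_ring_mult_support[OF assms(2,3)]
  have "finite {s. (f \<otimes>\<^bsub>monoid_ring S\<^esub> g) s \<noteq> 0}"
    by (rule finite_subset[OF sup])
       (use monoid_ring_carrierD[OF assms(2)] monoid_ring_carrierD[OF assms(3)] in auto)
  moreover have "{s. (f \<otimes>\<^bsub>monoid_ring S\<^esub> g) s \<noteq> 0} \<subseteq> carrier S"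
    by (rule subset_trans[OF sup])
       (use monoid_ring_carrierD[OF assms(2)] monoid_ring_carrierD[OF assms(3)] in auto)
  moreover have "carrier (monoid_ring S) = {f. finite {s. f s \<noteq> 0} \<and> {s. f s \<noteq> 0} \<subseteq> carrier S}"
    by (simp add: monoid_ring_def)
  ultimately show ?thesis by blast
qed

lemma sum_rotate:
  "(\<Sum>x\<in>P. \<Sum>a\<in>F. \<Sum>b\<in>G. t x a b) = (\<Sum>a\<in>F. \<Sum>b\<in>G. \<Sum>x\<in>P. t x a b)"
  by (rule trans[OF sum.swap]) (rule sum.cong[OF refl], rule sum.swap)

lemma monoid_ring_assoc:
  assumes "monoid S" "f \<in> carrier (monoid_ring S)" "g \<in> carrier (monoid_ring S)"
    "h \<in> carrier (monoid_ring S)"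
  shows "(f \<otimes>\<^bsub>monoid_ring S\<^esub> g) \<otimes>\<^bsub>monoid_ring S\<^esub> h =
    f \<otimes>\<^bsub>monoid_ring S\<^esub> (g \<otimes>\<^bsub>monoid_ring S\<^esub> h)"
proof
  fix s
  interpret S: monoid S by fact
  define F G H where "F = {s. f s \<noteq> 0}" and "G = {s. g s \<noteq> 0}" and "H = {s. h s \<noteq> 0}"
  define P Q where "P = (\<lambda>(a, b). a \<otimes>\<^bsub>S\<^esub> b) ` (F \<times> G)" and "Q = (\<lambda>(a, b). a \<otimes>\<^bsub>S\<^esub> b) ` (G \<times> H)"
  have fin: "finite F" "finite G" "finite H" "finite P" "finite Q"
    and sub: "F \<subseteq> carrier S" "G \<subseteq> carrier S" "H \<subseteq> carrier S"
    using assms(2-4)[THEN monoid_ring_carrierD(1)] assms(2-4)[THEN monoid_ring_carrierD(2)]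
    by (simp_all add: F_def G_def H_def P_def Q_def)
  have fg: "(f \<otimes>\<^bsub>monoid_ring S\<^esub> g) x =
      (\<Sum>a\<in>F. \<Sum>b\<in>G. if a \<otimes>\<^bsub>S\<^esub> b = x then f a * g b else 0)" for x
    by (rule monoid_ring_mult) (use fin in \<open>auto simp: F_def G_def\<close>)
  have gh: "(g \<otimes>\<^bsub>monoid_ring S\<^esub> h) x =
      (\<Sum>a\<in>G. \<Sum>b\<in>H. if a \<otimes>\<^bsub>S\<^esub> b = x then g a * h b else 0)" for x
    by (rule monoid_ring_mult) (use fin in \<open>auto simp: G_def H_def\<close>)
  have "((f \<otimes>\<^bsub>monoid_ring S\<^esub> g) \<otimes>\<^bsub>monoid_ring S\<^esub> h) s =
      (\<Sum>x\<in>P. \<Sum>c\<in>H. if x \<otimes>\<^bsub>S\<^esub> c = s then (f \<otimes>\<^bsub>monoid_ring S\<^esub> g) x * h c else 0)"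
    by (rule monoid_ring_mult)
       (use fin monoid_ring_mult_support[OF assms(2,3)] in \<open>auto simp: H_def P_def F_def G_def\<close>)
  also have "\<dots> = (\<Sum>x\<in>P. \<Sum>c\<in>H. \<Sum>a\<in>F. \<Sum>b\<in>G.
      if a \<otimes>\<^bsub>S\<^esub> b = x then (if a \<otimes>\<^bsub>S\<^esub> b \<otimes>\<^bsub>S\<^esub> c = s then f a * g b * h c else 0) else 0)"
    by (intro sum.cong refl) (auto simp: fg sum_distrib_right intro!: sum.cong sum.neutral)
  also have "\<dots> = (\<Sum>c\<in>H. \<Sum>a\<in>F. \<Sum>b\<in>G. \<Sum>x\<in>P.
      if a \<otimes>\<^bsub>S\<^esub> b = x then (if a \<otimes>\<^bsub>S\<^esub> b \<otimes>\<^bsub>S\<^esub> c = s then f a * g b * h c else 0) else 0)"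
    by (rule trans[OF sum.swap]) (rule sum.cong[OF refl], rule sum_rotate)
  also have "\<dots> = (\<Sum>c\<in>H. \<Sum>a\<in>F. \<Sum>b\<in>G.
      if a \<otimes>\<^bsub>S\<^esub> b \<otimes>\<^bsub>S\<^esub> c = s then f a * g b * h c else 0)"
    by (intro sum.cong refl) (use fin in \<open>force simp: P_def\<close>)
  also have "\<dots> = (\<Sum>a\<in>F. \<Sum>b\<in>G. \<Sum>c\<in>H.
      if a \<otimes>\<^bsub>S\<^esub> b \<otimes>\<^bsub>S\<^esub> c = s then f a * g b * h c else 0)"
    by (rule sum_rotate)
  also have "\<dots> = (\<Sum>a\<in>F. \<Sum>b\<in>G. \<Sum>c\<in>H.
      if a \<otimes>\<^bsub>S\<^esub> (b \<otimes>\<^bsub>S\<^esub> c) = s then f a * (g b * h c) else 0)"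
    by (intro sum.cong refl) (use sub in \<open>auto simp: S.m_assoc subset_iff\<close>)
  also have "\<dots> = (\<Sum>a\<in>F. \<Sum>b\<in>G. \<Sum>c\<in>H. \<Sum>x\<in>Q.
      if b \<otimes>\<^bsub>S\<^esub> c = x then (if a \<otimes>\<^bsub>S\<^esub> (b \<otimes>\<^bsub>S\<^esub> c) = s then f a * (g b * h c) else 0) else 0)"
    by (intro sum.cong refl) (use fin in \<open>force simp: Q_def\<close>)
  also have "\<dots> = (\<Sum>a\<in>F. \<Sum>x\<in>Q. \<Sum>b\<in>G. \<Sum>c\<in>H.
      if b \<otimes>\<^bsub>S\<^esub> c = x then (if a \<otimes>\<^bsub>S\<^esub> (b \<otimes>\<^bsub>S\<^esub> c) = s then f a * (g b * h c) else 0) else 0)"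
    by (rule sum.cong[OF refl], rule sum_rotate[symmetric])
  also have "\<dots> = (\<Sum>a\<in>F. \<Sum>x\<in>Q.
      if a \<otimes>\<^bsub>S\<^esub> x = s then f a * (g \<otimes>\<^bsub>monoid_ring S\<^esub> h) x else 0)"
    by (intro sum.cong refl) (auto simp: gh sum_distrib_left intro!: sum.cong sum.neutral)
  also have "\<dots> = (f \<otimes>\<^bsub>monoid_ring S\<^esub> (g \<otimes>\<^bsub>monoid_ring S\<^esub> h)) s"
    by (rule monoid_ring_mult[symmetric])
       (use fin monoid_ring_mult_support[OF assms(3,4)] in \<open>auto simp: F_def Q_def H_def G_def\<close>)
  finally show "((f \<otimes>\<^bsub>monoid_ring S\<^esub> g) \<otimes>\<^bsub>monoid_ring S\<^esub> h) s =
      (f \<otimes>\<^bsub>monoid_ring S\<^esub> (g \<otimes>\<^bsub>monoid_ring S\<^esub> h)) s" .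
qed

lemma monoid_ring_ring:
  assumes "monoid S"
  shows "ring (monoid_ring S)"
proof -
  interpret S: monoid S by fact
  let ?R = "monoid_ring S"
  have carr: "carrier ?R = {f. finite {s. f s \<noteq> 0} \<and> {s. f s \<noteq> 0} \<subseteq> carrier S}"
    and add: "f \<oplus>\<^bsub>?R\<^esub> g = (\<lambda>s. f s + g s)"
    and zero: "\<zero>\<^bsub>?R\<^esub> = (\<lambda>s. 0)"
    and one: "\<one>\<^bsub>?R\<^esub> = (\<lambda>s. if s = \<one>\<^bsub>S\<^esub> then 1 else 0)" for f g
    by (simp_all add: monoid_ring_def)
  have ag: "abelian_group ?R"
  proof (rule abelian_groupI)
    fix f g assume f: "f \<in> carrier ?R" and g: "g \<in> carrier ?R"
    have sub: "{s. f s + g s \<noteq> 0} \<subseteq> {s. f s \<noteq> 0} \<union> {s. g s \<noteq> 0}" by auto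
    then have "finite {s. f s + g s \<noteq> 0}"
      by (rule finite_subset) (use f g carr in auto)
    with sub show "f \<oplus>\<^bsub>?R\<^esub> g \<in> carrier ?R" using f g by (auto simp: carr add)
  next
    fix f assume "f \<in> carrier ?R"
    then have "(\<lambda>s. - f s) \<in> carrier ?R" by (simp add: carr)
    then show "\<exists>g\<in>carrier ?R. g \<oplus>\<^bsub>?R\<^esub> f = \<zero>\<^bsub>?R\<^esub>"
      by (rule bexI[rotated]) (simp add: add zero)
  qed (auto simp: carr add zero)
  show ?thesis
  proof (rule ringI[OF ag])
    show "monoid ?R"
    proof
      show "\<one>\<^bsub>?R\<^esub> \<in> carrier ?R" by (auto simp: one carr)
      fix f assume f: "f \<in> carrier ?R"
      have fs: "finite {s. f s \<noteq> 0}" "{s. f s \<noteq> 0} \<subseteq> carrier S"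
        using monoid_ring_carrierD[OF f] by auto
      show "\<one>\<^bsub>?R\<^esub> \<otimes>\<^bsub>?R\<^esub> f = f"
      proof
        fix s
        have "(\<one>\<^bsub>?R\<^esub> \<otimes>\<^bsub>?R\<^esub> f) s = (\<Sum>a\<in>{\<one>\<^bsub>S\<^esub>}. \<Sum>b | f b \<noteq> 0.
            if a \<otimes>\<^bsub>S\<^esub> b = s then \<one>\<^bsub>?R\<^esub> a * f b else 0)"
          by (rule monoid_ring_mult) (use fs in \<open>auto simp: one\<close>)
        also have "\<dots> = (\<Sum>b | f b \<noteq> 0. if b = s then f b else 0)"
          using fs by (auto simp: one subset_iff intro!: sum.cong)
        also have "\<dots> = f s" using fs by simp
        finally show "(\<one>\<^bsub>?R\<^esub> \<otimes>\<^bsub>?R\<^esub> f) s = f s" .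
      qed
      show "f \<otimes>\<^bsub>?R\<^esub> \<one>\<^bsub>?R\<^esub> = f"
      proof
        fix s
        have "(f \<otimes>\<^bsub>?R\<^esub> \<one>\<^bsub>?R\<^esub>) s = (\<Sum>a | f a \<noteq> 0. \<Sum>b\<in>{\<one>\<^bsub>S\<^esub>}.
            if a \<otimes>\<^bsub>S\<^esub> b = s then f a * \<one>\<^bsub>?R\<^esub> b else 0)"
          by (rule monoid_ring_mult) (use fs in \<open>auto simp: one\<close>)
        also have "\<dots> = (\<Sum>b | f b \<noteq> 0. if b = s then f b else 0)"
          using fs by (auto simp: one subset_iff intro!: sum.cong)
        also have "\<dots> = f s" using fs by simp
        finally show "(f \<otimes>\<^bsub>?R\<^esub> \<one>\<^bsub>?R\<^esub>) s = f s" .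
      qed
    qed (use monoid_ring_mult_closed[OF assms] monoid_ring_assoc[OF assms] in auto)
  next
    fix f g h assume f: "f \<in> carrier ?R" and g: "g \<in> carrier ?R" and h: "h \<in> carrier ?R"
    let ?A = "{s. f s \<noteq> 0} \<union> {s. g s \<noteq> 0}" and ?B = "{s. h s \<noteq> 0}"
    have fin: "finite ?A" "finite ?B" using f g h by (auto simp: carr)
    show "(f \<oplus>\<^bsub>?R\<^esub> g) \<otimes>\<^bsub>?R\<^esub> h = f \<otimes>\<^bsub>?R\<^esub> h \<oplus>\<^bsub>?R\<^esub> g \<otimes>\<^bsub>?R\<^esub> h"
    proof
      fix s
      have 1: "((f \<oplus>\<^bsub>?R\<^esub> g) \<otimes>\<^bsub>?R\<^esub> h) s = (\<Sum>a\<in>?A. \<Sum>b\<in>?B.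
          if a \<otimes>\<^bsub>S\<^esub> b = s then (f \<oplus>\<^bsub>?R\<^esub> g) a * h b else 0)"
        by (rule monoid_ring_mult[OF fin]) (auto simp: add)
      have 2: "(f \<otimes>\<^bsub>?R\<^esub> h) s = (\<Sum>a\<in>?A. \<Sum>b\<in>?B. if a \<otimes>\<^bsub>S\<^esub> b = s then f a * h b else 0)"
        by (rule monoid_ring_mult[OF fin]) auto
      have 3: "(g \<otimes>\<^bsub>?R\<^esub> h) s = (\<Sum>a\<in>?A. \<Sum>b\<in>?B. if a \<otimes>\<^bsub>S\<^esub> b = s then g a * h b else 0)"
        by (rule monoid_ring_mult[OF fin]) auto
      have "((f \<oplus>\<^bsub>?R\<^esub> g) \<otimes>\<^bsub>?R\<^esub> h) s = (f \<otimes>\<^bsub>?R\<^esub> h) s + (g \<otimes>\<^bsub>?R\<^esub> h) s"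
        unfolding 1 2 3 sum.distrib[symmetric]
        by (intro sum.cong refl) (simp add: add algebra_simps)
      then show "((f \<oplus>\<^bsub>?R\<^esub> g) \<otimes>\<^bsub>?R\<^esub> h) s = (f \<otimes>\<^bsub>?R\<^esub> h \<oplus>\<^bsub>?R\<^esub> g \<otimes>\<^bsub>?R\<^esub> h) s"
        by (simp add: add)
    qed
    show "h \<otimes>\<^bsub>?R\<^esub> (f \<oplus>\<^bsub>?R\<^esub> g) = h \<otimes>\<^bsub>?R\<^esub> f \<oplus>\<^bsub>?R\<^esub> h \<otimes>\<^bsub>?R\<^esub> g"
    proof
      fix s
      have 1: "(h \<otimes>\<^bsub>?R\<^esub> (f \<oplus>\<^bsub>?R\<^esub> g)) s = (\<Sum>a\<in>?B. \<Sum>b\<in>?A.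
          if a \<otimes>\<^bsub>S\<^esub> b = s then h a * (f \<oplus>\<^bsub>?R\<^esub> g) b else 0)"
        by (rule monoid_ring_mult[OF fin(2,1)]) (auto simp: add)
      have 2: "(h \<otimes>\<^bsub>?R\<^esub> f) s = (\<Sum>a\<in>?B. \<Sum>b\<in>?A. if a \<otimes>\<^bsub>S\<^esub> b = s then h a * f b else 0)"
        by (rule monoid_ring_mult[OF fin(2,1)]) auto
      have 3: "(h \<otimes>\<^bsub>?R\<^esub> g) s = (\<Sum>a\<in>?B. \<Sum>b\<in>?A. if a \<otimes>\<^bsub>S\<^esub> b = s then h a * g b else 0)"
        by (rule monoid_ring_mult[OF fin(2,1)]) auto
      have "(h \<otimes>\<^bsub>?R\<^esub> (f \<oplus>\<^bsub>?R\<^esub> g)) s = (h \<otimes>\<^bsub>?R\<^esub> f) s + (h \<otimes>\<^bsub>?R\<^esub> g) s"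
        unfolding 1 2 3 sum.distrib[symmetric]
        by (intro sum.cong refl) (simp add: add algebra_simps)
      then show "(h \<otimes>\<^bsub>?R\<^esub> (f \<oplus>\<^bsub>?R\<^esub> g)) s = (h \<otimes>\<^bsub>?R\<^esub> f \<oplus>\<^bsub>?R\<^esub> h \<otimes>\<^bsub>?R\<^esub> g) s"
        by (simp add: add)
    qed
  qed
qed

lemma augmentation_superset:
  assumes "finite A" "{s. f s \<noteq> 0} \<subseteq> A"
  shows "augmentation f = sum f A"
  unfolding augmentation_def using assms by (intro sum.mono_neutral_left) auto

lemma augmentation_mult:
  assumes "monoid S" "f \<in> carrier (monoid_ring S)" "g \<in> carrier (monoid_ring S)"
  shows "augmentation (f \<otimes>\<^bsub>monoid_ring S\<^esub> g) = augmentation f * augmentation g"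
proof -
  define F G where "F = {s. f s \<noteq> 0}" and "G = {s. g s \<noteq> 0}"
  define P where "P = (\<lambda>(a, b). a \<otimes>\<^bsub>S\<^esub> b) ` (F \<times> G)"
  have fin: "finite F" "finite G" "finite P"
    using assms(2,3)[THEN monoid_ring_carrierD(1)] by (simp_all add: F_def G_def P_def)
  have "augmentation (f \<otimes>\<^bsub>monoid_ring S\<^esub> g) = (\<Sum>x\<in>P. (f \<otimes>\<^bsub>monoid_ring S\<^esub> g) x)"
    by (rule augmentation_superset[OF fin(3)])
       (use monoid_ring_mult_support[OF assms(2,3)] in \<open>simp add: P_def F_def G_def\<close>)
  also have "\<dots> = (\<Sum>x\<in>P. \<Sum>a\<in>F. \<Sum>b\<in>G. if a \<otimes>\<^bsub>S\<^esub> b = x then f a * g b else 0)"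
    by (intro sum.cong refl monoid_ring_mult) (use fin in \<open>auto simp: F_def G_def\<close>)
  also have "\<dots> = (\<Sum>a\<in>F. \<Sum>b\<in>G. \<Sum>x\<in>P. if a \<otimes>\<^bsub>S\<^esub> b = x then f a * g b else 0)"
    by (rule sum_rotate)
  also have "\<dots> = (\<Sum>a\<in>F. \<Sum>b\<in>G. f a * g b)"
    by (intro sum.cong refl) (use fin in \<open>force simp: P_def\<close>)
  also have "\<dots> = augmentation f * augmentation g"
    by (simp add: augmentation_def F_def G_def sum_product)
  finally show ?thesis .
qed

lemma trivial_module_left_module:
  assumes "monoid S"
  shows "left_module (monoid_ring S) (trivial_module :: ('a \<Rightarrow> int, int) module)"
proof -
  interpret R: ring "monoid_ring S" by (rule monoid_ring_ring[OF assms])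
  interpret Z: abelian_group "trivial_module :: ('a \<Rightarrow> int, int) module"
  proof (rule abelian_groupI)
    fix x :: int
    show "\<exists>y\<in>carrier (trivial_module :: ('a \<Rightarrow> int, int) module).
        y \<oplus>\<^bsub>trivial_module :: ('a \<Rightarrow> int, int) module\<^esub> x =
        \<zero>\<^bsub>trivial_module :: ('a \<Rightarrow> int, int) module\<^esub>"
      by (rule bexI[of _ "- x"]) (auto simp: trivial_module_def)
  qed (auto simp: trivial_module_def)
  have add: "augmentation (f \<oplus>\<^bsub>monoid_ring S\<^esub> g) = augmentation f + augmentation g"
    if "f \<in> carrier (monoid_ring S)" "g \<in> carrier (monoid_ring S)" for f g
  proof -
    let ?A = "{s. f s \<noteq> 0} \<union> {s. g s \<noteq> 0}"
    have fin: "finite ?A" using that by (auto simp: monoid_ring_def)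
    have "augmentation (f \<oplus>\<^bsub>monoid_ring S\<^esub> g) = sum (f \<oplus>\<^bsub>monoid_ring S\<^esub> g) ?A"
      by (rule augmentation_superset[OF fin]) (auto simp: monoid_ring_def)
    also have "\<dots> = sum f ?A + sum g ?A" by (simp add: monoid_ring_def sum.distrib)
    also have "sum f ?A = augmentation f" by (rule augmentation_superset[OF fin, symmetric]) auto
    also have "sum g ?A = augmentation g" by (rule augmentation_superset[OF fin, symmetric]) auto
    finally show ?thesis .
  qed
  have one: "augmentation \<one>\<^bsub>monoid_ring S\<^esub> = 1"
    by (subst augmentation_superset[of "{\<one>\<^bsub>S\<^esub>}"]) (auto simp: monoid_ring_def)
  show ?thesis
    by unfold_locales
       (auto simp: trivial_module_def add one augmentation_mult[OF assms] algebra_simps)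
qed

lemma adjoin_identity_monoid:
  assumes "mult_semigroup U"
  shows "monoid (adjoin_identity U)"
proof -
  interpret mult_semigroup U by fact
  show ?thesis
    by unfold_locales
       (auto simp: adjoin_identity_def m_closed m_assoc split: option.splits)
qed


section \<open>Independence of the element type of the modules\<close>

definition transport :: "('m \<Rightarrow> 'k) \<Rightarrow> ('r, 'm) module \<Rightarrow> ('r, 'k) module" where
  "transport \<phi> M =
     \<lparr>carrier = \<phi> ` carrier M,
      mult = (\<lambda>x y. x),
      one = \<phi> \<one>\<^bsub>M\<^esub>,
      zero = \<phi> \<zero>\<^bsub>M\<^esub>,
      add = (\<lambda>x y. \<phi> (inv_into (carrier M) \<phi> x \<oplus>\<^bsub>M\<^esub> inv_into (carrier M) \<phi> y)),
      smult = (\<lambda>a x. \<phi> (a \<odot>\<^bsub>M\<^esub> inv_into (carrier M) \<phi> x))\<rparr>"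

lemma transport_simps:
  assumes "inj_on \<phi> (carrier M)"
  shows "carrier (transport \<phi> M) = \<phi> ` carrier M"
    and "\<zero>\<^bsub>transport \<phi> M\<^esub> = \<phi> \<zero>\<^bsub>M\<^esub>"
    and "\<lbrakk>x \<in> carrier M; y \<in> carrier M\<rbrakk> \<Longrightarrow> \<phi> x \<oplus>\<^bsub>transport \<phi> M\<^esub> \<phi> y = \<phi> (x \<oplus>\<^bsub>M\<^esub> y)"
    and "x \<in> carrier M \<Longrightarrow> a \<odot>\<^bsub>transport \<phi> M\<^esub> \<phi> x = \<phi> (a \<odot>\<^bsub>M\<^esub> x)"
  using assms by (simp_all add: transport_def)

lemma transport_left_module:
  assumes "left_module R M" and inj: "inj_on \<phi> (carrier M)"
  shows "left_module R (transport \<phi> M)"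
proof -
  interpret left_module R M by fact
  note tr = transport_simps[OF inj]
  have "abelian_group (transport \<phi> M)"
  proof (rule abelian_groupI)
    fix x assume "x \<in> carrier (transport \<phi> M)"
    then obtain u where u: "u \<in> carrier M" "x = \<phi> u" by (auto simp: tr)
    show "\<exists>y\<in>carrier (transport \<phi> M). y \<oplus>\<^bsub>transport \<phi> M\<^esub> x = \<zero>\<^bsub>transport \<phi> M\<^esub>"
      by (rule bexI[of _ "\<phi> (\<ominus>\<^bsub>M\<^esub> u)"]) (use u in \<open>auto simp: tr M.l_neg\<close>)
  qed (auto simp: tr M.a_ac)
  then interpret T: abelian_group "transport \<phi> M" .
  show ?thesis
    by unfold_locales
       (auto simp: tr smult_closed smult_l_distr smult_r_distr smult_assoc smult_one)
qed

lemma transport_lincomb: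
  assumes "left_module R M" and inj: "inj_on \<phi> (carrier M)"
    and "finite B" "B \<subseteq> carrier M" "c \<in> \<phi> ` B \<rightarrow> carrier R"
  shows "(\<Oplus>\<^bsub>transport \<phi> M\<^esub>b\<in>\<phi> ` B. c b \<odot>\<^bsub>transport \<phi> M\<^esub> b) = \<phi> (\<Oplus>\<^bsub>M\<^esub>b\<in>B. c (\<phi> b) \<odot>\<^bsub>M\<^esub> b)"
  using assms(3-5)
proof (induction B rule: finite_induct)
  interpret left_module R M by fact
  interpret T: left_module R "transport \<phi> M" by (rule transport_left_module) fact+
  note tr = transport_simps[OF inj]
  {
    case empty
    then show ?case by (simp add: tr)
  next
    case (insert b B)
    have b: "b \<in> carrier M" "c (\<phi> b) \<in> carrier R" and B: "B \<subseteq> carrier M"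
      using insert.prems by auto
    have nin: "\<phi> b \<notin> \<phi> ` B"
      using insert.hyps(2) b B inj by (auto dest: inj_onD)
    have cB: "(\<lambda>b. c (\<phi> b) \<odot>\<^bsub>M\<^esub> b) \<in> B \<rightarrow> carrier M"
      using insert.prems by (auto intro!: smult_closed)
    have cT: "(\<lambda>b. c b \<odot>\<^bsub>transport \<phi> M\<^esub> b) \<in> \<phi> ` B \<rightarrow> carrier (transport \<phi> M)"
      using insert.prems by (auto simp: tr smult_closed Pi_iff subset_iff)
    have "(\<Oplus>\<^bsub>transport \<phi> M\<^esub>b\<in>insert (\<phi> b) (\<phi> ` B). c b \<odot>\<^bsub>transport \<phi> M\<^esub> b) =
        c (\<phi> b) \<odot>\<^bsub>transport \<phi> M\<^esub> \<phi> b \<oplus>\<^bsub>transport \<phi> M\<^esub>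
        (\<Oplus>\<^bsub>transport \<phi> M\<^esub>b\<in>\<phi> ` B. c b \<odot>\<^bsub>transport \<phi> M\<^esub> b)"
      by (rule T.M.finsum_insert[OF _ nin cT])
         (use insert.hyps b in \<open>auto simp: tr smult_closed\<close>)
    also have "\<dots> = \<phi> (c (\<phi> b) \<odot>\<^bsub>M\<^esub> b \<oplus>\<^bsub>M\<^esub> (\<Oplus>\<^bsub>M\<^esub>b\<in>B. c (\<phi> b) \<odot>\<^bsub>M\<^esub> b))"
      using insert b cB by (simp add: tr smult_closed M.finsum_closed)
    also have "c (\<phi> b) \<odot>\<^bsub>M\<^esub> b \<oplus>\<^bsub>M\<^esub> (\<Oplus>\<^bsub>M\<^esub>b\<in>B. c (\<phi> b) \<odot>\<^bsub>M\<^esub> b) =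
        (\<Oplus>\<^bsub>M\<^esub>b\<in>insert b B. c (\<phi> b) \<odot>\<^bsub>M\<^esub> b)"
      using insert.hyps b cB by (intro M.finsum_insert[symmetric]) (auto intro!: smult_closed)
    finally show ?case by simp
  }
qed

lemma transport_finite_basis:
  assumes "left_module R M" and inj: "inj_on \<phi> (carrier M)" and "finite_basis R M B"
  shows "finite_basis R (transport \<phi> M) (\<phi> ` B)"
proof -
  interpret left_module R M by fact
  have fin: "finite B" and B: "B \<subseteq> carrier M"
    and uniq: "\<And>x. x \<in> carrier M \<Longrightarrow>
      \<exists>!c. c \<in> B \<rightarrow>\<^sub>E carrier R \<and> x = (\<Oplus>\<^bsub>M\<^esub>b\<in>B. c b \<odot>\<^bsub>M\<^esub> b)"
    using assms(3) by (auto simp: finite_basis_def)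
  note tr = transport_simps[OF inj]
  have comb: "(\<Oplus>\<^bsub>transport \<phi> M\<^esub>b\<in>\<phi> ` B. c b \<odot>\<^bsub>transport \<phi> M\<^esub> b) =
      \<phi> (\<Oplus>\<^bsub>M\<^esub>b\<in>B. c (\<phi> b) \<odot>\<^bsub>M\<^esub> b)" if "c \<in> \<phi> ` B \<rightarrow> carrier R" for c
    by (rule transport_lincomb[OF assms(1) inj fin B that])
  have closed: "(\<Oplus>\<^bsub>M\<^esub>b\<in>B. c b \<odot>\<^bsub>M\<^esub> b) \<in> carrier M" if "c \<in> B \<rightarrow> carrier R" for c
    using that B by (intro M.finsum_closed) (auto intro!: smult_closed)
  have cong: "(\<Oplus>\<^bsub>M\<^esub>b\<in>B. c b \<odot>\<^bsub>M\<^esub> b) = (\<Oplus>\<^bsub>M\<^esub>b\<in>B. c' b \<odot>\<^bsub>M\<^esub> b)"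
    if "c' \<in> B \<rightarrow> carrier R" "\<And>b. b \<in> B \<Longrightarrow> c b = c' b" for c c'
    using that B by (intro M.finsum_cong') (auto intro!: smult_closed)
  show ?thesis
    unfolding finite_basis_def
  proof (intro conjI ballI)
    show "finite (\<phi> ` B)" using fin by simp
    show "\<phi> ` B \<subseteq> carrier (transport \<phi> M)" using B by (auto simp: tr)
    fix x' assume "x' \<in> carrier (transport \<phi> M)"
    then obtain x where x: "x \<in> carrier M" "x' = \<phi> x" by (auto simp: tr)
    from uniq[OF x(1)] obtain c where c: "c \<in> B \<rightarrow>\<^sub>E carrier R" "x = (\<Oplus>\<^bsub>M\<^esub>b\<in>B. c b \<odot>\<^bsub>M\<^esub> b)"
      by blast
    define c' where "c' = restrict (\<lambda>b'. c (inv_into (carrier M) \<phi> b')) (\<phi> ` B)"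
    have c'\<phi>: "c' (\<phi> b) = c b" if "b \<in> B" for b
      using that B inj by (auto simp: c'_def)
    have c'_mem: "c' \<in> \<phi> ` B \<rightarrow>\<^sub>E carrier R"
      using c(1) B inj by (auto simp: c'_def PiE_def Pi_def subset_iff)
    show "\<exists>!c. c \<in> \<phi> ` B \<rightarrow>\<^sub>E carrier R \<and>
        x' = (\<Oplus>\<^bsub>transport \<phi> M\<^esub>b\<in>\<phi> ` B. c b \<odot>\<^bsub>transport \<phi> M\<^esub> b)"
    proof (rule ex1I[of _ c'])
      have "(\<Oplus>\<^bsub>M\<^esub>b\<in>B. c' (\<phi> b) \<odot>\<^bsub>M\<^esub> b) = x"
        unfolding c(2) by (rule cong) (use c(1) c'\<phi> in auto)
      moreover have "c' \<in> \<phi> ` B \<rightarrow> carrier R" using c'_mem by blast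
      ultimately show "c' \<in> \<phi> ` B \<rightarrow>\<^sub>E carrier R \<and>
          x' = (\<Oplus>\<^bsub>transport \<phi> M\<^esub>b\<in>\<phi> ` B. c' b \<odot>\<^bsub>transport \<phi> M\<^esub> b)"
        using c'_mem comb x by auto
    next
      fix d assume d: "d \<in> \<phi> ` B \<rightarrow>\<^sub>E carrier R \<and>
          x' = (\<Oplus>\<^bsub>transport \<phi> M\<^esub>b\<in>\<phi> ` B. d b \<odot>\<^bsub>transport \<phi> M\<^esub> b)"
      define e where "e = restrict (\<lambda>b. d (\<phi> b)) B"
      have e: "e \<in> B \<rightarrow>\<^sub>E carrier R" using d by (auto simp: e_def)
      have "d \<in> \<phi> ` B \<rightarrow> carrier R" using d by blast
      then have "\<phi> x = \<phi> (\<Oplus>\<^bsub>M\<^esub>b\<in>B. d (\<phi> b) \<odot>\<^bsub>M\<^esub> b)" using d x(2) comb by simp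
      moreover have "(\<Oplus>\<^bsub>M\<^esub>b\<in>B. d (\<phi> b) \<odot>\<^bsub>M\<^esub> b) = (\<Oplus>\<^bsub>M\<^esub>b\<in>B. e b \<odot>\<^bsub>M\<^esub> b)"
        by (rule cong) (use e in \<open>auto simp: e_def\<close>)
      moreover have "(\<Oplus>\<^bsub>M\<^esub>b\<in>B. e b \<odot>\<^bsub>M\<^esub> b) \<in> carrier M"
        by (rule closed) (use e in blast)
      ultimately have "x = (\<Oplus>\<^bsub>M\<^esub>b\<in>B. e b \<odot>\<^bsub>M\<^esub> b)"
        using x(1) inj by (auto dest: inj_onD)
      with uniq[OF x(1)] c e have "e = c" by blast
      then have "d (\<phi> b) = c' (\<phi> b)" if "b \<in> B" for b
        using that c'\<phi> by (auto simp: e_def)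
      then show "d = c'"
        using d c'_mem by (intro PiE_ext[of d "\<phi> ` B" "\<lambda>_. carrier R" c']) auto
    qed
  qed
qed

lemma transport_fg_free:
  assumes "fg_free R M" "inj_on \<phi> (carrier M)"
  shows "fg_free R (transport \<phi> M)"
  using assms transport_left_module transport_finite_basis unfolding fg_free_def by blast

lemma fg_free_embedding:
  fixes M :: "('a \<Rightarrow> int, 'm) module"
  assumes "fg_free R M"
  shows "\<exists>\<phi> :: 'm \<Rightarrow> nat \<Rightarrow> 'a \<Rightarrow> int. inj_on \<phi> (carrier M)"
proof -
  obtain B where "finite_basis R M B" using assms by (auto simp: fg_free_def)
  then have fin: "finite B"
    and ex: "\<And>x. x \<in> carrier M \<Longrightarrow> \<exists>c. c \<in> B \<rightarrow>\<^sub>E carrier R \<and> x = (\<Oplus>\<^bsub>M\<^esub>b\<in>B. c b \<odot>\<^bsub>M\<^esub> b)"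
    unfolding finite_basis_def by blast+
  define coord where
    "coord x = (SOME c. c \<in> B \<rightarrow>\<^sub>E carrier R \<and> x = (\<Oplus>\<^bsub>M\<^esub>b\<in>B. c b \<odot>\<^bsub>M\<^esub> b))" for x
  have coord: "coord x \<in> B \<rightarrow>\<^sub>E carrier R" "x = (\<Oplus>\<^bsub>M\<^esub>b\<in>B. coord x b \<odot>\<^bsub>M\<^esub> b)"
    if "x \<in> carrier M" for x
    using someI_ex[OF ex[OF that]] unfolding coord_def by auto
  obtain h where h: "bij_betw h {0..<card B} B"
    using ex_bij_betw_nat_finite[OF fin] by blast
  have "inj_on (\<lambda>x j. coord x (h j)) (carrier M)"
  proof (rule inj_onI)
    fix x y assume x: "x \<in> carrier M" and y: "y \<in> carrier M"
      and eq: "(\<lambda>j. coord x (h j)) = (\<lambda>j. coord y (h j))"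
    have "coord x b = coord y b" if b: "b \<in> B" for b
    proof -
      obtain j where "b = h j" using h b by (auto simp: bij_betw_def)
      then show ?thesis using fun_cong[OF eq, of j] by simp
    qed
    then have "coord x = coord y"
      using coord(1)[OF x] coord(1)[OF y] by (rule PiE_ext[rotated 2])
    then show "x = y" using coord(2)[OF x] coord(2)[OF y] by simp
  qed
  then show ?thesis by blast
qed

lemma transport_hom:
  assumes "left_module R M" "inj_on \<phi> (carrier M)" "inj_on \<psi> (carrier N)"
    and h: "h \<in> left_module_hom R M N"
  shows "(\<lambda>x. \<psi> (h (inv_into (carrier M) \<phi> x))) \<in>
    left_module_hom R (transport \<phi> M) (transport \<psi> N)"
proof -
  interpret left_module R M by fact
  have "h x \<in> carrier N" if "x \<in> carrier M" for x
    using h that by (auto simp: left_module_hom_def)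
  then show ?thesis
    using h assms(2) unfolding left_module_hom_def
    by (auto simp: transport_simps[OF assms(2)] transport_simps[OF assms(3)] smult_closed)
qed

lemma transport_kernel:
  assumes "left_module R N" "inj_on \<phi> (carrier M)" "inj_on \<psi> (carrier N)"
    and h: "h \<in> carrier M \<rightarrow> carrier N"
  shows "module_kernel (transport \<phi> M) (transport \<psi> N)
    (\<lambda>x. \<psi> (h (inv_into (carrier M) \<phi> x))) = \<phi> ` module_kernel M N h"
proof -
  interpret left_module R N by fact
  show ?thesis
    using h assms(2,3) M.zero_closed unfolding module_kernel_def
    by (auto simp: transport_simps[OF assms(2)] transport_simps[OF assms(3)] Pi_iff
        dest: inj_onD[OF assms(3)] intro!: imageI)
qed

lemma left_FP_I:
  fixes A :: "nat \<Rightarrow> ('a \<Rightarrow> int, 'm) module"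
  assumes "partial_free_resolution S n A d \<epsilon>"
  shows "left_FP S n"
proof -
  let ?Z = "trivial_module :: ('a \<Rightarrow> int, int) module"
  have free: "\<And>i. i \<le> n \<Longrightarrow> fg_free (monoid_ring S) (A i)"
    and eps: "\<epsilon> \<in> left_module_hom (monoid_ring S) (A 0) ?Z"
    and d: "\<And>i. i < n \<Longrightarrow> d i \<in> left_module_hom (monoid_ring S) (A (Suc i)) (A i)"
    and surj: "\<epsilon> ` carrier (A 0) = carrier ?Z"
    and ex0: "0 < n \<Longrightarrow> d 0 ` carrier (A 1) = module_kernel (A 0) ?Z \<epsilon>"
    and ex: "\<And>i. Suc i < n \<Longrightarrow>
      d (Suc i) ` carrier (A (Suc (Suc i))) = module_kernel (A (Suc i)) (A i) (d i)"
    using assms unfolding partial_free_resolution_def by simp_all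
  have lm: "left_module (monoid_ring S) (A i)" if "i \<le> n" for i
    using free[OF that] by (simp add: fg_free_def)
  have "\<forall>i. \<exists>\<phi> :: 'm \<Rightarrow> nat \<Rightarrow> 'a \<Rightarrow> int. i \<le> n \<longrightarrow> inj_on \<phi> (carrier (A i))"
    using fg_free_embedding[OF free] by blast
  then obtain \<phi> :: "nat \<Rightarrow> 'm \<Rightarrow> nat \<Rightarrow> 'a \<Rightarrow> int"
    where inj: "\<And>i. i \<le> n \<Longrightarrow> inj_on (\<phi> i) (carrier (A i))"
    by metis
  define A' where "A' i = transport (\<phi> i) (A i)" for i
  define d' where "d' i x = \<phi> i (d i (inv_into (carrier (A (Suc i))) (\<phi> (Suc i)) x))" for i x
  define \<epsilon>' where "\<epsilon>' x = \<epsilon> (inv_into (carrier (A 0)) (\<phi> 0) x)" for x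
  note tr0 = transport_simps[OF inj[OF le0]]
  interpret A0: left_module "monoid_ring S" "A 0" by (rule lm) simp
  have img: "d' i ` carrier (A' (Suc i)) = \<phi> i ` d i ` carrier (A (Suc i))" if "i < n" for i
    using inj[of "Suc i"] that
    by (simp add: A'_def d'_def transport_simps image_image)
  have "partial_free_resolution S n A' d' \<epsilon>'"
    unfolding partial_free_resolution_def
  proof (intro conjI allI impI)
    fix i assume "i \<le> n"
    then show "fg_free (monoid_ring S) (A' i)"
      unfolding A'_def by (intro transport_fg_free free inj)
  next
    show "\<epsilon>' \<in> left_module_hom (monoid_ring S) (A' 0) ?Z"
      using eps inj[of 0] unfolding left_module_hom_def A'_def \<epsilon>'_def
      by (auto simp: tr0 A0.smult_closed)
  next
    fix i assume "i < n"
    then show "d' i \<in> left_module_hom (monoid_ring S) (A' (Suc i)) (A' i)"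
      unfolding A'_def d'_def using lm inj d by (intro transport_hom) auto
  next
    show "\<epsilon>' ` carrier (A' 0) = carrier ?Z"
      using surj inj[of 0] by (simp add: A'_def \<epsilon>'_def tr0 image_image)
  next
    assume "0 < n"
    have "module_kernel (A' 0) ?Z \<epsilon>' = \<phi> 0 ` module_kernel (A 0) ?Z \<epsilon>"
      using inj[of 0] by (auto simp: module_kernel_def A'_def \<epsilon>'_def tr0)
    with ex0[OF \<open>0 < n\<close>] img[OF \<open>0 < n\<close>]
    show "d' 0 ` carrier (A' 1) = module_kernel (A' 0) ?Z \<epsilon>'" by simp
  next
    fix i assume i: "Suc i < n"
    have "module_kernel (A' (Suc i)) (A' i) (d' i) = \<phi> (Suc i) ` module_kernel (A (Suc i)) (A i) (d i)"
      unfolding A'_def d'_def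
      by (rule transport_kernel[OF lm]) (use i lm inj d[of i] in \<open>auto simp: left_module_hom_def\<close>)
    with ex[OF i] img[OF i]
    show "d' (Suc i) ` carrier (A' (Suc (Suc i))) = module_kernel (A' (Suc i)) (A' i) (d' i)"
      by simp
  qed
  then show ?thesis unfolding left_FP_def by blast
qed

end

theory Submission
  imports Defs
begin

text \<open>
  Write \<open>S\<close> for \<open>U\<close> with an identity adjoined and let \<open>H = eUe\<close>. The proof compares modules over
  \<open>\<int>S\<close> with modules over \<open>\<int>H\<close> by the exact functor \<open>M \<mapsto> eM\<close>.

  From \<open>S\<close> to \<open>H\<close>. The set \<open>eU\<close> is a free left \<open>H\<close>-set, and its orbits correspond to the minimal left
  ideals of \<open>U\<close>. So if there are finitely many of these, \<open>eM\<close> is finitely generated free over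
  \<open>\<int>H\<close> whenever \<open>M\<close> is so over \<open>\<int>S\<close> (\<open>corner_fg_free\<close>), and \<open>e\<close> turns a partial free resolution over
  \<open>\<int>S\<close> into one over \<open>\<int>H\<close> (\<open>corner_resolution\<close>). Moreover \<open>U\<close> is the disjoint union of its minimal right
  ideals, and for each of them, \<open>C\<close>, the map sending \<open>s\<close> to 1 if \<open>s \<in> C\<close> and to 0 otherwise is a crossed
  homomorphism on \<open>S\<close>. Extended to a free module \<open>A\<close> over the augmentation \<open>\<epsilon>\<close>, these maps are
  linear on \<open>ker \<epsilon>\<close> when \<open>U\<close> acts on \<open>\<int>\<close> by 0, and they separate elements \<open>u \<cdot> x - v \<cdot> x\<close> with \<open>\<epsilon> x = 1\<close> according to the
  right ideals of \<open>u\<close> and \<open>v\<close>. If \<open>ker \<epsilon>\<close> is finitely generated, almost all of them vanish on it, which bounds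
  the number of right ideals (\<open>finite_right_ideals_if_FP\<close>).

  From \<open>H\<close> to \<open>S\<close>. A free resolution over \<open>\<int>S\<close> can be built step by step as long as each kernel \<open>K\<close>, a
  submodule of a free module \<open>A\<close>, is finitely generated. By Schanuel's argument, \<open>eK\<close> is finitely generated
  over \<open>\<int>H\<close>, since it is a kernel in a partial resolution over \<open>\<int>H\<close> and \<open>H\<close> is of type
  \<open>FP\<^sub>n\<close> (\<open>finitely_generated_resolution_kernel\<close>). As \<open>U = UeU\<close>, generators of \<open>eK\<close> generate all of
  \<open>UK\<close>, so the issue is to go from \<open>UK\<close> to \<open>K\<close>. First, \<open>A/UA\<close> is a finitely generated free abelian group, hence
  \<open>K\<close> is finitely generated modulo \<open>K \<inter> UA\<close>. Secondly, let \<open>f\<close> run through a set \<open>E\<close> of idempotents,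
  one in each minimal right ideal; then \<open>\<int>U\<close> is the direct sum of the right ideals \<open>f\<int>S\<close>, and
  \<open>UA\<close> is the direct sum of the groups \<open>fA\<close>. If \<open>K\<close> is the kernel of a map between free modules, this
  directness in the target shows that the components of an element of \<open>K \<inter> UA\<close> lie in \<open>K\<close>, that is
  \<open>K \<inter> UA = UK\<close> (\<open>finitely_generated_kernel_of_free\<close>). If \<open>K\<close> is the kernel of the augmentation, then
  \<open>K \<inter> UA\<close> is generated by \<open>UK\<close> and the differences \<open>f \<cdot> b - g \<cdot> b\<close> with \<open>\<epsilon> b = 1\<close>
  (\<open>finitely_generated_kernel_of_augmentation\<close>). Here finiteness of \<open>E\<close>, that is of the set of right ideals, enters.

  If \<open>U\<close> has an identity, then \<open>U\<close> is a group and equals \<open>H\<close>.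
\<close>

section \<open>Submodules and finite generation\<close>

context left_module
begin

lemma zero_smult: "x \<in> carrier M \<Longrightarrow> \<zero>\<^bsub>R\<^esub> \<odot>\<^bsub>M\<^esub> x = \<zero>\<^bsub>M\<^esub>"
  using smult_l_distr[of "\<zero>\<^bsub>R\<^esub>" "\<zero>\<^bsub>R\<^esub>" x] by (simp add: smult_closed)

lemma smult_zero: "a \<in> carrier R \<Longrightarrow> a \<odot>\<^bsub>M\<^esub> \<zero>\<^bsub>M\<^esub> = \<zero>\<^bsub>M\<^esub>"
  using smult_r_distr[of a "\<zero>\<^bsub>M\<^esub>" "\<zero>\<^bsub>M\<^esub>"] by (simp add: smult_closed)

lemma minus_smult:
  assumes "a \<in> carrier R" "x \<in> carrier M"
  shows "(\<ominus>\<^bsub>R\<^esub> a) \<odot>\<^bsub>M\<^esub> x = \<ominus>\<^bsub>M\<^esub> (a \<odot>\<^bsub>M\<^esub> x)"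
  using smult_l_distr[of "\<ominus>\<^bsub>R\<^esub> a" a x] assms
  by (simp add: smult_closed zero_smult R.l_neg M.minus_equality)

lemma minus_one_smult: "x \<in> carrier M \<Longrightarrow> (\<ominus>\<^bsub>R\<^esub> \<one>\<^bsub>R\<^esub>) \<odot>\<^bsub>M\<^esub> x = \<ominus>\<^bsub>M\<^esub> x"
  by (simp add: minus_smult smult_one)

lemma smult_minus:
  assumes "a \<in> carrier R" "x \<in> carrier M"
  shows "a \<odot>\<^bsub>M\<^esub> (\<ominus>\<^bsub>M\<^esub> x) = \<ominus>\<^bsub>M\<^esub> (a \<odot>\<^bsub>M\<^esub> x)"
  using smult_r_distr[of a "\<ominus>\<^bsub>M\<^esub> x" x] assms
  by (simp add: M.l_neg smult_zero smult_closed M.minus_equality)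

lemma minus_self: "x \<in> carrier M \<Longrightarrow> x \<ominus>\<^bsub>M\<^esub> x = \<zero>\<^bsub>M\<^esub>"
  by (simp add: a_minus_def M.r_neg)

lemma submodule_introduction:
  assumes "N \<subseteq> carrier M" "\<zero>\<^bsub>M\<^esub> \<in> N"
    and "\<And>x y. \<lbrakk>x \<in> N; y \<in> N\<rbrakk> \<Longrightarrow> x \<oplus>\<^bsub>M\<^esub> y \<in> N"
    and smult: "\<And>a x. \<lbrakk>a \<in> carrier R; x \<in> N\<rbrakk> \<Longrightarrow> a \<odot>\<^bsub>M\<^esub> x \<in> N"
  shows "submodule N R M"
proof (intro submodule.intro subgroup.intro submodule_axioms.intro)
  fix x assume "x \<in> N"
  then show "inv\<^bsub>add_monoid M\<^esub> x \<in> N"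
    using smult[of "\<ominus>\<^bsub>R\<^esub> \<one>\<^bsub>R\<^esub>" x] assms(1)
    by (metis R.a_inv_closed R.one_closed a_inv_def minus_one_smult subsetD)
qed (use assms in auto)

lemma submoduleD:
  assumes "submodule N R M"
  shows "N \<subseteq> carrier M" "\<zero>\<^bsub>M\<^esub> \<in> N"
    and "\<lbrakk>x \<in> N; y \<in> N\<rbrakk> \<Longrightarrow> x \<oplus>\<^bsub>M\<^esub> y \<in> N"
    and "x \<in> N \<Longrightarrow> \<ominus>\<^bsub>M\<^esub> x \<in> N"
    and "\<lbrakk>x \<in> N; y \<in> N\<rbrakk> \<Longrightarrow> x \<ominus>\<^bsub>M\<^esub> y \<in> N"
    and "\<lbrakk>a \<in> carrier R; x \<in> N\<rbrakk> \<Longrightarrow> a \<odot>\<^bsub>M\<^esub> x \<in> N"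
proof -
  interpret N: submodule N R M by fact
  show "N \<subseteq> carrier M" "\<zero>\<^bsub>M\<^esub> \<in> N"
    "\<lbrakk>x \<in> N; y \<in> N\<rbrakk> \<Longrightarrow> x \<oplus>\<^bsub>M\<^esub> y \<in> N"
    "x \<in> N \<Longrightarrow> \<ominus>\<^bsub>M\<^esub> x \<in> N"
    "\<lbrakk>a \<in> carrier R; x \<in> N\<rbrakk> \<Longrightarrow> a \<odot>\<^bsub>M\<^esub> x \<in> N"
    using N.subset N.one_closed N.m_closed N.smult_closed M.add.subgroupE(3)[OF N.subgroup_axioms]
    by (auto simp: a_inv_def)
  then show "\<lbrakk>x \<in> N; y \<in> N\<rbrakk> \<Longrightarrow> x \<ominus>\<^bsub>M\<^esub> y \<in> N"
    using M.add.subgroupE(3)[OF N.subgroup_axioms] N.m_closed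
    by (auto simp: a_minus_def a_inv_def)
qed

lemma submodule_carrier: "submodule (carrier M) R M"
  by (rule submodule_introduction) (auto simp: smult_closed)

lemma finsum_mem:
  assumes "D \<subseteq> carrier M" "\<zero>\<^bsub>M\<^esub> \<in> D" "\<And>x y. \<lbrakk>x \<in> D; y \<in> D\<rbrakk> \<Longrightarrow> x \<oplus>\<^bsub>M\<^esub> y \<in> D" "f \<in> A \<rightarrow> D"
  shows "finsum M f A \<in> D"
  using assms(4)
proof (induction A rule: infinite_finite_induct)
  case (insert a A)
  have "f \<in> insert a A \<rightarrow> carrier M" using insert.prems assms(1) by auto
  then show ?case using insert assms(3) by (simp add: M.finsum_insert Pi_iff)
qed (auto simp: assms(2) M.finsum_infinite)

lemma finsum_mem_submodule: "\<lbrakk>submodule N R M; f \<in> A \<rightarrow> N\<rbrakk> \<Longrightarrow> finsum M f A \<in> N"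
  by (intro finsum_mem submoduleD(1-3))

lemma finsum_smult:
  assumes "a \<in> carrier R" "f \<in> A \<rightarrow> carrier M"
  shows "a \<odot>\<^bsub>M\<^esub> finsum M f A = (\<Oplus>\<^bsub>M\<^esub>i\<in>A. a \<odot>\<^bsub>M\<^esub> f i)"
  using assms(2)
proof (induction A rule: infinite_finite_induct)
  case (insert i A)
  then have "finsum M f A \<in> carrier M" "(\<lambda>i. a \<odot>\<^bsub>M\<^esub> f i) \<in> A \<rightarrow> carrier M"
    using assms(1) by (auto intro!: M.finsum_closed smult_closed)
  then show ?case
    using insert assms(1) by (simp add: M.finsum_insert smult_r_distr smult_closed Pi_iff)
qed (use assms(1) in \<open>auto simp: smult_zero M.finsum_infinite\<close>)

end

text \<open>
  The set \<open>K\<close> is a submodule in every use. Quantifying over the submodules that contain the generators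
  replaces linear combinations by closure arguments.
\<close>

definition finitely_generated ::
  "('r, 'c) ring_scheme \<Rightarrow> ('r, 'm, 'd) module_scheme \<Rightarrow> 'm set \<Rightarrow> bool" where
  "finitely_generated R M K \<longleftrightarrow>
     (\<exists>X. finite X \<and> X \<subseteq> K \<and> (\<forall>N. submodule N R M \<longrightarrow> X \<subseteq> N \<longrightarrow> K \<subseteq> N))"

section \<open>Homomorphisms\<close>

locale left_module_map = M: left_module R M + N: left_module R N
  for R :: "('r, 'c) ring_scheme" and M :: "('r, 'm, 'd) module_scheme"
    and N :: "('r, 'k, 'e) module_scheme" +
  fixes h
  assumes hom: "h \<in> left_module_hom R M N"
begin

lemma closed: "x \<in> carrier M \<Longrightarrow> h x \<in> carrier N"
  and add: "\<lbrakk>x \<in> carrier M; y \<in> carrier M\<rbrakk> \<Longrightarrow> h (x \<oplus>\<^bsub>M\<^esub> y) = h x \<oplus>\<^bsub>N\<^esub> h y"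
  and smult: "\<lbrakk>a \<in> carrier R; x \<in> carrier M\<rbrakk> \<Longrightarrow> h (a \<odot>\<^bsub>M\<^esub> x) = a \<odot>\<^bsub>N\<^esub> h x"
  using hom by (auto simp: left_module_hom_def)

lemma zero: "h \<zero>\<^bsub>M\<^esub> = \<zero>\<^bsub>N\<^esub>"
  using smult[of "\<zero>\<^bsub>R\<^esub>" "\<zero>\<^bsub>M\<^esub>"] by (simp add: M.zero_smult N.zero_smult closed)

lemma uminus: "x \<in> carrier M \<Longrightarrow> h (\<ominus>\<^bsub>M\<^esub> x) = \<ominus>\<^bsub>N\<^esub> h x"
  using smult[of "\<ominus>\<^bsub>R\<^esub> \<one>\<^bsub>R\<^esub>" x] by (simp add: M.minus_one_smult N.minus_one_smult closed)

lemma minus: "\<lbrakk>x \<in> carrier M; y \<in> carrier M\<rbrakk> \<Longrightarrow> h (x \<ominus>\<^bsub>M\<^esub> y) = h x \<ominus>\<^bsub>N\<^esub> h y"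
  by (simp add: a_minus_def add uminus)

lemma finsum:
  assumes "f \<in> A \<rightarrow> carrier M"
  shows "h (finsum M f A) = (\<Oplus>\<^bsub>N\<^esub>i\<in>A. h (f i))"
  using assms
proof (induction A rule: infinite_finite_induct)
  case (insert i A)
  then have "finsum M f A \<in> carrier M" "(\<lambda>i. h (f i)) \<in> A \<rightarrow> carrier N"
    by (auto intro!: M.finsum_closed closed)
  then show ?case
    using insert by (simp add: M.M.finsum_insert N.M.finsum_insert add closed Pi_iff)
qed (auto simp: zero M.M.finsum_infinite N.M.finsum_infinite)

lemma submodule_preimage:
  assumes "submodule L R N"
  shows "submodule {x \<in> carrier M. h x \<in> L} R M"
  by (rule M.submodule_introduction)
     (auto simp: zero add smult M.smult_closed N.submoduleD(2,3,6)[OF assms])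

lemma submodule_image:
  assumes "submodule L R M"
  shows "submodule (h ` L) R N"
proof (rule N.submodule_introduction)
  note L = M.submoduleD[OF assms]
  show "h ` L \<subseteq> carrier N" using L(1) closed by auto
  show "\<zero>\<^bsub>N\<^esub> \<in> h ` L" using zero L(2) by (metis imageI)
  show "x \<oplus>\<^bsub>N\<^esub> y \<in> h ` L" if "x \<in> h ` L" "y \<in> h ` L" for x y
    using that L(1,3) by (auto simp: add[symmetric] subset_iff)
  show "a \<odot>\<^bsub>N\<^esub> x \<in> h ` L" if "a \<in> carrier R" "x \<in> h ` L" for a x
    using that L(1,6) by (auto simp: smult[symmetric] subset_iff)
qed

lemma submodule_kernel: "submodule (module_kernel M N h) R M"
  by (rule M.submodule_introduction)
     (auto simp: module_kernel_def zero add smult M.smult_closed N.smult_zero)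

end

lemma left_module_map_comp:
  assumes "left_module_map R L M g" "left_module_map R M N h"
  shows "left_module_map R L N (\<lambda>x. h (g x))"
proof -
  interpret g: left_module_map R L M g by fact
  interpret h: left_module_map R M N h by fact
  show ?thesis
    by unfold_locales
       (auto simp: left_module_hom_def g.closed h.closed g.add h.add g.smult h.smult)
qed

lemma left_module_map_diff:
  assumes "left_module_map R M N g" "left_module_map R M N h"
  shows "left_module_map R M N (\<lambda>x. g x \<ominus>\<^bsub>N\<^esub> h x)"
proof -
  interpret g: left_module_map R M N g by fact
  interpret h: left_module_map R M N h by fact
  show ?thesis
    by unfold_locales
       (auto simp: left_module_hom_def g.closed h.closed g.add h.add g.smult h.smult a_minus_def
          g.N.M.a_ac g.N.M.minus_add g.N.smult_r_distr g.N.smult_minus g.N.smult_closed)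
qed

lemma left_module_map_id: "left_module R M \<Longrightarrow> left_module_map R M M (\<lambda>x. x)"
  by (auto simp: left_module_map_def left_module_map_axioms_def left_module_hom_def)

lemma submodule_equalizer:
  assumes "left_module_map R M N g" "left_module_map R M N h"
  shows "submodule {x \<in> carrier M. g x = h x} R M"
proof -
  interpret g: left_module_map R M N g by fact
  interpret h: left_module_map R M N h by fact
  show ?thesis
    by (rule g.M.submodule_introduction)
       (auto simp: g.zero h.zero g.add h.add g.smult h.smult g.M.smult_closed)
qed

section \<open>Bases\<close>

definition regular_module :: "('r, 'c) ring_scheme \<Rightarrow> ('r, 'r) module" where
  "regular_module R = \<lparr>carrier = carrier R, mult = mult R, one = \<one>\<^bsub>R\<^esub>, zero = \<zero>\<^bsub>R\<^esub>,
     add = add R, smult = mult R\<rparr>"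

lemma regular_module_simps [simp]:
  "carrier (regular_module R) = carrier R" "\<zero>\<^bsub>regular_module R\<^esub> = \<zero>\<^bsub>R\<^esub>"
  "x \<oplus>\<^bsub>regular_module R\<^esub> y = x \<oplus>\<^bsub>R\<^esub> y" "a \<odot>\<^bsub>regular_module R\<^esub> x = a \<otimes>\<^bsub>R\<^esub> x"
  by (simp_all add: regular_module_def)

lemma left_module_regular:
  assumes "ring R"
  shows "left_module R (regular_module R)"
proof -
  interpret ring R by fact
  have "abelian_group (regular_module R)"
    by (rule abelian_groupI) (auto simp: a_ac intro: bexI[of _ "\<ominus>\<^bsub>R\<^esub> _"] l_neg)
  then show ?thesis
    using assms
    by (auto simp: left_module_def left_module_axioms_def l_distr r_distr m_assoc)
qed

text \<open>
  One lemma serves two purposes: with \<open>\<kappa>\<close> the coordinates of a free module it gives the map with prescribed values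
  on a basis, and with \<open>N = M\<close> it gives the map that has to be the identity for a family to be a basis.
\<close>

lemma left_module_map_combination:
  assumes "left_module R M" "left_module R N"
    and \<kappa>: "\<And>j. j \<in> J \<Longrightarrow> left_module_map R M (regular_module R) (\<kappa> j)"
    and q: "\<And>j. j \<in> J \<Longrightarrow> q j \<in> carrier N"
  shows "left_module_map R M N (\<lambda>x. \<Oplus>\<^bsub>N\<^esub>j\<in>J. \<kappa> j x \<odot>\<^bsub>N\<^esub> q j)" (is "left_module_map R M N ?h")
proof -
  interpret M: left_module R M by fact
  interpret N: left_module R N by fact
  have closed: "\<kappa> j x \<in> carrier R" if "j \<in> J" "x \<in> carrier M" for j x
    using left_module_map.closed[OF \<kappa>] that by fastforce
  have tm: "(\<lambda>j. \<kappa> j x \<odot>\<^bsub>N\<^esub> q j) \<in> J \<rightarrow> carrier N" if "x \<in> carrier M" for x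
    using that q closed by (auto intro!: N.smult_closed)
  have "?h (x \<oplus>\<^bsub>M\<^esub> y) = ?h x \<oplus>\<^bsub>N\<^esub> ?h y" if "x \<in> carrier M" "y \<in> carrier M" for x y
  proof -
    have "?h x \<oplus>\<^bsub>N\<^esub> ?h y = (\<Oplus>\<^bsub>N\<^esub>j\<in>J. \<kappa> j x \<odot>\<^bsub>N\<^esub> q j \<oplus>\<^bsub>N\<^esub> \<kappa> j y \<odot>\<^bsub>N\<^esub> q j)"
      by (rule N.M.finsum_addf[symmetric]) (use tm that in auto)
    also have "\<dots> = ?h (x \<oplus>\<^bsub>M\<^esub> y)"
      by (rule N.M.finsum_cong')
         (use that q closed left_module_map.add[OF \<kappa>] in
           \<open>auto simp: N.smult_l_distr intro!: N.smult_closed\<close>)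
    finally show ?thesis by simp
  qed
  moreover have "?h (a \<odot>\<^bsub>M\<^esub> x) = a \<odot>\<^bsub>N\<^esub> ?h x" if "a \<in> carrier R" "x \<in> carrier M" for a x
  proof -
    have "a \<odot>\<^bsub>N\<^esub> ?h x = (\<Oplus>\<^bsub>N\<^esub>j\<in>J. a \<odot>\<^bsub>N\<^esub> (\<kappa> j x \<odot>\<^bsub>N\<^esub> q j))"
      by (rule N.finsum_smult) (use tm that in auto)
    also have "\<dots> = ?h (a \<odot>\<^bsub>M\<^esub> x)"
      by (rule N.M.finsum_cong')
         (use that q closed left_module_map.smult[OF \<kappa>] in
           \<open>auto simp: N.smult_assoc intro!: N.smult_closed\<close>)
    finally show ?thesis by simp
  qed
  ultimately show ?thesis
    using tm by unfold_locales (auto simp: left_module_hom_def intro!: N.M.finsum_closed)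
qed

context left_module
begin

lemma basis_generates:
  assumes "finite_basis R M B" "submodule N R M" "B \<subseteq> N"
  shows "carrier M \<subseteq> N"
proof
  fix x assume "x \<in> carrier M"
  then obtain c where c: "c \<in> B \<rightarrow>\<^sub>E carrier R" "x = (\<Oplus>\<^bsub>M\<^esub>b\<in>B. c b \<odot>\<^bsub>M\<^esub> b)"
    using assms(1) unfolding finite_basis_def by blast
  have "(\<lambda>b. c b \<odot>\<^bsub>M\<^esub> b) \<in> B \<rightarrow> N"
    using c(1) assms(3) submoduleD(6)[OF assms(2)] by (auto simp: PiE_iff)
  then show "x \<in> N" unfolding c(2) by (rule finsum_mem_submodule[OF assms(2)])
qed

text \<open>
  Unique expansion makes the coordinates linear: the sum of two expansions is an expansion of the sum, and
  likewise for multiples.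
\<close>

lemma coordinates:
  assumes "finite_basis R M B"
  obtains \<kappa> where
    "\<And>b. b \<in> B \<Longrightarrow> left_module_map R M (regular_module R) (\<kappa> b)"
    "\<And>b b'. \<lbrakk>b \<in> B; b' \<in> B\<rbrakk> \<Longrightarrow> \<kappa> b b' = (if b = b' then \<one>\<^bsub>R\<^esub> else \<zero>\<^bsub>R\<^esub>)"
    "\<And>x. x \<in> carrier M \<Longrightarrow> x = (\<Oplus>\<^bsub>M\<^esub>b\<in>B. \<kappa> b x \<odot>\<^bsub>M\<^esub> b)"
proof -
  have fin: "finite B" and B: "B \<subseteq> carrier M"
    and ex1: "\<And>x. x \<in> carrier M \<Longrightarrow>
      \<exists>!c. c \<in> B \<rightarrow>\<^sub>E carrier R \<and> x = (\<Oplus>\<^bsub>M\<^esub>b\<in>B. c b \<odot>\<^bsub>M\<^esub> b)"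
    using assms by (auto simp: finite_basis_def)
  define coord where
    "coord x = (THE c. c \<in> B \<rightarrow>\<^sub>E carrier R \<and> x = (\<Oplus>\<^bsub>M\<^esub>b\<in>B. c b \<odot>\<^bsub>M\<^esub> b))" for x
  have mem: "coord x \<in> B \<rightarrow>\<^sub>E carrier R" and sum: "x = (\<Oplus>\<^bsub>M\<^esub>b\<in>B. coord x b \<odot>\<^bsub>M\<^esub> b)"
    if "x \<in> carrier M" for x
    using theI'[OF ex1[OF that]] unfolding coord_def by auto
  have val: "b \<in> B \<Longrightarrow> coord x b \<in> carrier R" if "x \<in> carrier M" for x b
    using mem[OF that] by auto
  have uniq: "coord x b = c b"
    if "x \<in> carrier M" "x = (\<Oplus>\<^bsub>M\<^esub>b\<in>B. c b \<odot>\<^bsub>M\<^esub> b)" "c \<in> B \<rightarrow> carrier R" "b \<in> B" for x b c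
  proof -
    have "(\<Oplus>\<^bsub>M\<^esub>b\<in>B. restrict c B b \<odot>\<^bsub>M\<^esub> b) = (\<Oplus>\<^bsub>M\<^esub>b\<in>B. c b \<odot>\<^bsub>M\<^esub> b)"
      using that(3) B by (intro M.finsum_cong') (auto intro!: smult_closed)
    moreover have "restrict c B \<in> B \<rightarrow>\<^sub>E carrier R" using that(3) by auto
    ultimately have "restrict c B = coord x"
      using ex1[OF that(1)] mem[OF that(1)] sum[OF that(1)] that(2) by auto
    then have "restrict c B b = coord x b" by simp
    then show ?thesis using that(4) by simp
  qed
  have tm: "c b \<odot>\<^bsub>M\<^esub> b \<in> carrier M" if "c \<in> B \<rightarrow> carrier R" "b \<in> B" for b c
    using that B by (auto intro!: smult_closed)
  show thesis
  proof (rule that[of "\<lambda>b x. coord x b"])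
    fix b assume b: "b \<in> B"
    interpret Reg: left_module R "regular_module R"
      by (rule left_module_regular) (rule R.ring_axioms)
    show "left_module_map R M (regular_module R) (\<lambda>x. coord x b)"
    proof
      have "coord (x \<oplus>\<^bsub>M\<^esub> y) b = coord x b \<oplus>\<^bsub>R\<^esub> coord y b"
        if x: "x \<in> carrier M" and y: "y \<in> carrier M" for x y
      proof (rule uniq)
        have "x \<oplus>\<^bsub>M\<^esub> y = (\<Oplus>\<^bsub>M\<^esub>b\<in>B. coord x b \<odot>\<^bsub>M\<^esub> b) \<oplus>\<^bsub>M\<^esub> (\<Oplus>\<^bsub>M\<^esub>b\<in>B. coord y b \<odot>\<^bsub>M\<^esub> b)"
          using sum x y by metis
        also have "\<dots> = (\<Oplus>\<^bsub>M\<^esub>b\<in>B. coord x b \<odot>\<^bsub>M\<^esub> b \<oplus>\<^bsub>M\<^esub> coord y b \<odot>\<^bsub>M\<^esub> b)"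
          by (rule M.finsum_addf[symmetric]) (use val x y tm in auto)
        also have "\<dots> = (\<Oplus>\<^bsub>M\<^esub>b\<in>B. (coord x b \<oplus>\<^bsub>R\<^esub> coord y b) \<odot>\<^bsub>M\<^esub> b)"
          by (rule M.finsum_cong') (use val x y B in \<open>auto simp: smult_l_distr intro!: smult_closed\<close>)
        finally show "x \<oplus>\<^bsub>M\<^esub> y = \<dots>" .
      qed (use val x y b in auto)
      moreover have "coord (a \<odot>\<^bsub>M\<^esub> x) b = a \<otimes>\<^bsub>R\<^esub> coord x b"
        if a: "a \<in> carrier R" and x: "x \<in> carrier M" for a x
      proof (rule uniq)
        have "a \<odot>\<^bsub>M\<^esub> x = a \<odot>\<^bsub>M\<^esub> (\<Oplus>\<^bsub>M\<^esub>b\<in>B. coord x b \<odot>\<^bsub>M\<^esub> b)"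
          using sum x by metis
        also have "\<dots> = (\<Oplus>\<^bsub>M\<^esub>b\<in>B. a \<odot>\<^bsub>M\<^esub> (coord x b \<odot>\<^bsub>M\<^esub> b))"
          by (rule finsum_smult) (use val x a B in \<open>auto intro!: smult_closed\<close>)
        also have "\<dots> = (\<Oplus>\<^bsub>M\<^esub>b\<in>B. (a \<otimes>\<^bsub>R\<^esub> coord x b) \<odot>\<^bsub>M\<^esub> b)"
          by (rule M.finsum_cong') (use val x a B in \<open>auto simp: smult_assoc intro!: smult_closed\<close>)
        finally show "a \<odot>\<^bsub>M\<^esub> x = \<dots>" .
      qed (use val x a b in \<open>auto intro!: smult_closed\<close>)
      ultimately show "(\<lambda>x. coord x b) \<in> left_module_hom R M (regular_module R)"
        using val b by (auto simp: left_module_hom_def)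
    qed
  next
    fix b b' assume b: "b \<in> B" "b' \<in> B"
    show "coord b' b = (if b = b' then \<one>\<^bsub>R\<^esub> else \<zero>\<^bsub>R\<^esub>)"
    proof (rule uniq)
      have "(\<Oplus>\<^bsub>M\<^esub>b\<in>B. (if b = b' then \<one>\<^bsub>R\<^esub> else \<zero>\<^bsub>R\<^esub>) \<odot>\<^bsub>M\<^esub> b) =
          (\<Oplus>\<^bsub>M\<^esub>b\<in>B. if b = b' then b else \<zero>\<^bsub>M\<^esub>)"
        using B by (intro M.finsum_cong') (auto simp: smult_one zero_smult)
      also have "\<dots> = b'"
        using M.add.finprod_singleton_swap[OF b(2) fin, of "\<lambda>b. b"] B by auto
      finally show "b' = (\<Oplus>\<^bsub>M\<^esub>b\<in>B. (if b = b' then \<one>\<^bsub>R\<^esub> else \<zero>\<^bsub>R\<^esub>) \<odot>\<^bsub>M\<^esub> b)" by simp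
    qed (use b B in auto)
  qed (use sum in auto)
qed

text \<open>
  A converse to \<open>coordinates\<close>. The map \<open>x \<mapsto> \<Sum> \<kappa> j x \<cdot> \<beta> j\<close> agrees with the identity on the
  generators, hence everywhere, and applying \<open>\<kappa> j\<close> to any expansion recovers its coefficient.
\<close>

lemma basis_criterion:
  assumes "finite J" "\<And>j. j \<in> J \<Longrightarrow> \<beta> j \<in> carrier M" "\<one>\<^bsub>R\<^esub> \<noteq> \<zero>\<^bsub>R\<^esub>"
    and \<kappa>: "\<And>j. j \<in> J \<Longrightarrow> left_module_map R M (regular_module R) (\<kappa> j)"
    and \<kappa>\<beta>: "\<And>i j. \<lbrakk>i \<in> J; j \<in> J\<rbrakk> \<Longrightarrow> \<kappa> j (\<beta> i) = (if i = j then \<one>\<^bsub>R\<^esub> else \<zero>\<^bsub>R\<^esub>)"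
    and gen: "\<And>N. \<lbrakk>submodule N R M; \<beta> ` J \<subseteq> N\<rbrakk> \<Longrightarrow> carrier M \<subseteq> N"
  shows "finite_basis R M (\<beta> ` J)"
proof -
  have inj: "inj_on \<beta> J"
    using \<kappa>\<beta> assms(3) by (intro inj_onI) metis
  define \<mu> where "\<mu> b = \<kappa> (the_inv_into J \<beta> b)" for b
  have \<mu>: "\<mu> (\<beta> j) = \<kappa> j" if "j \<in> J" for j
    using that inj by (simp add: \<mu>_def the_inv_into_f_f)
  have closed: "\<kappa> j x \<in> carrier R" if "j \<in> J" "x \<in> carrier M" for j x
    using left_module_map.closed[OF \<kappa>] that by fastforce
  have expand: "x = (\<Oplus>\<^bsub>M\<^esub>b\<in>\<beta> ` J. \<mu> b x \<odot>\<^bsub>M\<^esub> b)" if "x \<in> carrier M" for x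
  proof -
    let ?h = "\<lambda>x. \<Oplus>\<^bsub>M\<^esub>b\<in>\<beta> ` J. \<mu> b x \<odot>\<^bsub>M\<^esub> b"
    have map: "left_module_map R M M ?h"
      by (rule left_module_map_combination[OF left_module_axioms left_module_axioms])
         (use \<kappa> \<mu> assms(2) in auto)
    have "\<beta> i = ?h (\<beta> i)" if i: "i \<in> J" for i
    proof -
      have "?h (\<beta> i) = (\<Oplus>\<^bsub>M\<^esub>j\<in>J. \<kappa> j (\<beta> i) \<odot>\<^bsub>M\<^esub> \<beta> j)"
        by (subst M.finsum_reindex[OF _ inj])
           (use assms(2) closed i in \<open>auto simp: \<mu> intro!: smult_closed M.finsum_cong'\<close>)
      also have "\<dots> = (\<Oplus>\<^bsub>M\<^esub>j\<in>J. if i = j then \<beta> j else \<zero>\<^bsub>M\<^esub>)"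
        using i assms(2) by (intro M.finsum_cong') (auto simp: \<kappa>\<beta> smult_one zero_smult)
      also have "\<dots> = \<beta> i"
        using M.finsum_singleton[OF i assms(1), of \<beta>] assms(2) by auto
      finally show ?thesis by simp
    qed
    then have "\<beta> ` J \<subseteq> {x \<in> carrier M. x = ?h x}" using assms(2) by auto
    from gen[OF submodule_equalizer[OF left_module_map_id[OF left_module_axioms] map] this] that
    show ?thesis by blast
  qed
  show ?thesis
    unfolding finite_basis_def
  proof (intro conjI ballI)
    show "finite (\<beta> ` J)" "\<beta> ` J \<subseteq> carrier M" using assms by auto
    fix x assume x: "x \<in> carrier M"
    show "\<exists>!c. c \<in> \<beta> ` J \<rightarrow>\<^sub>E carrier R \<and> x = (\<Oplus>\<^bsub>M\<^esub>b\<in>\<beta> ` J. c b \<odot>\<^bsub>M\<^esub> b)"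
    proof (rule ex1I[of _ "\<lambda>b\<in>\<beta> ` J. \<mu> b x"])
      have "(\<Oplus>\<^bsub>M\<^esub>b\<in>\<beta> ` J. (\<lambda>b\<in>\<beta> ` J. \<mu> b x) b \<odot>\<^bsub>M\<^esub> b) = (\<Oplus>\<^bsub>M\<^esub>b\<in>\<beta> ` J. \<mu> b x \<odot>\<^bsub>M\<^esub> b)"
        by (rule M.finsum_cong') (use x assms(2) closed in \<open>auto simp: \<mu> intro!: smult_closed\<close>)
      then show "(\<lambda>b\<in>\<beta> ` J. \<mu> b x) \<in> \<beta> ` J \<rightarrow>\<^sub>E carrier R \<and>
          x = (\<Oplus>\<^bsub>M\<^esub>b\<in>\<beta> ` J. (\<lambda>b\<in>\<beta> ` J. \<mu> b x) b \<odot>\<^bsub>M\<^esub> b)"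
        using expand[OF x] x closed by (auto simp: \<mu>)
    next
      fix c assume c: "c \<in> \<beta> ` J \<rightarrow>\<^sub>E carrier R \<and> x = (\<Oplus>\<^bsub>M\<^esub>b\<in>\<beta> ` J. c b \<odot>\<^bsub>M\<^esub> b)"
      have cR: "c (\<beta> j) \<in> carrier R" if "j \<in> J" for j using c that by auto
      have "c (\<beta> j) = \<kappa> j x" if j: "j \<in> J" for j
      proof -
        interpret k: left_module_map R M "regular_module R" "\<kappa> j" by (rule \<kappa>[OF j])
        have "x = (\<Oplus>\<^bsub>M\<^esub>i\<in>J. c (\<beta> i) \<odot>\<^bsub>M\<^esub> \<beta> i)"
          using c assms(2) cR
          by (subst M.finsum_reindex[OF _ inj, symmetric]) (auto intro!: smult_closed)
        also have "\<kappa> j \<dots> = (\<Oplus>\<^bsub>regular_module R\<^esub>i\<in>J. \<kappa> j (c (\<beta> i) \<odot>\<^bsub>M\<^esub> \<beta> i))"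
          by (rule k.finsum) (use assms(2) cR in \<open>auto intro!: smult_closed\<close>)
        also have "\<dots> = (\<Oplus>\<^bsub>regular_module R\<^esub>i\<in>J. if j = i then c (\<beta> i) else \<zero>\<^bsub>regular_module R\<^esub>)"
          by (rule k.N.M.finsum_cong') (use j assms(2) cR in \<open>auto simp: \<kappa>\<beta> k.smult\<close>)
        also have "\<dots> = c (\<beta> j)"
          using k.N.M.finsum_singleton[OF j assms(1), of "\<lambda>i. c (\<beta> i)"] cR by auto
        finally show ?thesis by simp
      qed
      then show "c = (\<lambda>b\<in>\<beta> ` J. \<mu> b x)"
        using PiE_arb[OF conjunct1[OF c]] by (intro ext) (auto simp: \<mu> restrict_def)
    qed
  qed
qed

end

lemma map_from_basis:
  assumes "left_module R M" "left_module R N" "finite_basis R M B" "\<And>b. b \<in> B \<Longrightarrow> q b \<in> carrier N"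
  shows "\<exists>h. left_module_map R M N h \<and> (\<forall>b\<in>B. h b = q b)"
proof -
  interpret M: left_module R M by fact
  interpret N: left_module R N by fact
  obtain \<kappa> where
    \<kappa>: "\<And>b. b \<in> B \<Longrightarrow> left_module_map R M (regular_module R) (\<kappa> b)"
    and \<kappa>\<delta>: "\<And>b b'. \<lbrakk>b \<in> B; b' \<in> B\<rbrakk> \<Longrightarrow> \<kappa> b b' = (if b = b' then \<one>\<^bsub>R\<^esub> else \<zero>\<^bsub>R\<^esub>)"
    using M.coordinates[OF assms(3)] by metis
  have fin: "finite B" and B: "B \<subseteq> carrier M" using assms(3) by (auto simp: finite_basis_def)
  let ?h = "\<lambda>x. \<Oplus>\<^bsub>N\<^esub>b\<in>B. \<kappa> b x \<odot>\<^bsub>N\<^esub> q b"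
  have "left_module_map R M N ?h"
    by (rule left_module_map_combination[OF assms(1,2) \<kappa> assms(4)])
  moreover have "?h b = q b" if b: "b \<in> B" for b
  proof -
    have "?h b = (\<Oplus>\<^bsub>N\<^esub>b'\<in>B. if b = b' then q b' else \<zero>\<^bsub>N\<^esub>)"
      using b assms(4) by (intro N.M.finsum_cong') (auto simp: \<kappa>\<delta> N.smult_one N.zero_smult)
    also have "\<dots> = q b"
      using N.M.finsum_singleton[OF b fin, of q] assms(4) by auto
    finally show ?thesis .
  qed
  ultimately show ?thesis by blast
qed

text \<open>
  Finitely generated free modules are projective.
\<close>

lemma lift_from_fg_free:
  assumes "left_module_map R M N \<phi>" "left_module_map R Q N d" "fg_free R M"
    and im: "\<And>x. x \<in> carrier M \<Longrightarrow> \<phi> x \<in> d ` carrier Q"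
  shows "\<exists>\<psi>. left_module_map R M Q \<psi> \<and> (\<forall>x\<in>carrier M. d (\<psi> x) = \<phi> x)"
proof -
  interpret \<phi>: left_module_map R M N \<phi> by fact
  interpret d: left_module_map R Q N d by fact
  obtain B where B: "finite_basis R M B" using assms(3) by (auto simp: fg_free_def)
  then have sub: "B \<subseteq> carrier M" by (simp add: finite_basis_def)
  define q where "q b = inv_into (carrier Q) d (\<phi> b)" for b
  have q: "q b \<in> carrier Q" "d (q b) = \<phi> b" if "b \<in> B" for b
    using im[of b] sub that by (auto simp: q_def inv_into_into f_inv_into_f)
  obtain \<psi> where \<psi>: "left_module_map R M Q \<psi>" "\<And>b. b \<in> B \<Longrightarrow> \<psi> b = q b"
    using map_from_basis[OF \<phi>.M.left_module_axioms d.M.left_module_axioms B, of q] q(1) by auto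
  have "carrier M \<subseteq> {x \<in> carrier M. d (\<psi> x) = \<phi> x}"
    by (rule \<phi>.M.basis_generates[OF B])
       (use submodule_equalizer[OF left_module_map_comp[OF \<psi>(1) assms(2)] assms(1)] \<psi>(2) q(2) sub in auto)
  then show ?thesis using \<psi>(1) by blast
qed

lemma finitely_generated_image:
  assumes "left_module_map R M N h" "fg_free R M"
  shows "finitely_generated R N (h ` carrier M)"
proof -
  interpret h: left_module_map R M N h by fact
  obtain B where B: "finite_basis R M B" using assms(2) by (auto simp: fg_free_def)
  show ?thesis
    unfolding finitely_generated_def
  proof (intro exI[of _ "h ` B"] conjI allI impI)
    show "finite (h ` B)" "h ` B \<subseteq> h ` carrier M" using B by (auto simp: finite_basis_def)
    fix L assume L: "submodule L R N" "h ` B \<subseteq> L"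
    have "carrier M \<subseteq> {x \<in> carrier M. h x \<in> L}"
      by (rule h.M.basis_generates[OF B h.submodule_preimage[OF L(1)]])
         (use B L(2) in \<open>auto simp: finite_basis_def\<close>)
    then show "h ` carrier M \<subseteq> L" by auto
  qed
qed

section \<open>Standard free modules\<close>

text \<open>
  Functions on all of \<open>nat\<close> that vanish from \<open>m\<close> on, so that these modules lie in the element type over which type
  left-\<open>FP\<^sub>n\<close> is defined.
\<close>

definition free_module :: "('r, 'c) ring_scheme \<Rightarrow> nat \<Rightarrow> ('r, nat \<Rightarrow> 'r) module" where
  "free_module R m =
     \<lparr>carrier = {x. (\<forall>i<m. x i \<in> carrier R) \<and> (\<forall>i\<ge>m. x i = \<zero>\<^bsub>R\<^esub>)},
      mult = (\<lambda>x y. x), one = (\<lambda>_. \<zero>\<^bsub>R\<^esub>), zero = (\<lambda>_. \<zero>\<^bsub>R\<^esub>),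
      add = (\<lambda>x y i. x i \<oplus>\<^bsub>R\<^esub> y i), smult = (\<lambda>a x i. a \<otimes>\<^bsub>R\<^esub> x i)\<rparr>"

context ring
begin

lemma free_module_carrier:
  "carrier (free_module R m) = {x. (\<forall>i. x i \<in> carrier R) \<and> (\<forall>i\<ge>m. x i = \<zero>)}"
  unfolding free_module_def by (auto simp: not_less) (metis not_less zero_closed)

lemma free_module_simps:
  "\<zero>\<^bsub>free_module R m\<^esub> = (\<lambda>_. \<zero>)"
  "x \<oplus>\<^bsub>free_module R m\<^esub> y = (\<lambda>i. x i \<oplus> y i)"
  "a \<odot>\<^bsub>free_module R m\<^esub> x = (\<lambda>i. a \<otimes> x i)"
  by (simp_all add: free_module_def)

lemma left_module_free_module: "left_module R (free_module R m)"
proof -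
  have "abelian_group (free_module R m)"
  proof (rule abelian_groupI)
    fix x assume "x \<in> carrier (free_module R m)"
    then show "\<exists>y\<in>carrier (free_module R m). y \<oplus>\<^bsub>free_module R m\<^esub> x = \<zero>\<^bsub>free_module R m\<^esub>"
      by (intro bexI[of _ "\<lambda>i. \<ominus> x i"]) (auto simp: free_module_carrier free_module_simps l_neg)
  qed (auto simp: free_module_carrier free_module_simps a_ac)
  then show ?thesis
    by (auto simp: left_module_def left_module_axioms_def ring_axioms free_module_carrier
        free_module_simps l_distr r_distr m_assoc)
qed

lemma finite_basis_free_module:
  assumes "\<one> \<noteq> \<zero>"
  shows "finite_basis R (free_module R m) ((\<lambda>j i. if i = j then \<one> else \<zero>) ` {..<m})"
proof -
  interpret F: left_module R "free_module R m" by (rule left_module_free_module)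
  show ?thesis
  proof (rule F.basis_criterion[where \<kappa> = "\<lambda>j x. x j"])
    show "left_module_map R (free_module R m) (regular_module R) (\<lambda>x. x j)" for j
      using F.left_module_axioms left_module_regular[OF ring_axioms]
      by (auto simp: left_module_map_def left_module_map_axioms_def left_module_hom_def
          free_module_carrier free_module_simps)
    fix N assume N: "submodule N R (free_module R m)"
      and \<beta>: "(\<lambda>j i. if i = j then \<one> else \<zero>) ` {..<m} \<subseteq> N"
    note N = F.submoduleD[OF N]
    have "x \<in> N" if "k \<le> m" "x \<in> carrier (free_module R m)" "\<forall>i\<ge>k. x i = \<zero>" for k x
      using that
    proof (induction k arbitrary: x)
      case 0
      then have "x = \<zero>\<^bsub>free_module R m\<^esub>" by (auto simp: free_module_simps)
      then show ?case using N(2) by simp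
    next
      case (Suc k)
      let ?y = "x(k := \<zero>)" and ?e = "\<lambda>i. if i = k then \<one> else \<zero>"
      have x: "x i \<in> carrier R" for i using Suc.prems by (auto simp: free_module_carrier)
      have "?y \<in> N"
        by (rule Suc.IH) (use Suc.prems in \<open>auto simp: free_module_carrier\<close>)
      moreover have "x k \<odot>\<^bsub>free_module R m\<^esub> ?e \<in> N"
      proof (rule N(6))
        show "?e \<in> N" using \<beta> Suc.prems(1) by (auto simp: image_subset_iff Suc_le_eq)
      qed (rule x)
      ultimately have "?y \<oplus>\<^bsub>free_module R m\<^esub> x k \<odot>\<^bsub>free_module R m\<^esub> ?e \<in> N" by (rule N(3))
      moreover have "?y \<oplus>\<^bsub>free_module R m\<^esub> x k \<odot>\<^bsub>free_module R m\<^esub> ?e = x"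
        using x by (auto simp: free_module_simps)
      ultimately show ?case by simp
    qed
    then show "carrier (free_module R m) \<subseteq> N" by (auto simp: free_module_carrier)
  qed (use assms in \<open>auto simp: free_module_carrier\<close>)
qed

lemma fg_free_free_module: "\<one> \<noteq> \<zero> \<Longrightarrow> fg_free R (free_module R m)"
  using left_module_free_module finite_basis_free_module unfolding fg_free_def by blast

end

lemma free_module_onto:
  assumes "left_module R M" "\<one>\<^bsub>R\<^esub> \<noteq> \<zero>\<^bsub>R\<^esub>" "submodule K R M" "finitely_generated R M K"
  shows "\<exists>m h. left_module_map R (free_module R m) M h \<and> h ` carrier (free_module R m) = K"
proof -
  interpret M: left_module R M by fact
  obtain X where X: "finite X" "X \<subseteq> K" "\<And>N. \<lbrakk>submodule N R M; X \<subseteq> N\<rbrakk> \<Longrightarrow> K \<subseteq> N"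
    using assms(4) by (auto simp: finitely_generated_def)
  obtain m and q :: "nat \<Rightarrow> _" where q: "X = q ` {..<m}"
    using X(1) by (metis finite_imp_nat_seg_image_inj_on lessThan_def)
  let ?\<beta> = "\<lambda>j i. if i = j then \<one>\<^bsub>R\<^esub> else \<zero>\<^bsub>R\<^esub>"
  let ?B = "?\<beta> ` {..<m}"
  interpret F: left_module R "free_module R m" by (rule M.R.left_module_free_module)
  note B = M.R.finite_basis_free_module[OF assms(2), of m]
  have inj: "inj ?\<beta>" using assms(2) by (intro injI) metis
  have XM: "X \<subseteq> carrier M" using X(2) M.submoduleD(1)[OF assms(3)] by blast
  have "q (inv_into UNIV ?\<beta> b) \<in> carrier M" if "b \<in> ?B" for b
    using that XM q by (auto simp: inv_f_f[OF inj])
  then obtain h where h: "left_module_map R (free_module R m) M h" "\<And>b. b \<in> ?B \<Longrightarrow> h b = q (inv_into UNIV ?\<beta> b)"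
    using map_from_basis[OF F.left_module_axioms assms(1) B, of "\<lambda>b. q (inv_into UNIV ?\<beta> b)"] by blast
  interpret h: left_module_map R "free_module R m" M h by fact
  have im: "h ` ?B = X" using h(2) by (auto simp: q inv_f_f[OF inj] image_image)
  have "carrier (free_module R m) \<subseteq> {x \<in> carrier (free_module R m). h x \<in> K}"
    by (rule F.basis_generates[OF B h.submodule_preimage[OF assms(3)]])
       (use im X(2) B in \<open>auto simp: finite_basis_def\<close>)
  moreover have "K \<subseteq> h ` carrier (free_module R m)"
    by (rule X(3)[OF h.submodule_image[OF F.submodule_carrier]])
       (use im B in \<open>auto simp: finite_basis_def\<close>)
  ultimately show ?thesis using h(1) by blast
qed

section \<open>Comparison of partial resolutions\<close>

text \<open>
  What Schanuel's argument carries from one step of two resolutions to the next. Here \<open>K\<close> and \<open>L\<close> are the kernels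
  reached in degree \<open>k\<close>, the maps \<open>f\<close> and \<open>g\<close> are the degree \<open>k\<close> parts of chain maps between the resolutions,
  and \<open>r\<close> is what remains of \<open>f \<circ> g - id\<close> after subtracting the part of a chain homotopy that passes through
  lower degree. That part vanishes on \<open>L\<close>, whence the last condition.
\<close>

definition comparable ::
  "('r, 'c) ring_scheme \<Rightarrow> ('r, 'm, 'd) module_scheme \<Rightarrow> 'm set \<Rightarrow>
    ('r, 'k, 'e) module_scheme \<Rightarrow> 'k set \<Rightarrow> bool" where
  "comparable R P K Q L \<longleftrightarrow> (\<exists>f g r. left_module_map R P Q f \<and> left_module_map R Q P g \<and>
     left_module_map R Q Q r \<and> f ` K \<subseteq> L \<and> g ` L \<subseteq> K \<and> r ` carrier Q \<subseteq> L \<and>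
     (\<forall>z\<in>L. r z = f (g z) \<ominus>\<^bsub>Q\<^esub> z))"

lemma comparableE:
  assumes "comparable R P K Q L"
  obtains f g r where "left_module_map R P Q f" "left_module_map R Q P g" "left_module_map R Q Q r"
    "f ` K \<subseteq> L" "g ` L \<subseteq> K" "r ` carrier Q \<subseteq> L" "\<And>z. z \<in> L \<Longrightarrow> r z = f (g z) \<ominus>\<^bsub>Q\<^esub> z"
  using assms unfolding comparable_def by (elim exE conjE) (rule that, assumption+, erule bspec)

lemma comparable_covers:
  assumes "left_module_map R P Z d" "left_module_map R Q Z d'"
    and "fg_free R P" "fg_free R Q" "d ` carrier P = d' ` carrier Q"
  shows "comparable R P (module_kernel P Z d) Q (module_kernel Q Z d')"
proof -
  interpret d: left_module_map R P Z d by fact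
  interpret d': left_module_map R Q Z d' by fact
  obtain f where f: "left_module_map R P Q f" "\<And>x. x \<in> carrier P \<Longrightarrow> d' (f x) = d x"
    using lift_from_fg_free[OF assms(1,2,3)] assms(5) by blast
  obtain g where g: "left_module_map R Q P g" "\<And>x. x \<in> carrier Q \<Longrightarrow> d (g x) = d' x"
    using lift_from_fg_free[OF assms(2,1,4)] assms(5) by blast
  interpret f: left_module_map R P Q f by fact
  interpret g: left_module_map R Q P g by fact
  show ?thesis
    unfolding comparable_def
  proof (intro exI conjI)
    show "left_module_map R Q Q (\<lambda>x. f (g x) \<ominus>\<^bsub>Q\<^esub> x)"
      by (intro left_module_map_diff left_module_map_comp[OF g(1) f(1)]
          left_module_map_id[OF d'.M.left_module_axioms])
    show "(\<lambda>x. f (g x) \<ominus>\<^bsub>Q\<^esub> x) ` carrier Q \<subseteq> module_kernel Q Z d'"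
      by (auto simp: module_kernel_def d'.minus f.closed g.closed f(2) g(2) d'.closed
          d.N.minus_self)
  qed (use f g f.closed g.closed in \<open>auto simp: module_kernel_def\<close>)
qed

text \<open>
  The maps \<open>f\<close> and \<open>g\<close> lift to \<open>f'\<close> and \<open>g'\<close>, and \<open>r\<close> lifts to the next part \<open>h\<close> of the homotopy because its
  values lie in the image of \<open>d'\<close>. The new remainder is \<open>f' \<circ> g' - id - h \<circ> d'\<close>.
\<close>

lemma comparable_step:
  assumes "comparable R P K Q L"
    and d: "left_module_map R P' P d" "d ` carrier P' = K"
    and d': "left_module_map R Q' Q d'" "d' ` carrier Q' = L"
    and free: "fg_free R P'" "fg_free R Q'" "fg_free R Q"
  shows "comparable R P' (module_kernel P' P d) Q' (module_kernel Q' Q d')"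
proof -
  obtain f g r where f: "left_module_map R P Q f" and g: "left_module_map R Q P g"
    and r: "left_module_map R Q Q r" and fK: "f ` K \<subseteq> L" and gL: "g ` L \<subseteq> K"
    and rQ: "r ` carrier Q \<subseteq> L" and rL: "\<And>z. z \<in> L \<Longrightarrow> r z = f (g z) \<ominus>\<^bsub>Q\<^esub> z"
    by (rule comparableE[OF assms(1)]) (rule that; assumption)
  interpret d: left_module_map R P' P d by fact
  interpret d': left_module_map R Q' Q d' by fact
  interpret f: left_module_map R P Q f by fact
  interpret g: left_module_map R Q P g by fact
  have dK: "d x \<in> K" if "x \<in> carrier P'" for x using that d(2) by auto
  have d'L: "d' x \<in> L" if "x \<in> carrier Q'" for x using that d'(2) by auto
  obtain f' where f': "left_module_map R P' Q' f'" "\<And>x. x \<in> carrier P' \<Longrightarrow> d' (f' x) = f (d x)"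
    using lift_from_fg_free[OF left_module_map_comp[OF d(1) f] d'(1) free(1)] d'(2) dK fK by blast
  obtain g' where g': "left_module_map R Q' P' g'" "\<And>x. x \<in> carrier Q' \<Longrightarrow> d (g' x) = g (d' x)"
    using lift_from_fg_free[OF left_module_map_comp[OF d'(1) g] d(1) free(2)] d(2) d'L gL by blast
  obtain h where h: "left_module_map R Q Q' h" "\<And>x. x \<in> carrier Q \<Longrightarrow> d' (h x) = r x"
    using lift_from_fg_free[OF r d'(1) free(3)] d'(2) rQ by blast
  interpret f': left_module_map R P' Q' f' by fact
  interpret g': left_module_map R Q' P' g' by fact
  interpret h: left_module_map R Q Q' h by fact
  let ?r = "\<lambda>x. f' (g' x) \<ominus>\<^bsub>Q'\<^esub> x \<ominus>\<^bsub>Q'\<^esub> h (d' x)"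
  show ?thesis
    unfolding comparable_def
  proof (intro exI conjI ballI)
    show "left_module_map R Q' Q' ?r"
      by (intro left_module_map_diff left_module_map_comp[OF g'(1) f'(1)]
          left_module_map_comp[OF d'(1) h(1)] left_module_map_id[OF d'.M.left_module_axioms])
    show "?r ` carrier Q' \<subseteq> module_kernel Q' Q d'"
    proof
      fix y assume "y \<in> ?r ` carrier Q'"
      then obtain x where x: "x \<in> carrier Q'" "y = ?r x" by blast
      have "d' y = f (g (d' x)) \<ominus>\<^bsub>Q\<^esub> d' x \<ominus>\<^bsub>Q\<^esub> r (d' x)"
        using x by (simp add: d'.minus f'.closed g'.closed h.closed d'.closed f'(2) g'(2) h(2))
      also have "\<dots> = \<zero>\<^bsub>Q\<^esub>"
        using x d'L by (simp add: rL f.closed g.closed d'.closed d'.N.minus_self)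
      finally show "y \<in> module_kernel Q' Q d'"
        using x by (simp add: module_kernel_def f'.closed g'.closed h.closed d'.closed)
    qed
    show "?r z = f' (g' z) \<ominus>\<^bsub>Q'\<^esub> z" if "z \<in> module_kernel Q' Q d'" for z
      using that
      by (simp add: module_kernel_def h.zero f'.closed g'.closed a_minus_def)
    show "f' ` module_kernel P' P d \<subseteq> module_kernel Q' Q d'"
      by (auto simp: module_kernel_def f'.closed f'(2) f.zero)
    show "g' ` module_kernel Q' Q d' \<subseteq> module_kernel P' P d"
      by (auto simp: module_kernel_def g'.closed g'(2) g.zero)
  qed (use f' g' in auto)
qed

text \<open>
  Every \<open>z \<in> L\<close> equals \<open>f (g z) - r z\<close>; the first term comes from \<open>K\<close> and the second from the image of \<open>r\<close>.
\<close>

lemma comparable_finitely_generated: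
  assumes "comparable R P K Q L" "finitely_generated R P K" "fg_free R Q"
    and "K \<subseteq> carrier P" "L \<subseteq> carrier Q"
  shows "finitely_generated R Q L"
proof -
  obtain f g r where f: "left_module_map R P Q f" and g: "left_module_map R Q P g"
    and r: "left_module_map R Q Q r" and fK: "f ` K \<subseteq> L" and gL: "g ` L \<subseteq> K"
    and rQ: "r ` carrier Q \<subseteq> L" and rL: "\<And>z. z \<in> L \<Longrightarrow> r z = f (g z) \<ominus>\<^bsub>Q\<^esub> z"
    by (rule comparableE[OF assms(1)]) (rule that; assumption)
  interpret f: left_module_map R P Q f by fact
  interpret g: left_module_map R Q P g by fact
  interpret r: left_module_map R Q Q r by fact
  obtain X where X: "finite X" "X \<subseteq> K" "\<And>N. \<lbrakk>submodule N R P; X \<subseteq> N\<rbrakk> \<Longrightarrow> K \<subseteq> N"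
    using assms(2) by (auto simp: finitely_generated_def)
  obtain Y where Y: "finite Y" "Y \<subseteq> r ` carrier Q"
    "\<And>N. \<lbrakk>submodule N R Q; Y \<subseteq> N\<rbrakk> \<Longrightarrow> r ` carrier Q \<subseteq> N"
    using finitely_generated_image[OF r assms(3)] by (auto simp: finitely_generated_def)
  show ?thesis
    unfolding finitely_generated_def
  proof (intro exI[of _ "f ` X \<union> Y"] conjI allI impI)
    show "finite (f ` X \<union> Y)" "f ` X \<union> Y \<subseteq> L" using X(1,2) Y(1,2) fK rQ by blast+
    fix N assume N: "submodule N R Q" "f ` X \<union> Y \<subseteq> N"
    have KN: "K \<subseteq> {x \<in> carrier P. f x \<in> N}"
      using X(2) X(3)[OF f.submodule_preimage[OF N(1)]] N(2) assms(4) by blast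
    show "L \<subseteq> N"
    proof
      fix z assume z: "z \<in> L"
      then have "z \<in> carrier Q" using assms(5) by blast
      have "f (g z) \<in> N" using KN z gL by blast
      moreover have "r z \<in> N" using Y(3)[OF N(1)] N(2) z assms(5) by blast
      ultimately have "f (g z) \<ominus>\<^bsub>Q\<^esub> r z \<in> N" by (rule f.N.submoduleD(5)[OF N(1)])
      moreover have "f (g z) \<ominus>\<^bsub>Q\<^esub> r z = z"
        using \<open>z \<in> carrier Q\<close> z
        by (simp add: rL a_minus_def f.closed g.closed f.N.M.minus_add f.N.M.a_assoc[symmetric] f.N.M.r_neg)
      ultimately show "z \<in> N" by simp
    qed
  qed
qed

section \<open>Monoid rings\<close>

text \<open>
  The basis element of the monoid ring that belongs to \<open>s\<close>.
\<close>

definition single :: "'a \<Rightarrow> 'a \<Rightarrow> int" where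
  "single s = (\<lambda>t. if t = s then 1 else 0)"

lemma monoid_ring_simps:
  "carrier (monoid_ring S) = {f. finite {s. f s \<noteq> 0} \<and> {s. f s \<noteq> 0} \<subseteq> carrier S}"
  "f \<oplus>\<^bsub>monoid_ring S\<^esub> g = (\<lambda>s. f s + g s)"
  "\<zero>\<^bsub>monoid_ring S\<^esub> = (\<lambda>_. 0)"
  "\<one>\<^bsub>monoid_ring S\<^esub> = single \<one>\<^bsub>S\<^esub>"
  by (simp_all add: monoid_ring_def single_def)

lemma monoid_ring_one_not_zero: "\<one>\<^bsub>monoid_ring S\<^esub> \<noteq> \<zero>\<^bsub>monoid_ring S\<^esub>"
  by (metis monoid_ring_simps(3,4) single_def zero_neq_one)

lemma monoid_ring_a_inv:
  assumes "monoid S" "f \<in> carrier (monoid_ring S)"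
  shows "\<ominus>\<^bsub>monoid_ring S\<^esub> f = (\<lambda>s. - f s)"
proof -
  interpret ring "monoid_ring S" by (rule monoid_ring_ring[OF assms(1)])
  show ?thesis
    by (rule minus_equality) (use assms(2) in \<open>auto simp: monoid_ring_simps\<close>)
qed

lemma single_closed: "s \<in> carrier S \<Longrightarrow> single s \<in> carrier (monoid_ring S)"
  by (auto simp: monoid_ring_simps single_def)

lemma single_support: "{t. single s t \<noteq> 0} = {s}"
  by (auto simp: single_def)

lemma single_mult:
  assumes "f \<in> carrier (monoid_ring S)"
  shows "(single s \<otimes>\<^bsub>monoid_ring S\<^esub> f) t = (\<Sum>b | f b \<noteq> 0. if s \<otimes>\<^bsub>S\<^esub> b = t then f b else 0)"
  using monoid_ring_mult[of "{s}" "{b. f b \<noteq> 0}" "single s" f S t] assms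
  by (simp add: single_support monoid_ring_simps) (simp add: single_def cong: if_cong)

lemma single_mult_single: "single s \<otimes>\<^bsub>monoid_ring S\<^esub> single t = single (s \<otimes>\<^bsub>S\<^esub> t)"
  by (rule ext) (simp add: monoid_ring_def single_support, auto simp: single_def)

lemma augmentation_single: "augmentation (single s) = 1"
  by (simp add: augmentation_def single_support single_def)

text \<open>
  The monoid ring is generated by the monoid as an additive group. Linearity over the ring then only has to be checked on
  monoid elements.
\<close>

lemma monoid_ring_induct [consumes 1, case_names zero single add uminus]:
  assumes "f \<in> carrier (monoid_ring S)"
    and zero: "P (\<lambda>_. 0)"
    and single: "\<And>s. s \<in> carrier S \<Longrightarrow> P (single s)"
    and add: "\<And>f g. \<lbrakk>f \<in> carrier (monoid_ring S); g \<in> carrier (monoid_ring S); P f; P g\<rbrakk>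
      \<Longrightarrow> P (\<lambda>s. f s + g s)"
    and uminus: "\<And>f. \<lbrakk>f \<in> carrier (monoid_ring S); P f\<rbrakk> \<Longrightarrow> P (\<lambda>s. - f s)"
  shows "P f"
proof -
  have nat: "P (\<lambda>t. int m * single s t)" if s: "s \<in> carrier S" for m s
  proof (induction m)
    case (Suc m)
    have "(\<lambda>t. int m * single s t) \<in> carrier (monoid_ring S)"
      using s by (auto simp: monoid_ring_simps single_def)
    from add[OF this single_closed[OF s] Suc single[OF s]]
    show ?case by (simp add: algebra_simps)
  qed (simp add: zero)
  have int: "P (\<lambda>t. c * single s t)" if s: "s \<in> carrier S" for c :: int and s
  proof (cases "0 \<le> c")
    case True
    then show ?thesis using nat[OF s, of "nat c"] by simp
  next
    case False
    have "(\<lambda>t. int (nat (- c)) * single s t) \<in> carrier (monoid_ring S)"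
      using s by (auto simp: monoid_ring_simps single_def)
    from uminus[OF this nat[OF s]] False show ?thesis by simp
  qed
  have "P g" if "finite F" "F \<subseteq> carrier S" "{s. g s \<noteq> 0} \<subseteq> F" for F and g
    using that
  proof (induction F arbitrary: g rule: finite_induct)
    case empty
    then have "g = (\<lambda>_. 0)" by auto
    then show ?case using zero by simp
  next
    case (insert s F)
    have "{t. (g(s := 0)) t \<noteq> 0} \<subseteq> F" using insert.prems by (auto split: if_splits)
    moreover from this have "g(s := 0) \<in> carrier (monoid_ring S)"
      using insert by (auto simp: monoid_ring_simps intro: finite_subset)
    moreover have "(\<lambda>t. g s * single s t) \<in> carrier (monoid_ring S)"
      using insert.prems by (auto simp: monoid_ring_simps single_def)
    ultimately have "P (\<lambda>t. (g(s := 0)) t + g s * single s t)"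
      using insert.IH[of "g(s := 0)"] insert.prems(1) int[of s "g s"]
      by (intro add) (simp_all del: fun_upd_apply)
    moreover have "(\<lambda>t. (g(s := 0)) t + g s * single s t) = g" by (auto simp: single_def)
    ultimately show ?case by simp
  qed
  then show ?thesis using assms(1) by (auto simp: monoid_ring_simps)
qed

section \<open>Partial resolutions\<close>

text \<open>
  The kernel that the next term of a resolution has to cover; in degree 0 it is the kernel of the augmentation, which
  has a different target type.
\<close>

definition resolution_kernel ::
  "nat \<Rightarrow> (nat \<Rightarrow> ('a \<Rightarrow> int, 'm) module) \<Rightarrow> (nat \<Rightarrow> 'm \<Rightarrow> 'm) \<Rightarrow> ('m \<Rightarrow> int) \<Rightarrow> 'm set" where
  "resolution_kernel k A d \<epsilon> = (case k of
     0 \<Rightarrow> module_kernel (A 0) (trivial_module :: ('a \<Rightarrow> int, int) module) \<epsilon>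
   | Suc i \<Rightarrow> module_kernel (A (Suc i)) (A i) (d i))"

lemma partial_free_resolution_0:
  "partial_free_resolution S 0 A d \<epsilon> \<longleftrightarrow> fg_free (monoid_ring S) (A 0) \<and>
     \<epsilon> \<in> left_module_hom (monoid_ring S) (A 0) trivial_module \<and> \<epsilon> ` carrier (A 0) = UNIV"
  by (auto simp: partial_free_resolution_def trivial_module_def)

lemma partial_free_resolution_Suc:
  "partial_free_resolution S (Suc k) A d \<epsilon> \<longleftrightarrow> partial_free_resolution S k A d \<epsilon> \<and>
     fg_free (monoid_ring S) (A (Suc k)) \<and>
     d k \<in> left_module_hom (monoid_ring S) (A (Suc k)) (A k) \<and>
     d k ` carrier (A (Suc k)) = resolution_kernel k A d \<epsilon>"
proof -
  have le: "(\<forall>i\<le>Suc k. Q i) \<longleftrightarrow> (\<forall>i\<le>k. Q i) \<and> Q (Suc k)"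
    and less: "(\<forall>i<Suc k. Q i) \<longleftrightarrow> (\<forall>i<k. Q i) \<and> Q k" for Q
    by (auto simp: le_Suc_eq less_Suc_eq)
  show ?thesis
  proof (cases k)
    case 0
    then show ?thesis
      unfolding partial_free_resolution_def resolution_kernel_def le less by (simp add: conj_ac)
  next
    case (Suc i)
    have "(\<forall>j. Suc j < Suc k \<longrightarrow> Q j) \<longleftrightarrow> (\<forall>j. Suc j < k \<longrightarrow> Q j) \<and> Q i" for Q
      using Suc by (auto simp: less_Suc_eq)
    then show ?thesis
      using Suc unfolding partial_free_resolution_def resolution_kernel_def le less by (simp add: conj_ac)
  qed
qed

lemma partial_free_resolution_mono:
  "\<lbrakk>partial_free_resolution S n A d \<epsilon>; k \<le> n\<rbrakk> \<Longrightarrow> partial_free_resolution S k A d \<epsilon>"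
  unfolding partial_free_resolution_def by simp

lemma partial_free_resolution_cong:
  assumes "partial_free_resolution S k A d \<epsilon>"
    and "\<And>i. i \<le> k \<Longrightarrow> A' i = A i" "\<And>i. i < k \<Longrightarrow> d' i = d i"
  shows "partial_free_resolution S k A' d' \<epsilon>"
  using assms unfolding partial_free_resolution_def by simp

lemma partial_free_resolution_fg_free:
  "partial_free_resolution S k A d \<epsilon> \<Longrightarrow> fg_free (monoid_ring S) (A k)"
  by (simp add: partial_free_resolution_def)

lemma partial_free_resolution_left_module:
  "partial_free_resolution S k A d \<epsilon> \<Longrightarrow> left_module (monoid_ring S) (A k)"
  by (simp add: partial_free_resolution_def fg_free_def)

lemma partial_free_resolution_augmentation:
  assumes "monoid S" "partial_free_resolution S k A d \<epsilon>"
  shows "left_module_map (monoid_ring S) (A 0) (trivial_module :: ('a \<Rightarrow> int, int) module) \<epsilon>"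
  using assms trivial_module_left_module
  by (auto simp: partial_free_resolution_def fg_free_def left_module_map_def left_module_map_axioms_def)

lemma partial_free_resolution_map:
  assumes "partial_free_resolution S (Suc k) A d \<epsilon>"
  shows "left_module_map (monoid_ring S) (A (Suc k)) (A k) (d k)"
  using assms
  by (auto simp: partial_free_resolution_def fg_free_def left_module_map_def left_module_map_axioms_def)

lemma resolution_kernel_submodule:
  assumes "monoid S" "partial_free_resolution S k A d \<epsilon>"
  shows "submodule (resolution_kernel k A d \<epsilon>) (monoid_ring S) (A k)"
proof (cases k)
  case 0
  then show ?thesis
    using left_module_map.submodule_kernel[OF partial_free_resolution_augmentation[OF assms]]
    by (simp add: resolution_kernel_def)
next
  case (Suc i)
  then show ?thesis
    using left_module_map.submodule_kernel[OF partial_free_resolution_map[of S i A d \<epsilon>]] assms(2)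
    by (simp add: resolution_kernel_def)
qed

lemma resolution_kernel_subset: "resolution_kernel k A d \<epsilon> \<subseteq> carrier (A k)"
  by (auto simp: resolution_kernel_def module_kernel_def split: nat.split)

lemma comparable_resolutions:
  assumes S: "monoid S" and P: "partial_free_resolution S k P dP \<epsilon>P"
    and Q: "partial_free_resolution S k Q dQ \<epsilon>Q"
  shows "comparable (monoid_ring S) (P k) (resolution_kernel k P dP \<epsilon>P)
    (Q k) (resolution_kernel k Q dQ \<epsilon>Q)"
  using P Q
proof (induction k)
  case 0
  show ?case
    using comparable_covers[OF partial_free_resolution_augmentation[OF S 0(1)]
      partial_free_resolution_augmentation[OF S 0(2)]] 0
    by (simp add: resolution_kernel_def partial_free_resolution_0)
next
  case (Suc k)
  have "comparable (monoid_ring S) (P k) (resolution_kernel k P dP \<epsilon>P)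
      (Q k) (resolution_kernel k Q dQ \<epsilon>Q)"
    using Suc by (simp add: partial_free_resolution_Suc)
  from comparable_step[OF this partial_free_resolution_map[OF Suc.prems(1)] _
      partial_free_resolution_map[OF Suc.prems(2)]]
  show ?case
    using Suc.prems partial_free_resolution_fg_free[of S k Q dQ \<epsilon>Q]
    by (simp add: partial_free_resolution_Suc resolution_kernel_def)
qed

text \<open>
  Generalised Schanuel lemma: one long partial resolution makes the last kernel of every shorter one finitely
  generated.
\<close>

lemma finitely_generated_resolution_kernel:
  assumes S: "monoid S" and P: "partial_free_resolution S (Suc k) P dP \<epsilon>P"
    and Q: "partial_free_resolution S k Q dQ \<epsilon>Q"
  shows "finitely_generated (monoid_ring S) (Q k) (resolution_kernel k Q dQ \<epsilon>Q)"
proof (rule comparable_finitely_generated)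
  have P': "partial_free_resolution S k P dP \<epsilon>P" using P by (simp add: partial_free_resolution_Suc)
  show "comparable (monoid_ring S) (P k) (resolution_kernel k P dP \<epsilon>P)
      (Q k) (resolution_kernel k Q dQ \<epsilon>Q)"
    by (rule comparable_resolutions[OF S P' Q])
  show "finitely_generated (monoid_ring S) (P k) (resolution_kernel k P dP \<epsilon>P)"
    using finitely_generated_image[OF partial_free_resolution_map[OF P]] P
    by (simp add: partial_free_resolution_Suc)
qed (rule partial_free_resolution_fg_free[OF Q] resolution_kernel_subset)+

lemma partial_free_resolution_start:
  assumes "monoid S"
  shows "\<exists>(A :: nat \<Rightarrow> ('a \<Rightarrow> int, nat \<Rightarrow> 'a \<Rightarrow> int) module) d \<epsilon>. partial_free_resolution S 0 A d \<epsilon>"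
proof -
  let ?R = "monoid_ring S" and ?Z = "trivial_module :: ('a \<Rightarrow> int, int) module"
  interpret R: ring ?R by (rule monoid_ring_ring[OF assms])
  let ?b = "\<lambda>i::nat. if i = 0 then \<one>\<^bsub>?R\<^esub> else \<zero>\<^bsub>?R\<^esub>"
  have basis: "finite_basis ?R (free_module ?R 1) {?b}"
    using R.finite_basis_free_module[OF monoid_ring_one_not_zero, of 1] by (simp add: lessThan_Suc)
  obtain \<epsilon> where \<epsilon>: "left_module_map ?R (free_module ?R 1) ?Z \<epsilon>" "\<epsilon> ?b = 1"
    using map_from_basis[OF R.left_module_free_module trivial_module_left_module[OF assms] basis,
        of "\<lambda>_. 1"] by (auto simp: trivial_module_def)
  interpret \<epsilon>: left_module_map ?R "free_module ?R 1" ?Z \<epsilon> by fact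
  have "z \<in> \<epsilon> ` carrier (free_module ?R 1)" for z
  proof -
    let ?f = "\<lambda>s. if s = \<one>\<^bsub>S\<^esub> then z else 0"
    have f: "?f \<in> carrier ?R" using monoid.one_closed[OF assms] by (auto simp: monoid_ring_simps)
    have b: "?b \<in> carrier (free_module ?R 1)" using basis by (simp add: finite_basis_def)
    have "\<epsilon> (?f \<odot>\<^bsub>free_module ?R 1\<^esub> ?b) = augmentation ?f * 1"
      using \<epsilon>.smult[OF f b] \<epsilon>(2) by (simp add: trivial_module_def)
    also have "augmentation ?f = z"
      by (subst augmentation_superset[of "{\<one>\<^bsub>S\<^esub>}"]) auto
    finally show ?thesis by (intro image_eqI[OF _ \<epsilon>.M.smult_closed[OF f b]]) simp
  qed
  then have "partial_free_resolution S 0 (\<lambda>_. free_module ?R 1) d \<epsilon>" for d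
    using \<epsilon>.hom R.fg_free_free_module[OF monoid_ring_one_not_zero]
    by (auto simp: partial_free_resolution_0)
  then show ?thesis by blast
qed

text \<open>
  A resolution can be extended greedily, because the hypothesis speaks about every partial resolution and not just about
  a well-chosen one.
\<close>

theorem left_FP_if_kernels_finitely_generated:
  fixes S :: "('a, 'b) monoid_scheme"
  assumes S: "monoid S"
    and fg: "\<And>k A d \<epsilon>. \<lbrakk>k < n; partial_free_resolution S k
        (A :: nat \<Rightarrow> ('a \<Rightarrow> int, nat \<Rightarrow> 'a \<Rightarrow> int) module) d \<epsilon>\<rbrakk>
      \<Longrightarrow> finitely_generated (monoid_ring S) (A k) (resolution_kernel k A d \<epsilon>)"
  shows "left_FP S n"
proof -
  let ?R = "monoid_ring S"
  interpret R: ring ?R by (rule monoid_ring_ring[OF S])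
  have "k \<le> n \<Longrightarrow> \<exists>(A :: nat \<Rightarrow> ('a \<Rightarrow> int, nat \<Rightarrow> 'a \<Rightarrow> int) module) d \<epsilon>.
      partial_free_resolution S k A d \<epsilon>" for k
  proof (induction k)
    case 0
    show ?case by (rule partial_free_resolution_start[OF S])
  next
    case (Suc k)
    then obtain A :: "nat \<Rightarrow> ('a \<Rightarrow> int, nat \<Rightarrow> 'a \<Rightarrow> int) module" and d \<epsilon>
      where A: "partial_free_resolution S k A d \<epsilon>" by auto
    obtain m h where h: "left_module_map ?R (free_module ?R m) (A k) h"
      "h ` carrier (free_module ?R m) = resolution_kernel k A d \<epsilon>"
      using free_module_onto[OF partial_free_resolution_left_module[OF A] monoid_ring_one_not_zero
          resolution_kernel_submodule[OF S A] fg[OF _ A]] Suc.prems by auto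
    let ?A = "A(Suc k := free_module ?R m)" and ?d = "d(k := h)"
    have "partial_free_resolution S k ?A ?d \<epsilon>"
      by (rule partial_free_resolution_cong[OF A]) auto
    moreover have "resolution_kernel k ?A ?d \<epsilon> = resolution_kernel k A d \<epsilon>"
      by (cases k) (auto simp: resolution_kernel_def)
    ultimately have "partial_free_resolution S (Suc k) ?A ?d \<epsilon>"
      using left_module_map.hom[OF h(1)] h(2) R.fg_free_free_module[OF monoid_ring_one_not_zero]
      by (simp add: partial_free_resolution_Suc)
    then show ?case by blast
  qed
  then show ?thesis unfolding left_FP_def by blast
qed

section \<open>Completely simple semigroups\<close>

text \<open>
  The two recovery laws say that all principal left ideals and all principal right ideals are minimal. They are the
  form in which complete simplicity is used.
\<close>

locale completely_simple_semigroup = mult_semigroup U for U (structure) +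
  assumes nonempty: "carrier U \<noteq> {}"
    and left_recover: "\<lbrakk>u \<in> carrier U; v \<in> carrier U\<rbrakk> \<Longrightarrow> \<exists>w\<in>carrier U. w \<otimes> (u \<otimes> v) = v"
    and right_recover: "\<lbrakk>u \<in> carrier U; v \<in> carrier U\<rbrakk> \<Longrightarrow> \<exists>w\<in>carrier U. u \<otimes> v \<otimes> w = u"

text \<open>
  If \<open>L\<close> is a minimal left ideal, the union of its translates \<open>L s\<close> is a two-sided ideal, hence everything. So \<open>v\<close> lies
  in some \<open>L s\<close>, which is again a minimal left ideal, and \<open>U (u v)\<close> is a left ideal inside it.
\<close>

lemma simple_left_recover:
  assumes "simple_semigroup U" "minimal_left_ideal L U" "u \<in> carrier U" "v \<in> carrier U"
  shows "\<exists>w\<in>carrier U. w \<otimes>\<^bsub>U\<^esub> (u \<otimes>\<^bsub>U\<^esub> v) = v"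
proof -
  interpret mult_semigroup U using assms(1) by (simp add: simple_semigroup_def)
  have L: "L \<subseteq> carrier U" "L \<noteq> {}" "\<And>s x. \<lbrakk>s \<in> carrier U; x \<in> L\<rbrakk> \<Longrightarrow> s \<otimes>\<^bsub>U\<^esub> x \<in> L"
    and min: "\<And>J. \<lbrakk>left_ideal J U; J \<subseteq> L\<rbrakk> \<Longrightarrow> J = L"
    using assms(2) by (auto simp: minimal_left_ideal_def left_ideal_def)
  let ?I = "{x \<otimes>\<^bsub>U\<^esub> s | x s. x \<in> L \<and> s \<in> carrier U}"
  have mem: "x \<otimes>\<^bsub>U\<^esub> s \<in> ?I" if "x \<in> L" "s \<in> carrier U" for x s
    using that by blast
  have "two_sided_ideal ?I U"
    unfolding two_sided_ideal_def left_ideal_def right_ideal_def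
  proof (intro conjI ballI)
    show "?I \<subseteq> carrier U" using L(1) m_closed by auto
    then show "?I \<subseteq> carrier U" .
    show "?I \<noteq> {}" using L(2) assms(3) by auto
    then show "?I \<noteq> {}" .
    fix t y assume t: "t \<in> carrier U" and "y \<in> ?I"
    then obtain x s where y: "y = x \<otimes>\<^bsub>U\<^esub> s" "x \<in> L" "s \<in> carrier U" by blast
    have eq: "t \<otimes>\<^bsub>U\<^esub> y = (t \<otimes>\<^bsub>U\<^esub> x) \<otimes>\<^bsub>U\<^esub> s" "y \<otimes>\<^bsub>U\<^esub> t = x \<otimes>\<^bsub>U\<^esub> (s \<otimes>\<^bsub>U\<^esub> t)"
      using y t L(1) by (auto simp: m_assoc)
    have "t \<otimes>\<^bsub>U\<^esub> x \<in> L" "s \<otimes>\<^bsub>U\<^esub> t \<in> carrier U"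
      using L(3) y t m_closed by simp_all
    then show "t \<otimes>\<^bsub>U\<^esub> y \<in> ?I" "y \<otimes>\<^bsub>U\<^esub> t \<in> ?I"
      unfolding eq using y(2,3) by (simp_all only: mem)
  qed
  then have "?I = carrier U" using assms(1) unfolding simple_semigroup_def by (elim conjE allE[where x = ?I]) (rule mp)
  then have "v \<in> ?I" using assms(4) by (simp only:)
  then obtain x s where v: "v = x \<otimes>\<^bsub>U\<^esub> s" "x \<in> L" "s \<in> carrier U" by blast
  \<comment> \<open>By minimality, the left ideal of all \<open>z \<in> L\<close> with \<open>z s \<in> U (u v)\<close> is \<open>L\<close>; in particular it contains \<open>x\<close>.\<close>
  let ?J = "{z \<in> L. \<exists>w\<in>carrier U. w \<otimes>\<^bsub>U\<^esub> (u \<otimes>\<^bsub>U\<^esub> v) = z \<otimes>\<^bsub>U\<^esub> s}"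
  have "left_ideal ?J U"
    unfolding left_ideal_def
  proof (intro conjI ballI)
    show "?J \<subseteq> carrier U" using L(1) by auto
    have "u \<otimes>\<^bsub>U\<^esub> (u \<otimes>\<^bsub>U\<^esub> v) = (u \<otimes>\<^bsub>U\<^esub> (u \<otimes>\<^bsub>U\<^esub> x)) \<otimes>\<^bsub>U\<^esub> s"
      using v L(1) assms(3) by (auto simp: m_assoc m_closed)
    then have "u \<otimes>\<^bsub>U\<^esub> (u \<otimes>\<^bsub>U\<^esub> x) \<in> ?J" using v L(3) assms(3) by blast
    then show "?J \<noteq> {}" by blast
    fix t z assume t: "t \<in> carrier U" and "z \<in> ?J"
    then obtain w where w: "z \<in> L" "w \<in> carrier U" "w \<otimes>\<^bsub>U\<^esub> (u \<otimes>\<^bsub>U\<^esub> v) = z \<otimes>\<^bsub>U\<^esub> s" by blast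
    have "(t \<otimes>\<^bsub>U\<^esub> w) \<otimes>\<^bsub>U\<^esub> (u \<otimes>\<^bsub>U\<^esub> v) = t \<otimes>\<^bsub>U\<^esub> (w \<otimes>\<^bsub>U\<^esub> (u \<otimes>\<^bsub>U\<^esub> v))"
      using w t assms(3,4) by (simp add: m_assoc m_closed)
    also have "\<dots> = t \<otimes>\<^bsub>U\<^esub> z \<otimes>\<^bsub>U\<^esub> s"
      using w t v(3) L(1) by (auto simp: m_assoc)
    finally show "t \<otimes>\<^bsub>U\<^esub> z \<in> ?J" using w t L(3) m_closed by blast
  qed
  then have "?J = L" by (rule min) blast
  then show ?thesis using v by blast
qed

text \<open>
  Reversing the product turns the law for left ideals into the one for right ideals.
\<close>

definition opposite :: "('a, 'b) monoid_scheme \<Rightarrow> 'a monoid" where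
  "opposite U = \<lparr>carrier = carrier U, mult = (\<lambda>x y. y \<otimes>\<^bsub>U\<^esub> x), one = \<one>\<^bsub>U\<^esub>\<rparr>"

lemma opposite_ideals:
  "left_ideal I (opposite U) = right_ideal I U" "right_ideal I (opposite U) = left_ideal I U"
  by (simp_all add: opposite_def left_ideal_def right_ideal_def)

lemma simple_semigroup_opposite:
  assumes "simple_semigroup U"
  shows "simple_semigroup (opposite U)"
proof -
  interpret mult_semigroup U using assms by (simp add: simple_semigroup_def)
  have "mult_semigroup (opposite U)"
    by unfold_locales (auto simp: opposite_def m_assoc m_closed)
  then show ?thesis
    using assms by (auto simp: simple_semigroup_def two_sided_ideal_def opposite_ideals)
      (auto simp: opposite_def)
qed

lemma completely_simple_semigroup:
  assumes "completely_simple U"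
  shows "completely_simple_semigroup U"
proof -
  obtain L K where simple: "simple_semigroup U" and L: "minimal_left_ideal L U"
    and K: "minimal_right_ideal K U"
    using assms by (auto simp: completely_simple_def)
  have "minimal_left_ideal K (opposite U)"
    using K by (simp add: minimal_left_ideal_def minimal_right_ideal_def opposite_ideals)
  note right = simple_left_recover[OF simple_semigroup_opposite[OF simple] this]
  show ?thesis
  proof (intro completely_simple_semigroup.intro completely_simple_semigroup_axioms.intro)
    show "mult_semigroup U" using simple by (simp add: simple_semigroup_def)
    show "carrier U \<noteq> {}" using L by (auto simp: minimal_left_ideal_def left_ideal_def)
    show "\<exists>w\<in>carrier U. w \<otimes>\<^bsub>U\<^esub> (u \<otimes>\<^bsub>U\<^esub> v) = v" if "u \<in> carrier U" "v \<in> carrier U" for u v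
      by (rule simple_left_recover[OF simple L that])
    show "\<exists>w\<in>carrier U. u \<otimes>\<^bsub>U\<^esub> v \<otimes>\<^bsub>U\<^esub> w = u" if "u \<in> carrier U" "v \<in> carrier U" for u v
      using right[of v u] that by (simp add: opposite_def)
  qed
qed

context completely_simple_semigroup
begin

definition principal_left :: "'a \<Rightarrow> 'a set" where
  "principal_left u = (\<lambda>w. w \<otimes> u) ` carrier U"

definition principal_right :: "'a \<Rightarrow> 'a set" where
  "principal_right u = (\<lambda>w. u \<otimes> w) ` carrier U"

lemma principal_left_self: "u \<in> carrier U \<Longrightarrow> u \<in> principal_left u"
  using left_recover[of u u] by (auto simp: principal_left_def m_assoc[symmetric] m_closed)
    (metis image_eqI m_assoc m_closed)

lemma principal_right_self: "u \<in> carrier U \<Longrightarrow> u \<in> principal_right u"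
  using right_recover[of u u] by (auto simp: principal_right_def m_assoc m_closed)
    (metis image_eqI m_closed)

lemma principal_left_mult:
  assumes "u \<in> carrier U" "v \<in> carrier U"
  shows "principal_left (u \<otimes> v) = principal_left v"
proof
  show "principal_left (u \<otimes> v) \<subseteq> principal_left v"
    using assms by (auto simp: principal_left_def m_assoc[symmetric] m_closed)
  obtain w where "w \<in> carrier U" "w \<otimes> (u \<otimes> v) = v" using left_recover assms by blast
  then have "t \<otimes> v = (t \<otimes> w) \<otimes> (u \<otimes> v)" "t \<otimes> w \<in> carrier U" if "t \<in> carrier U" for t
    using assms that by (simp_all add: m_assoc m_closed)
  then show "principal_left v \<subseteq> principal_left (u \<otimes> v)"
    unfolding principal_left_def by blast
qed

lemma principal_right_mult:
  assumes "u \<in> carrier U" "v \<in> carrier U"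
  shows "principal_right (u \<otimes> v) = principal_right u"
proof
  show "principal_right (u \<otimes> v) \<subseteq> principal_right u"
    using assms by (auto simp: principal_right_def m_assoc m_closed)
  obtain w where "w \<in> carrier U" "u \<otimes> v \<otimes> w = u" using right_recover assms by blast
  then have "u \<otimes> t = (u \<otimes> v) \<otimes> (w \<otimes> t)" "w \<otimes> t \<in> carrier U" if "t \<in> carrier U" for t
    using assms that by (metis m_assoc m_closed, simp add: m_closed)
  then show "principal_right u \<subseteq> principal_right (u \<otimes> v)"
    unfolding principal_right_def by blast
qed

lemma left_ideal_principal_left: "u \<in> carrier U \<Longrightarrow> left_ideal (principal_left u) U"
  using nonempty by (auto simp: left_ideal_def principal_left_def m_closed m_assoc[symmetric])

lemma right_ideal_principal_right: "u \<in> carrier U \<Longrightarrow> right_ideal (principal_right u) U"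
  using nonempty by (auto simp: right_ideal_def principal_right_def m_closed m_assoc)

lemma finite_principal_left:
  "finite {L. left_ideal L U} \<Longrightarrow> finite (principal_left ` carrier U)"
  by (rule finite_subset[of _ "{L. left_ideal L U}"]) (use left_ideal_principal_left in auto)

text \<open>
  Every right ideal is a union of principal ones.
\<close>

lemma finite_right_ideals_iff:
  "finite {R. right_ideal R U} \<longleftrightarrow> finite (principal_right ` carrier U)"
proof
  show "finite (principal_right ` carrier U)" if "finite {R. right_ideal R U}"
    by (rule finite_subset[OF _ that]) (use right_ideal_principal_right in auto)
next
  assume "finite (principal_right ` carrier U)"
  then have "finite (Union ` Pow (principal_right ` carrier U))" by simp
  moreover have "R \<in> Union ` Pow (principal_right ` carrier U)" if R: "right_ideal R U" for R
  proof (rule image_eqI)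
    show "principal_right ` R \<in> Pow (principal_right ` carrier U)"
      using R by (auto simp: right_ideal_def)
    have "u \<in> principal_right u" "principal_right u \<subseteq> R" if "u \<in> R" for u
      using R that principal_right_self by (auto simp: right_ideal_def principal_right_def)
    then show "R = \<Union> (principal_right ` R)" by blast
  qed
  ultimately show "finite {R. right_ideal R U}"
    by (intro finite_subset[of "{R. right_ideal R U}" "Union ` Pow (principal_right ` carrier U)"]) blast+
qed

text \<open>
  With \<open>u u w = u = w' u u\<close> the element \<open>u w = w' u\<close> is the identity of the maximal subgroup containing \<open>u\<close>.
\<close>

lemma idempotent_left_unit:
  assumes "u \<in> carrier U"
  obtains f where "f \<in> principal_right u" "f \<in> carrier U" "f \<otimes> f = f" "f \<otimes> u = u"
proof -
  obtain w where w: "w \<in> carrier U" "u \<otimes> u \<otimes> w = u" using right_recover assms by blast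
  obtain w' where w': "w' \<in> carrier U" "w' \<otimes> (u \<otimes> u) = u" using left_recover assms by blast
  have f: "u \<otimes> w = w' \<otimes> u"
  proof -
    have "u \<otimes> w = w' \<otimes> (u \<otimes> u) \<otimes> w" using w'(2) by simp
    also have "\<dots> = w' \<otimes> (u \<otimes> u \<otimes> w)" using w(1) w'(1) assms by (simp add: m_assoc m_closed)
    finally show ?thesis using w(2) by simp
  qed
  show thesis
  proof (rule that[of "u \<otimes> w"])
    show "u \<otimes> w \<in> principal_right u" "u \<otimes> w \<in> carrier U"
      using w assms by (auto simp: principal_right_def m_closed)
    show "u \<otimes> w \<otimes> u = u" unfolding f using w' assms by (simp add: m_assoc)
    have "u \<otimes> w \<otimes> (u \<otimes> w) = w' \<otimes> (u \<otimes> u \<otimes> w)"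
      unfolding f using w w' assms by (metis f m_assoc m_closed)
    then show "u \<otimes> w \<otimes> (u \<otimes> w) = u \<otimes> w" using w(2) f by simp
  qed
qed

text \<open>
  One idempotent is chosen in each minimal right ideal. The last property says that different minimal right ideals are
  disjoint.
\<close>

lemma idempotent_transversal:
  obtains E where "E \<subseteq> carrier U" "E \<noteq> {}" "finite (principal_right ` carrier U) \<Longrightarrow> finite E"
    "\<And>f. f \<in> E \<Longrightarrow> f \<otimes> f = f" "\<And>u. u \<in> carrier U \<Longrightarrow> \<exists>f\<in>E. f \<otimes> u = u"
    "\<And>f f' u v. \<lbrakk>f \<in> E; f' \<in> E; u \<in> carrier U; v \<in> carrier U; f \<otimes> u = f' \<otimes> v\<rbrakk> \<Longrightarrow> f = f'"
proof -
  define g where "g C = (SOME f. f \<in> C \<and> f \<in> carrier U \<and> f \<otimes> f = f)" for C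
  have g: "g (principal_right u) \<in> principal_right u" "g (principal_right u) \<in> carrier U"
    "g (principal_right u) \<otimes> g (principal_right u) = g (principal_right u)"
    if u: "u \<in> carrier U" for u
  proof -
    obtain f where "f \<in> principal_right u \<and> f \<in> carrier U \<and> f \<otimes> f = f"
      by (rule idempotent_left_unit[OF u]) blast
    from someI[of "\<lambda>f. f \<in> principal_right u \<and> f \<in> carrier U \<and> f \<otimes> f = f", OF this]
    show "g (principal_right u) \<in> principal_right u" "g (principal_right u) \<in> carrier U"
      "g (principal_right u) \<otimes> g (principal_right u) = g (principal_right u)"
      by (auto simp: g_def)
  qed
  have pr: "principal_right (g (principal_right u)) = principal_right u" if u: "u \<in> carrier U" for u
  proof -
    obtain w where "w \<in> carrier U" "g (principal_right u) = u \<otimes> w"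
      using g(1)[OF u] unfolding principal_right_def by blast
    then show ?thesis using principal_right_mult u by simp
  qed
  show thesis
  proof (rule that[of "g ` principal_right ` carrier U"])
    show "\<exists>f\<in>g ` principal_right ` carrier U. f \<otimes> u = u" if u: "u \<in> carrier U" for u
    proof
      let ?f = "g (principal_right u)"
      have "u \<in> principal_right ?f" using principal_right_self[OF u] pr[OF u] by simp
      then obtain w where "w \<in> carrier U" "u = ?f \<otimes> w" by (auto simp: principal_right_def)
      then show "?f \<otimes> u = u" using g(2,3)[OF u] by (metis m_assoc)
    qed (use u in auto)
    fix f f' u v
    assume "f \<in> g ` principal_right ` carrier U" "f' \<in> g ` principal_right ` carrier U"
      and uv: "u \<in> carrier U" "v \<in> carrier U" "f \<otimes> u = f' \<otimes> v"
    then obtain a b where a: "a \<in> carrier U" "f = g (principal_right a)"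
      and b: "b \<in> carrier U" "f' = g (principal_right b)" by auto
    have "principal_right (f \<otimes> u) = principal_right f"
      by (rule principal_right_mult) (use a g(2) uv(1) in auto)
    moreover have "principal_right (f' \<otimes> v) = principal_right f'"
      by (rule principal_right_mult) (use b g(2) uv(2) in auto)
    ultimately show "f = f'" using uv(3) pr a b by simp
  qed (use g nonempty in auto)
qed

end

section \<open>The maximal subgroup at an idempotent\<close>

locale completely_simple_pointed = completely_simple_semigroup U for U (structure) +
  fixes e
  assumes e_idempotent: "idempotent_in e U"
begin

lemma e_closed: "e \<in> carrier U" and e_e: "e \<otimes> e = e"
  using e_idempotent by (auto simp: idempotent_in_def)

abbreviation H where "H \<equiv> units_of (local_monoid U e)"

text \<open>
  The local monoid \<open>eUe\<close> consists of units: one-sided inverses of \<open>x\<close> come from the recovery laws for \<open>e x\<close> and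
  \<open>x e\<close>.
\<close>

lemma H_carrier: "carrier H = {x \<in> carrier U. e \<otimes> x = x \<and> x \<otimes> e = x}"
proof
  show "carrier H \<subseteq> {x \<in> carrier U. e \<otimes> x = x \<and> x \<otimes> e = x}"
    using e_closed e_e
    by (auto simp: units_of_def Units_def local_monoid_def m_closed)
      (auto simp: m_assoc m_closed, auto simp: m_assoc[symmetric] m_closed)
  show "{x \<in> carrier U. e \<otimes> x = x \<and> x \<otimes> e = x} \<subseteq> carrier H"
  proof
    fix x assume "x \<in> {x \<in> carrier U. e \<otimes> x = x \<and> x \<otimes> e = x}"
    then have x: "x \<in> carrier U" "e \<otimes> x = x" "x \<otimes> e = x" by auto
    obtain w where w: "w \<in> carrier U" "e \<otimes> x \<otimes> w = e" using right_recover e_closed x by blast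
    obtain w' where w': "w' \<in> carrier U" "w' \<otimes> (x \<otimes> e) = e" using left_recover e_closed x by blast
    interpret L: monoid "local_monoid U e"
      by (rule local_monoid_monoid[OF mult_semigroup_axioms e_idempotent])
    have mem: "e \<otimes> y \<otimes> e \<in> carrier (local_monoid U e)" if "y \<in> carrier U" for y
      using that by (auto simp: local_monoid_def)
    have xL: "x \<in> carrier (local_monoid U e)" using mem[OF x(1)] x by simp
    have r: "x \<otimes> (e \<otimes> w \<otimes> e) = e"
    proof -
      have "x \<otimes> (e \<otimes> w \<otimes> e) = (x \<otimes> e) \<otimes> w \<otimes> e" using x(1) w e_closed by (simp add: m_assoc m_closed)
      then show ?thesis using x w e_e by simp
    qed
    have l: "(e \<otimes> w' \<otimes> e) \<otimes> x = e"
    proof -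
      have "(e \<otimes> w' \<otimes> e) \<otimes> x = e \<otimes> (w' \<otimes> (e \<otimes> x))" using x(1) w' e_closed by (simp add: m_assoc m_closed)
      then show ?thesis using x w' e_e by simp
    qed
    have "e \<otimes> w' \<otimes> e = e \<otimes> w \<otimes> e"
      using L.inv_unique[of "e \<otimes> w' \<otimes> e" x "e \<otimes> w \<otimes> e"] r l xL mem w w'
      by (auto simp: local_monoid_def)
    then have "x \<in> Units (local_monoid U e)"
      using r l xL mem[OF w(1)] by (auto simp: Units_def local_monoid_def)
    then show "x \<in> carrier H" by (simp add: units_of_def)
  qed
qed

lemma H_mult: "x \<otimes>\<^bsub>H\<^esub> y = x \<otimes> y" and H_one: "\<one>\<^bsub>H\<^esub> = e"
  by (simp_all add: units_of_def local_monoid_def)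

lemma H_group: "group H"
  by (rule maximal_subgroup_group[OF mult_semigroup_axioms])
     (use e_idempotent in \<open>auto simp: maximal_subgroup_def\<close>)

lemma H_closed: "h \<in> carrier H \<Longrightarrow> h \<in> carrier U"
  by (simp add: H_carrier)

lemma H_inverse:
  assumes "h \<in> carrier H"
  obtains k where "k \<in> carrier H" "k \<otimes> h = e" "h \<otimes> k = e"
  using group.l_inv[OF H_group assms] group.r_inv[OF H_group assms] group.inv_closed[OF H_group assms]
  by (auto simp: H_mult H_one)

text \<open>
  The \<open>H\<close>-orbits on \<open>eU\<close> are the intersections of \<open>eU\<close> with the minimal left ideals, and the action is free since every
  \<open>r \<in> eU\<close> satisfies \<open>r w = e\<close> for some \<open>w\<close>.
\<close>

lemma orbit_transversal:
  assumes "finite {L. left_ideal L U}"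
  obtains T where "finite T" "T \<subseteq> carrier U" "\<And>r. r \<in> T \<Longrightarrow> e \<otimes> r = r"
    "\<And>s. \<lbrakk>s \<in> carrier U; e \<otimes> s = s\<rbrakk> \<Longrightarrow> \<exists>h\<in>carrier H. \<exists>r\<in>T. s = h \<otimes> r"
    "\<And>h h' r r'. \<lbrakk>h \<in> carrier H; h' \<in> carrier H; r \<in> T; r' \<in> T; h \<otimes> r = h' \<otimes> r'\<rbrakk>
      \<Longrightarrow> h = h' \<and> r = r'"
proof -
  define g where "g C = (SOME r. r \<in> C \<and> r \<in> carrier U \<and> e \<otimes> r = r)" for C
  have g: "g (principal_left u) \<in> principal_left u" "g (principal_left u) \<in> carrier U"
    "e \<otimes> g (principal_left u) = g (principal_left u)" if u: "u \<in> carrier U" for u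
  proof -
    have "e \<otimes> u \<in> principal_left u \<and> e \<otimes> u \<in> carrier U \<and> e \<otimes> (e \<otimes> u) = e \<otimes> u"
      using u e_closed e_e by (auto simp: principal_left_def m_closed m_assoc[symmetric])
    from someI[of "\<lambda>r. r \<in> principal_left u \<and> r \<in> carrier U \<and> e \<otimes> r = r", OF this]
    show "g (principal_left u) \<in> principal_left u" "g (principal_left u) \<in> carrier U"
      "e \<otimes> g (principal_left u) = g (principal_left u)" by (auto simp: g_def)
  qed
  have pl: "principal_left (g (principal_left u)) = principal_left u" if u: "u \<in> carrier U" for u
  proof -
    obtain w where "w \<in> carrier U" "g (principal_left u) = w \<otimes> u"
      using g(1)[OF u] unfolding principal_left_def by blast
    then show ?thesis using principal_left_mult u by simp
  qed
  show thesis
  proof (rule that[of "g ` principal_left ` carrier U"])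
    show "finite (g ` principal_left ` carrier U)" using finite_principal_left[OF assms] by simp
    fix s assume s: "s \<in> carrier U" "e \<otimes> s = s"
    let ?r = "g (principal_left s)"
    have "s \<in> principal_left ?r" using principal_left_self[OF s(1)] pl[OF s(1)] by simp
    then obtain w where w: "w \<in> carrier U" "s = w \<otimes> ?r" by (auto simp: principal_left_def)
    have "s = e \<otimes> (w \<otimes> (e \<otimes> ?r))" using s(2) w(2) g(3)[OF s(1)] by simp
    also have "\<dots> = e \<otimes> w \<otimes> e \<otimes> ?r" using w(1) e_closed g(2)[OF s(1)] by (simp add: m_assoc m_closed)
    finally have "s = e \<otimes> w \<otimes> e \<otimes> ?r" .
    moreover have "e \<otimes> w \<otimes> e \<in> carrier H"
    proof -
      have "e \<otimes> (e \<otimes> w \<otimes> e) = e \<otimes> e \<otimes> w \<otimes> e" "e \<otimes> w \<otimes> e \<otimes> e = e \<otimes> w \<otimes> (e \<otimes> e)"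
        using w(1) e_closed by (simp_all add: m_assoc m_closed)
      then show ?thesis using w(1) e_closed e_e by (simp add: H_carrier m_closed)
    qed
    ultimately show "\<exists>h\<in>carrier H. \<exists>r\<in>g ` principal_left ` carrier U. s = h \<otimes> r"
      using s(1) by blast
  next
    fix h h' r r'
    assume h: "h \<in> carrier H" "h' \<in> carrier H"
      and "r \<in> g ` principal_left ` carrier U" "r' \<in> g ` principal_left ` carrier U"
      and eq: "h \<otimes> r = h' \<otimes> r'"
    then obtain a b where a: "a \<in> carrier U" "r = g (principal_left a)"
      and b: "b \<in> carrier U" "r' = g (principal_left b)" by auto
    have rU: "r \<in> carrier U" "e \<otimes> r = r" "r' \<in> carrier U" using g a b by auto
    have hU: "h \<in> carrier U" "h' \<in> carrier U" "h \<otimes> e = h" "h' \<otimes> e = h'"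
      using h by (auto simp: H_carrier)
    have "principal_left (h \<otimes> r) = principal_left r"
      by (rule principal_left_mult) (use rU hU in auto)
    moreover have "principal_left (h' \<otimes> r') = principal_left r'"
      by (rule principal_left_mult) (use rU hU in auto)
    ultimately have r: "r = r'" using eq pl a b by simp
    obtain w where w: "w \<in> carrier U" "e \<otimes> r \<otimes> w = e" using right_recover e_closed rU by blast
    have "h = h \<otimes> (r \<otimes> w)" "h' = h' \<otimes> (r \<otimes> w)" using w rU hU by simp_all
    then have "h = h'" using eq r hU w(1) rU(1) by (metis m_assoc)
    with r show "h = h' \<and> r = r'" by simp
  qed (use g in auto)
qed

end

section \<open>Modules over a monoid ring\<close>

lemma left_module_map_equivariant:
  fixes S :: "('a, 'b) monoid_scheme"
  assumes S: "monoid S" and "left_module (monoid_ring S) M" "left_module (monoid_ring S) N"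
    and closed: "\<And>x. x \<in> carrier M \<Longrightarrow> h x \<in> carrier N"
    and add: "\<And>x y. \<lbrakk>x \<in> carrier M; y \<in> carrier M\<rbrakk> \<Longrightarrow> h (x \<oplus>\<^bsub>M\<^esub> y) = h x \<oplus>\<^bsub>N\<^esub> h y"
    and equivariant: "\<And>s x. \<lbrakk>s \<in> carrier S; x \<in> carrier M\<rbrakk> \<Longrightarrow> h (single s \<odot>\<^bsub>M\<^esub> x) = single s \<odot>\<^bsub>N\<^esub> h x"
  shows "left_module_map (monoid_ring S) M N h"
proof -
  interpret M: left_module "monoid_ring S" M by fact
  interpret N: left_module "monoid_ring S" N by fact
  have zero: "h \<zero>\<^bsub>M\<^esub> = \<zero>\<^bsub>N\<^esub>"
    using add[of "\<zero>\<^bsub>M\<^esub>" "\<zero>\<^bsub>M\<^esub>"] closed[of "\<zero>\<^bsub>M\<^esub>"] by simp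
  have uminus: "h (\<ominus>\<^bsub>M\<^esub> x) = \<ominus>\<^bsub>N\<^esub> h x" if "x \<in> carrier M" for x
    using add[of "\<ominus>\<^bsub>M\<^esub> x" x] closed that zero
    by (intro N.M.minus_equality[symmetric]) (simp_all add: M.M.l_neg)
  have z: "(\<lambda>_. 0) = \<zero>\<^bsub>monoid_ring S\<^esub>" by (simp add: monoid_ring_simps)
  have "h (f \<odot>\<^bsub>M\<^esub> x) = f \<odot>\<^bsub>N\<^esub> h x" if f: "f \<in> carrier (monoid_ring S)" and x: "x \<in> carrier M" for f x
    using f
  proof (induction f rule: monoid_ring_induct)
    case zero
    then show ?case using x by (simp only: z M.zero_smult N.zero_smult closed \<open>h \<zero>\<^bsub>M\<^esub> = \<zero>\<^bsub>N\<^esub>\<close>)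
  next
    case (single s)
    then show ?case using x by (rule equivariant)
  next
    case (add f g)
    have eq: "(\<lambda>s. f s + g s) = f \<oplus>\<^bsub>monoid_ring S\<^esub> g" by (simp add: monoid_ring_simps)
    show ?case
      unfolding eq using add x closed
      by (simp add: M.smult_l_distr N.smult_l_distr M.smult_closed assms(5))
  next
    case (uminus f)
    show ?case
      unfolding monoid_ring_a_inv[OF S uminus(1), symmetric]
      using uminus x closed \<open>\<And>x. x \<in> carrier M \<Longrightarrow> h (\<ominus>\<^bsub>M\<^esub> x) = \<ominus>\<^bsub>N\<^esub> h x\<close>
      by (simp add: M.minus_smult N.minus_smult M.smult_closed)
  qed
  then show ?thesis
    using closed add M.left_module_axioms N.left_module_axioms
    by (auto simp: left_module_map_def left_module_map_axioms_def left_module_hom_def)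
qed

lemma submodule_equivariant:
  fixes S :: "('a, 'b) monoid_scheme"
  assumes S: "monoid S" and "left_module (monoid_ring S) M"
    and sub: "N \<subseteq> carrier M" and zero: "\<zero>\<^bsub>M\<^esub> \<in> N"
    and add: "\<And>x y. \<lbrakk>x \<in> N; y \<in> N\<rbrakk> \<Longrightarrow> x \<oplus>\<^bsub>M\<^esub> y \<in> N"
    and uminus: "\<And>x. x \<in> N \<Longrightarrow> \<ominus>\<^bsub>M\<^esub> x \<in> N"
    and equivariant: "\<And>s x. \<lbrakk>s \<in> carrier S; x \<in> N\<rbrakk> \<Longrightarrow> single s \<odot>\<^bsub>M\<^esub> x \<in> N"
  shows "submodule N (monoid_ring S) M"
proof -
  interpret M: left_module "monoid_ring S" M by fact
  have z: "(\<lambda>_. 0) = \<zero>\<^bsub>monoid_ring S\<^esub>" by (simp add: monoid_ring_simps)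
  have "f \<odot>\<^bsub>M\<^esub> x \<in> N" if f: "f \<in> carrier (monoid_ring S)" and x: "x \<in> N" for f x
    using f
  proof (induction f rule: monoid_ring_induct)
    case zero
    then show ?case using x sub assms(4) by (simp add: z M.zero_smult subset_iff)
  next
    case (single s)
    then show ?case using x by (rule equivariant)
  next
    case (add f g)
    have eq: "(\<lambda>s. f s + g s) = f \<oplus>\<^bsub>monoid_ring S\<^esub> g" by (simp add: monoid_ring_simps)
    show ?case
      unfolding eq using add x sub assms(5)
      by (simp add: M.smult_l_distr subset_iff)
  next
    case (uminus f)
    show ?case
      unfolding monoid_ring_a_inv[OF S uminus(1), symmetric]
      using uminus x sub assms(6) by (simp add: M.minus_smult subset_iff)
  qed
  then show ?thesis
    by (intro M.submodule_introduction) (use sub zero add in auto)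
qed

lemma single_mult_translate:
  assumes "f \<in> carrier (monoid_ring S)"
    and "\<And>t. f t \<noteq> 0 \<Longrightarrow> s \<otimes>\<^bsub>S\<^esub> t = u \<longleftrightarrow> t = v"
  shows "(single s \<otimes>\<^bsub>monoid_ring S\<^esub> f) u = f v"
proof -
  have "(single s \<otimes>\<^bsub>monoid_ring S\<^esub> f) u = (\<Sum>t | f t \<noteq> 0. if t = v then f t else 0)"
    unfolding single_mult[OF assms(1)] using assms(2) by (intro sum.cong) auto
  also have "\<dots> = f v"
    using assms(1) by (auto simp: monoid_ring_simps)
  finally show ?thesis .
qed

section \<open>The corner of a module at an idempotent\<close>

definition extend_by_zero :: "('a \<Rightarrow> int) \<Rightarrow> 'a option \<Rightarrow> int" where
  "extend_by_zero g s = (case s of None \<Rightarrow> 0 | Some u \<Rightarrow> g u)"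

text \<open>
  This is \<open>eM\<close> as a module over \<open>\<int>H\<close>. The group ring is not a unital subring of \<open>\<int>S\<close>: its identity is \<open>e\<close>,
  which acts as the identity exactly on the elements retained here.
\<close>

definition corner :: "'a \<Rightarrow> ('a option \<Rightarrow> int, 'm) module \<Rightarrow> ('a \<Rightarrow> int, 'm) module" where
  "corner e M = \<lparr>carrier = {x \<in> carrier M. single (Some e) \<odot>\<^bsub>M\<^esub> x = x}, mult = mult M, one = \<one>\<^bsub>M\<^esub>,
     zero = \<zero>\<^bsub>M\<^esub>, add = add M, smult = (\<lambda>g x. extend_by_zero g \<odot>\<^bsub>M\<^esub> x)\<rparr>"

lemma corner_simps:
  "carrier (corner e M) = {x \<in> carrier M. single (Some e) \<odot>\<^bsub>M\<^esub> x = x}"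
  "\<zero>\<^bsub>corner e M\<^esub> = \<zero>\<^bsub>M\<^esub>" "x \<oplus>\<^bsub>corner e M\<^esub> y = x \<oplus>\<^bsub>M\<^esub> y"
  "g \<odot>\<^bsub>corner e M\<^esub> x = extend_by_zero g \<odot>\<^bsub>M\<^esub> x"
  by (simp_all add: corner_def)

lemma extend_by_zero_support: "{s. extend_by_zero g s \<noteq> 0} = Some ` {u. g u \<noteq> 0}"
  by (auto simp: extend_by_zero_def split: option.splits)

lemma extend_by_zero_single: "extend_by_zero (single u) = single (Some u)"
  by (auto simp: extend_by_zero_def single_def split: option.splits)

lemma augmentation_extend_by_zero: "augmentation (extend_by_zero g) = augmentation g"
  unfolding augmentation_def extend_by_zero_support
  by (subst sum.reindex) (auto simp: extend_by_zero_def)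

lemma adjoin_identity_simps:
  "carrier (adjoin_identity U) = insert None (Some ` carrier U)"
  "\<one>\<^bsub>adjoin_identity U\<^esub> = None"
  "None \<otimes>\<^bsub>adjoin_identity U\<^esub> s = s" "s \<otimes>\<^bsub>adjoin_identity U\<^esub> None = s"
  "Some u \<otimes>\<^bsub>adjoin_identity U\<^esub> Some v = Some (u \<otimes>\<^bsub>U\<^esub> v)"
  by (simp_all add: adjoin_identity_def split: option.split)

context completely_simple_pointed
begin

abbreviation S where "S \<equiv> adjoin_identity U"
abbreviation ZS where "ZS \<equiv> monoid_ring S"
abbreviation ZH where "ZH \<equiv> monoid_ring H"

lemma S_monoid: "monoid S"
  by (rule adjoin_identity_monoid[OF mult_semigroup_axioms])

lemma H_monoid: "monoid H"
  using H_group by (simp add: group_def)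

lemma ZS_ring: "ring ZS" and ZH_ring: "ring ZH"
  using S_monoid H_monoid by (auto intro: monoid_ring_ring)

lemma single_Some_closed: "u \<in> carrier U \<Longrightarrow> single (Some u) \<in> carrier ZS"
  by (rule single_closed) (simp add: adjoin_identity_simps)

lemma extend_by_zero_closed: "g \<in> carrier ZH \<Longrightarrow> extend_by_zero g \<in> carrier ZS"
  using H_closed by (auto simp: monoid_ring_simps extend_by_zero_support adjoin_identity_simps)

lemma extend_by_zero_mult:
  assumes "f \<in> carrier ZH" "g \<in> carrier ZH"
  shows "extend_by_zero (f \<otimes>\<^bsub>ZH\<^esub> g) = extend_by_zero f \<otimes>\<^bsub>ZS\<^esub> extend_by_zero g"
proof
  fix s
  let ?F = "{u. f u \<noteq> 0}" and ?G = "{u. g u \<noteq> 0}"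
  have fin: "finite ?F" "finite ?G" using assms by (auto simp: monoid_ring_simps)
  have "(extend_by_zero f \<otimes>\<^bsub>ZS\<^esub> extend_by_zero g) s =
      (\<Sum>a\<in>Some ` ?F. \<Sum>b\<in>Some ` ?G. if a \<otimes>\<^bsub>S\<^esub> b = s then extend_by_zero f a * extend_by_zero g b else 0)"
    by (rule monoid_ring_mult) (use fin in \<open>simp_all add: extend_by_zero_support\<close>)
  also have "\<dots> = (\<Sum>a\<in>?F. \<Sum>b\<in>?G. if Some (a \<otimes> b) = s then f a * g b else 0)"
    by (simp add: sum.reindex extend_by_zero_def adjoin_identity_simps cong: if_cong)
  also have "\<dots> = extend_by_zero (f \<otimes>\<^bsub>ZH\<^esub> g) s"
    by (cases s) (simp_all add: extend_by_zero_def monoid_ring_def H_mult)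
  finally show "extend_by_zero (f \<otimes>\<^bsub>ZH\<^esub> g) s = (extend_by_zero f \<otimes>\<^bsub>ZS\<^esub> extend_by_zero g) s" by simp
qed

lemma extend_by_zero_add: "extend_by_zero (f \<oplus>\<^bsub>ZH\<^esub> g) = extend_by_zero f \<oplus>\<^bsub>ZS\<^esub> extend_by_zero g"
  by (auto simp: monoid_ring_simps extend_by_zero_def split: option.split)

lemma extend_by_zero_one: "extend_by_zero \<one>\<^bsub>ZH\<^esub> = single (Some e)"
  by (simp add: monoid_ring_simps H_one extend_by_zero_single)

lemma e_H: "e \<in> carrier H"
  using e_closed e_e by (simp add: H_carrier)

lemma e_extend_by_zero:
  assumes "g \<in> carrier ZH"
  shows "single (Some e) \<otimes>\<^bsub>ZS\<^esub> extend_by_zero g = extend_by_zero g"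
proof -
  interpret H: ring ZH by (rule ZH_ring)
  have "single (Some e) \<otimes>\<^bsub>ZS\<^esub> extend_by_zero g = extend_by_zero (\<one>\<^bsub>ZH\<^esub> \<otimes>\<^bsub>ZH\<^esub> g)"
    using extend_by_zero_mult[OF H.one_closed assms] by (simp add: extend_by_zero_one)
  then show ?thesis using assms by simp
qed

lemma corner_left_module:
  assumes "left_module ZS M"
  shows "left_module ZH (corner e M)"
proof -
  interpret M: left_module ZS M by fact
  interpret H: ring ZH by (rule ZH_ring)
  note se = single_Some_closed[OF e_closed]
  have "abelian_group (corner e M)"
  proof (rule abelian_groupI)
    fix x assume "x \<in> carrier (corner e M)"
    then show "\<exists>y\<in>carrier (corner e M). y \<oplus>\<^bsub>corner e M\<^esub> x = \<zero>\<^bsub>corner e M\<^esub>"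
      by (intro bexI[of _ "\<ominus>\<^bsub>M\<^esub> x"]) (auto simp: corner_simps M.M.l_neg M.smult_minus se)
  qed (auto simp: corner_simps M.smult_r_distr M.smult_zero se M.M.a_ac)
  moreover have "single (Some e) \<odot>\<^bsub>M\<^esub> (extend_by_zero g \<odot>\<^bsub>M\<^esub> x) = extend_by_zero g \<odot>\<^bsub>M\<^esub> x"
    if "g \<in> carrier ZH" "x \<in> carrier M" for g x
    using that by (simp add: M.smult_assoc[symmetric] se extend_by_zero_closed e_extend_by_zero)
  ultimately show ?thesis
    unfolding left_module_def left_module_axioms_def using ZH_ring
    by (auto simp: corner_simps M.smult_closed extend_by_zero_closed extend_by_zero_add
        extend_by_zero_mult extend_by_zero_one M.smult_l_distr M.smult_r_distr M.smult_assoc)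
qed

lemma corner_a_inv:
  assumes "left_module ZS M" "x \<in> carrier (corner e M)"
  shows "\<ominus>\<^bsub>corner e M\<^esub> x = \<ominus>\<^bsub>M\<^esub> x"
proof -
  interpret M: left_module ZS M by fact
  interpret C: left_module ZH "corner e M" by (rule corner_left_module) fact
  show ?thesis
    by (rule C.M.minus_equality)
       (use assms(2) in \<open>auto simp: corner_simps M.M.l_neg M.smult_minus single_Some_closed e_closed\<close>)
qed

lemma corner_map:
  assumes "left_module_map ZS M N h"
  shows "left_module_map ZH (corner e M) (corner e N) h"
proof -
  interpret h: left_module_map ZS M N h by fact
  show ?thesis
    using corner_left_module[OF h.M.left_module_axioms] corner_left_module[OF h.N.left_module_axioms]
    by (auto simp: left_module_map_def left_module_map_axioms_def left_module_hom_def corner_simps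
        h.add h.smult[symmetric] h.closed extend_by_zero_closed single_Some_closed e_closed)
qed

lemma e_smult_corner:
  assumes "left_module ZS M" "x \<in> carrier M"
  shows "single (Some e) \<odot>\<^bsub>M\<^esub> x \<in> carrier (corner e M)"
proof -
  interpret M: left_module ZS M by fact
  note se = single_Some_closed[OF e_closed]
  have "single (Some e) \<otimes>\<^bsub>ZS\<^esub> single (Some e) = single (Some e)"
    by (simp add: single_mult_single adjoin_identity_simps e_e)
  then show ?thesis
    using assms(2) se by (simp add: corner_simps M.smult_closed M.smult_assoc[symmetric])
qed

text \<open>
  Exactness of \<open>M \<mapsto> eM\<close>: if \<open>y = h x\<close> and \<open>e y = y\<close>, then \<open>y = h (e x)\<close>.
\<close>

lemma corner_image:
  assumes "left_module_map ZS M N h"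
  shows "h ` carrier (corner e M) = h ` carrier M \<inter> carrier (corner e N)"
proof -
  interpret h: left_module_map ZS M N h by fact
  interpret ch: left_module_map ZH "corner e M" "corner e N" h by (rule corner_map) fact
  note se = single_Some_closed[OF e_closed]
  show ?thesis
  proof
    show "h ` carrier (corner e M) \<subseteq> h ` carrier M \<inter> carrier (corner e N)"
      using ch.closed by (auto simp: corner_simps(1)[of e M])
    show "h ` carrier M \<inter> carrier (corner e N) \<subseteq> h ` carrier (corner e M)"
    proof
      fix y assume "y \<in> h ` carrier M \<inter> carrier (corner e N)"
      then obtain x where x: "x \<in> carrier M" "y = h x" and "single (Some e) \<odot>\<^bsub>N\<^esub> y = y"
        by (auto simp: corner_simps)
      then have "y = h (single (Some e) \<odot>\<^bsub>M\<^esub> x)" by (simp add: h.smult se)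
      then show "y \<in> h ` carrier (corner e M)"
        using e_smult_corner[OF h.M.left_module_axioms x(1)] by blast
    qed
  qed
qed

lemma corner_kernel:
  "module_kernel (corner e M) (corner e N) h = module_kernel M N h \<inter> carrier (corner e M)"
  by (auto simp: module_kernel_def corner_simps)

lemma Some_e_S: "single (Some e) \<in> carrier ZS"
  by (rule single_Some_closed[OF e_closed])

text \<open>
  If \<open>B\<close> is a basis of \<open>M\<close> and \<open>T\<close> a transversal of the \<open>H\<close>-orbits on \<open>eU\<close>, the elements \<open>r \<cdot> b\<close> form a basis of
  \<open>eM\<close>. The coordinate of \<open>x\<close> at \<open>r \<cdot> b\<close> is the function \<open>h \<mapsto> \<kappa> b x (h r)\<close> on \<open>H\<close>.
\<close>

lemma corner_fg_free:
  assumes "fg_free ZS M" "finite {L. left_ideal L U}"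
  shows "fg_free ZH (corner e M)"
proof -
  obtain B where M: "left_module ZS M" and B: "finite_basis ZS M B"
    using assms(1) by (auto simp: fg_free_def)
  interpret M: left_module ZS M by fact
  interpret C: left_module ZH "corner e M" by (rule corner_left_module[OF M])
  obtain \<kappa> where \<kappa>: "\<And>b. b \<in> B \<Longrightarrow> left_module_map ZS M (regular_module ZS) (\<kappa> b)"
    and \<kappa>\<delta>: "\<And>b b'. \<lbrakk>b \<in> B; b' \<in> B\<rbrakk> \<Longrightarrow> \<kappa> b b' = (if b = b' then \<one>\<^bsub>ZS\<^esub> else \<zero>\<^bsub>ZS\<^esub>)"
    by (rule M.coordinates[OF B]) (rule that; assumption)
  have BM: "B \<subseteq> carrier M" and finB: "finite B" using B by (auto simp: finite_basis_def)
  obtain T where T: "finite T" "T \<subseteq> carrier U" "\<And>r. r \<in> T \<Longrightarrow> e \<otimes> r = r"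
    and T_ex: "\<And>s. \<lbrakk>s \<in> carrier U; e \<otimes> s = s\<rbrakk> \<Longrightarrow> \<exists>h\<in>carrier H. \<exists>r\<in>T. s = h \<otimes> r"
    and T_uniq: "\<And>h h' r r'. \<lbrakk>h \<in> carrier H; h' \<in> carrier H; r \<in> T; r' \<in> T; h \<otimes> r = h' \<otimes> r'\<rbrakk>
      \<Longrightarrow> h = h' \<and> r = r'"
    by (rule orbit_transversal[OF assms(2)]) (rule that; assumption)
  define \<beta> where "\<beta> = (\<lambda>(r, b). single (Some r) \<odot>\<^bsub>M\<^esub> b)"
  define \<mu> where "\<mu> = (\<lambda>(r, b) x h. if h \<in> carrier H then \<kappa> b x (Some (h \<otimes> r)) else 0)"
  have \<kappa>_closed: "\<kappa> b x \<in> carrier ZS" if "b \<in> B" "x \<in> carrier M" for b x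
    using left_module_map.closed[OF \<kappa>] that by fastforce
  have \<mu>_closed: "\<mu> (r, b) x \<in> carrier ZH" if "r \<in> T" "b \<in> B" "x \<in> carrier M" for r b x
  proof -
    have "inj_on (\<lambda>h. Some (h \<otimes> r)) {h. \<mu> (r, b) x h \<noteq> 0}"
      by (rule inj_onI) (use T_uniq that(1) in \<open>auto simp: \<mu>_def split: if_splits\<close>)
    moreover have "(\<lambda>h. Some (h \<otimes> r)) ` {h. \<mu> (r, b) x h \<noteq> 0} \<subseteq> {s. \<kappa> b x s \<noteq> 0}"
      by (auto simp: \<mu>_def split: if_splits)
    moreover have "finite {s. \<kappa> b x s \<noteq> 0}"
      using \<kappa>_closed[OF that(2,3)] by (simp add: monoid_ring_simps)
    ultimately have "finite {h. \<mu> (r, b) x h \<noteq> 0}" by (meson finite_imageD finite_subset)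
    then show ?thesis by (auto simp: monoid_ring_simps) (auto simp: \<mu>_def split: if_splits)
  qed
  have \<kappa>_corner: "e \<otimes> t = t \<and> t \<in> carrier U"
    if b: "b \<in> B" and xC: "x \<in> carrier (corner e M)" and t: "\<kappa> b x (Some t) \<noteq> 0" for b x t
  proof -
    have x: "x \<in> carrier M" "single (Some e) \<odot>\<^bsub>M\<^esub> x = x" using xC by (auto simp: corner_simps)
    have "\<kappa> b x = single (Some e) \<otimes>\<^bsub>ZS\<^esub> \<kappa> b x"
      using left_module_map.smult[OF \<kappa>[OF b] Some_e_S x(1)] x(2) by simp
    then have "Some t \<in> {s. (single (Some e) \<otimes>\<^bsub>ZS\<^esub> \<kappa> b x) s \<noteq> 0}" using t by simp
    then obtain s where s: "\<kappa> b x s \<noteq> 0" "Some t = Some e \<otimes>\<^bsub>S\<^esub> s"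
      using monoid_ring_mult_support[OF Some_e_S \<kappa>_closed[OF b x(1)]] by (auto simp: single_support)
    have "s \<in> carrier S" using s(1) \<kappa>_closed[OF b x(1)] by (auto simp: monoid_ring_simps)
    then show ?thesis
      using s(2) e_closed e_e by (auto simp: adjoin_identity_simps m_closed m_assoc[symmetric])
  qed
  have "finite_basis ZH (corner e M) (\<beta> ` (T \<times> B))"
  proof (rule C.basis_criterion[where \<kappa> = \<mu>])
    show "finite (T \<times> B)" using T(1) finB by simp
    show \<beta>C: "\<beta> j \<in> carrier (corner e M)" if "j \<in> T \<times> B" for j
    proof -
      obtain r b where j: "j = (r, b)" "r \<in> T" "b \<in> B" using \<open>j \<in> T \<times> B\<close> by auto
      have "single (Some e) \<otimes>\<^bsub>ZS\<^esub> single (Some r) = single (Some r)"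
        using T(3)[OF j(2)] by (simp add: single_mult_single adjoin_identity_simps)
      moreover have "single (Some r) \<in> carrier ZS" "b \<in> carrier M"
        using j T(2) BM by (auto intro: single_Some_closed)
      ultimately show ?thesis
        using Some_e_S by (simp add: j(1) \<beta>_def corner_simps M.smult_assoc[symmetric] M.smult_closed)
    qed
    show "\<one>\<^bsub>ZH\<^esub> \<noteq> \<zero>\<^bsub>ZH\<^esub>" by (rule monoid_ring_one_not_zero)
    show "left_module_map ZH (corner e M) (regular_module ZH) (\<mu> j)" if "j \<in> T \<times> B" for j
    proof -
      obtain r b where j: "j = (r, b)" and r: "r \<in> T" and b: "b \<in> B" using \<open>j \<in> T \<times> B\<close> by auto
      interpret k: left_module_map ZS M "regular_module ZS" "\<kappa> b" by (rule \<kappa>[OF b])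
      show ?thesis
      proof (rule left_module_map_equivariant[OF H_monoid C.left_module_axioms left_module_regular[OF ZH_ring]])
        fix x assume x: "x \<in> carrier (corner e M)"
        then have xM: "x \<in> carrier M" by (simp add: corner_simps)
        show "\<mu> j x \<in> carrier (regular_module ZH)" using \<mu>_closed r b xM by (simp add: j)
        show "\<mu> j (x \<oplus>\<^bsub>corner e M\<^esub> y) = \<mu> j x \<oplus>\<^bsub>regular_module ZH\<^esub> \<mu> j y"
          if "y \<in> carrier (corner e M)" for y
          using k.add[OF xM, of y] that by (auto simp: j \<mu>_def monoid_ring_simps corner_simps)
        fix h assume h: "h \<in> carrier H"
        obtain h' where h': "h' \<in> carrier H" "h' \<otimes> h = e" "h \<otimes> h' = e" using H_inverse[OF h] .
        have hh: "h \<otimes> t = v \<longleftrightarrow> t = h' \<otimes> v"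
          if "t \<in> carrier U" "e \<otimes> t = t" "v \<in> carrier U" "e \<otimes> v = v" for t v
          using that h h' by (metis H_closed m_assoc)
        show "\<mu> j (single h \<odot>\<^bsub>corner e M\<^esub> x) = single h \<odot>\<^bsub>regular_module ZH\<^esub> \<mu> j x"
        proof
          fix g
          show "\<mu> j (single h \<odot>\<^bsub>corner e M\<^esub> x) g = (single h \<odot>\<^bsub>regular_module ZH\<^esub> \<mu> j x) g"
          proof (cases "g \<in> carrier H")
            case True
            have rU: "r \<in> carrier U" "e \<otimes> r = r" using T r by auto
            have gU: "g \<in> carrier U" "e \<otimes> g = g" using True by (auto simp: H_carrier)
            have gr: "g \<otimes> r \<in> carrier U" "e \<otimes> (g \<otimes> r) = g \<otimes> r"
              using rU gU e_closed by (simp_all add: m_closed m_assoc[symmetric])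
            have "\<mu> j (single h \<odot>\<^bsub>corner e M\<^esub> x) g = (single (Some h) \<otimes>\<^bsub>ZS\<^esub> \<kappa> b x) (Some (g \<otimes> r))"
              using True k.smult[OF single_Some_closed[OF H_closed[OF h]] xM]
              by (simp add: j \<mu>_def corner_simps extend_by_zero_single)
            also have "\<dots> = \<kappa> b x (Some (h' \<otimes> (g \<otimes> r)))"
            proof (rule single_mult_translate[OF \<kappa>_closed[OF b xM]])
              fix t assume t: "\<kappa> b x t \<noteq> 0"
              show "Some h \<otimes>\<^bsub>S\<^esub> t = Some (g \<otimes> r) \<longleftrightarrow> t = Some (h' \<otimes> (g \<otimes> r))"
              proof (cases t)
                case None
                have "single (Some e) \<otimes>\<^bsub>ZS\<^esub> \<kappa> b x = \<kappa> b x"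
                  using k.smult[OF Some_e_S xM] x by (simp add: corner_simps)
                then have "None \<in> {s. (single (Some e) \<otimes>\<^bsub>ZS\<^esub> \<kappa> b x) s \<noteq> 0}" using t None by simp
                then obtain s where "None = Some e \<otimes>\<^bsub>S\<^esub> s"
                  using monoid_ring_mult_support[OF Some_e_S \<kappa>_closed[OF b xM]]
                  by (auto simp: single_support)
                then show ?thesis by (cases s) (auto simp: adjoin_identity_simps)
              next
                case (Some u)
                then have "u \<in> carrier U" "e \<otimes> u = u" using \<kappa>_corner[OF b x] t by auto
                then show ?thesis using Some hh[of u "g \<otimes> r"] gr by (simp add: adjoin_identity_simps)
              qed
            qed
            also have "h' \<otimes> (g \<otimes> r) = h' \<otimes> g \<otimes> r" using H_closed[OF h'(1)] gU rU by (simp add: m_assoc)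
            also have "\<kappa> b x (Some (h' \<otimes> g \<otimes> r)) = \<mu> j x (h' \<otimes> g)"
              using monoid.m_closed[OF H_monoid h'(1) True] by (simp add: j \<mu>_def H_mult)
            also have "\<dots> = (single h \<otimes>\<^bsub>ZH\<^esub> \<mu> j x) g"
            proof (rule single_mult_translate[symmetric])
              show "\<mu> j x \<in> carrier ZH" using \<mu>_closed[OF r b xM] by (simp add: j)
              fix t assume "\<mu> j x t \<noteq> 0"
              then have "t \<in> carrier H" by (auto simp: j \<mu>_def split: if_splits)
              then show "h \<otimes>\<^bsub>H\<^esub> t = g \<longleftrightarrow> t = h' \<otimes> g"
                using hh[of t g] gU by (simp add: H_mult H_carrier)
            qed
            finally show ?thesis by simp
          next
            case False
            have "single h \<otimes>\<^bsub>ZH\<^esub> \<mu> j x \<in> carrier ZH"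
              using \<mu>_closed[OF r b xM] single_closed[OF h] by (simp add: j)
            then have "(single h \<otimes>\<^bsub>ZH\<^esub> \<mu> j x) g = 0" using False by (auto simp: monoid_ring_simps)
            then show ?thesis using False by (simp add: j \<mu>_def)
          qed
        qed
      qed
    qed
    show "\<mu> j (\<beta> i) = (if i = j then \<one>\<^bsub>ZH\<^esub> else \<zero>\<^bsub>ZH\<^esub>)" if i: "i \<in> T \<times> B" and j: "j \<in> T \<times> B" for i j
    proof -
      obtain r b where ij: "i = (r, b)" "r \<in> T" "b \<in> B" using i by auto
      obtain r' b' where jj: "j = (r', b')" "r' \<in> T" "b' \<in> B" using j by auto
      interpret k: left_module_map ZS M "regular_module ZS" "\<kappa> b'" by (rule \<kappa>[OF jj(3)])
      have rS: "single (Some r) \<in> carrier ZS" using ij T(2) by (auto intro: single_Some_closed)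
      have "\<kappa> b' (\<beta> i) = single (Some r) \<otimes>\<^bsub>ZS\<^esub> (if b' = b then \<one>\<^bsub>ZS\<^esub> else \<zero>\<^bsub>ZS\<^esub>)"
        using k.smult[OF rS, of b] BM ij jj by (auto simp: \<beta>_def \<kappa>\<delta>)
      also have "\<dots> = (if b' = b then single (Some r) else (\<lambda>_. 0))"
        using rS M.R.r_one[OF rS] M.R.r_null[OF rS] by (simp add: monoid_ring_simps(3))
      finally have "\<mu> j (\<beta> i) h = (if h \<in> carrier H \<and> b' = b \<and> h \<otimes> r' = r then 1 else 0)" for h
        by (cases "b' = b") (auto simp: jj(1) \<mu>_def single_def)
      moreover have "h \<otimes> r' = r \<longleftrightarrow> h = e \<and> r' = r" if "h \<in> carrier H" for h
        using T_uniq[OF that e_H jj(2) ij(2)] T(3) ij(2) by auto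
      ultimately show ?thesis
        using e_H by (auto simp: fun_eq_iff monoid_ring_simps(3,4) single_def H_one ij(1) jj(1))
    qed
    fix N assume N: "submodule N ZH (corner e M)" "\<beta> ` (T \<times> B) \<subseteq> N"
    note ND = C.submoduleD[OF N(1)]
    let ?K = "{x \<in> carrier M. single (Some e) \<odot>\<^bsub>M\<^esub> x \<in> N}"
    \<comment> \<open>The elements \<open>x\<close> with \<open>e \<cdot> (s \<cdot> x) \<in> N\<close> for all \<open>s\<close> form a \<open>\<int>S\<close>-submodule, so it suffices to have
      the basis \<open>B\<close> in it.\<close>
    let ?L = "{x \<in> carrier M. \<forall>s\<in>carrier S. single s \<odot>\<^bsub>M\<^esub> x \<in> ?K}"
    note sc = single_closed[of _ S]
    have "submodule ?L ZS M"
    proof (rule submodule_equivariant[OF S_monoid M])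
      show "\<zero>\<^bsub>M\<^esub> \<in> ?L" using ND(2) by (auto simp: M.smult_zero sc Some_e_S corner_simps)
      show "x \<oplus>\<^bsub>M\<^esub> y \<in> ?L" if "x \<in> ?L" "y \<in> ?L" for x y
        using that ND(3) by (auto simp: M.smult_r_distr sc Some_e_S corner_simps)
      show "\<ominus>\<^bsub>M\<^esub> x \<in> ?L" if "x \<in> ?L" for x
        using that ND(4) ND(1)
        by (auto simp: M.smult_minus sc Some_e_S corner_a_inv[OF M, symmetric] subset_iff)
      show "single s \<odot>\<^bsub>M\<^esub> x \<in> ?L" if "s \<in> carrier S" "x \<in> ?L" for s x
        using that monoid.m_closed[OF S_monoid]
        by (auto simp: M.smult_assoc[symmetric] sc single_mult_single M.smult_closed)
    qed auto
    moreover have "B \<subseteq> ?L"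
    proof
      fix b assume b: "b \<in> B"
      then have bM: "b \<in> carrier M" using BM by auto
      have "single (Some e) \<odot>\<^bsub>M\<^esub> (single s \<odot>\<^bsub>M\<^esub> b) \<in> N" if s: "s \<in> carrier S" for s
      proof -
        obtain t where t: "Some e \<otimes>\<^bsub>S\<^esub> s = Some t" "t \<in> carrier U" "e \<otimes> t = t"
          using s e_closed e_e
          by (auto simp: adjoin_identity_simps m_closed m_assoc[symmetric])
        obtain h r where hr: "h \<in> carrier H" "r \<in> T" "t = h \<otimes> r" using T_ex[OF t(2,3)] by auto
        have "single (Some e) \<odot>\<^bsub>M\<^esub> (single s \<odot>\<^bsub>M\<^esub> b) = single (Some t) \<odot>\<^bsub>M\<^esub> b"
          using s bM t(1) by (simp add: M.smult_assoc[symmetric] sc Some_e_S single_mult_single)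
        also have "single (Some t) = single (Some h) \<otimes>\<^bsub>ZS\<^esub> single (Some r)"
          by (simp add: hr(3) single_mult_single adjoin_identity_simps)
        also have "\<dots> \<odot>\<^bsub>M\<^esub> b = single (Some h) \<odot>\<^bsub>M\<^esub> (single (Some r) \<odot>\<^bsub>M\<^esub> b)"
          using hr T(2) bM H_closed by (intro M.smult_assoc single_Some_closed) auto
        also have "\<dots> = single h \<odot>\<^bsub>corner e M\<^esub> \<beta> (r, b)"
          by (simp add: corner_simps extend_by_zero_single \<beta>_def)
        also have "\<dots> \<in> N"
          by (rule ND(6)[OF single_closed[OF hr(1)]]) (use N(2) hr(2) b in auto)
        finally show ?thesis .
      qed
      then show "b \<in> ?L" using bM by (auto simp: M.smult_closed sc)
    qed
    ultimately have L: "carrier M \<subseteq> ?L" by (rule M.basis_generates[OF B])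
    show "carrier (corner e M) \<subseteq> N"
    proof
      fix x assume x: "x \<in> carrier (corner e M)"
      then have "x \<in> ?L" using L by (auto simp: corner_simps)
      then have "single (Some e) \<odot>\<^bsub>M\<^esub> (single (Some e) \<odot>\<^bsub>M\<^esub> x) \<in> N"
        using e_closed by (auto simp: adjoin_identity_simps)
      then show "x \<in> N" using x by (simp add: corner_simps)
    qed
  qed
  then show ?thesis unfolding fg_free_def using C.left_module_axioms by blast
qed

lemma corner_resolution:
  assumes "partial_free_resolution S k A d \<epsilon>" "finite {L. left_ideal L U}"
  shows "partial_free_resolution H k (\<lambda>i. corner e (A i)) d \<epsilon>"
    and "resolution_kernel k (\<lambda>i. corner e (A i)) d \<epsilon> =
      resolution_kernel k A d \<epsilon> \<inter> carrier (corner e (A k))"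
proof -
  show ker: "resolution_kernel k (\<lambda>i. corner e (A i)) d \<epsilon> =
      resolution_kernel k A d \<epsilon> \<inter> carrier (corner e (A k))" for k
    by (cases k) (auto simp: resolution_kernel_def corner_kernel module_kernel_def corner_simps trivial_module_def)
  show "partial_free_resolution H k (\<lambda>i. corner e (A i)) d \<epsilon>"
    using assms(1)
  proof (induction k)
    case 0
    interpret \<epsilon>: left_module_map ZS "A 0" "trivial_module :: ('a option \<Rightarrow> int, int) module" \<epsilon>
      by (rule partial_free_resolution_augmentation[OF S_monoid 0])
    have "\<epsilon> x \<in> \<epsilon> ` carrier (corner e (A 0))" if "x \<in> carrier (A 0)" for x
    proof (rule image_eqI)
      show "\<epsilon> x = \<epsilon> (single (Some e) \<odot>\<^bsub>A 0\<^esub> x)"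
        using \<epsilon>.smult[OF Some_e_S that] by (simp add: trivial_module_def augmentation_single)
      show "single (Some e) \<odot>\<^bsub>A 0\<^esub> x \<in> carrier (corner e (A 0))"
        by (rule e_smult_corner[OF \<epsilon>.M.left_module_axioms that])
    qed
    then have "\<epsilon> ` carrier (corner e (A 0)) = \<epsilon> ` carrier (A 0)"
      by (auto simp: corner_simps(1))
    then show ?case
      using 0 corner_fg_free[OF _ assms(2)] \<epsilon>.add \<epsilon>.smult
      by (auto simp: partial_free_resolution_0 left_module_hom_def trivial_module_def corner_simps
          augmentation_extend_by_zero extend_by_zero_closed)
  next
    case (Suc k)
    note map = partial_free_resolution_map[OF Suc.prems]
    have "d k ` carrier (corner e (A (Suc k))) = d k ` carrier (A (Suc k)) \<inter> carrier (corner e (A k))"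
      by (rule corner_image[OF map])
    then show ?case
      using Suc corner_fg_free[OF _ assms(2), of "A (Suc k)"] left_module_map.hom[OF corner_map[OF map]]
      by (simp add: partial_free_resolution_Suc ker)
  qed
qed

end

section \<open>Finitely many right ideals\<close>

lemma finsum_trivial_module:
  assumes "monoid (S :: ('a, 'b) monoid_scheme)" "finite A"
  shows "finsum (trivial_module :: ('a \<Rightarrow> int, int) module) f A = sum f A"
proof -
  interpret Z: left_module "monoid_ring S" "trivial_module :: ('a \<Rightarrow> int, int) module"
    by (rule trivial_module_left_module[OF assms(1)])
  have c: "carrier (trivial_module :: ('a \<Rightarrow> int, int) module) = UNIV"
    by (simp add: trivial_module_def)
  show ?thesis using assms(2)
    by (induction A rule: finite_induct)
       (use c in \<open>simp_all add: Z.M.finsum_insert, simp_all add: trivial_module_def\<close>)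
qed

lemma augmentation_add:
  assumes "f \<in> carrier (monoid_ring S)" "g \<in> carrier (monoid_ring S)"
  shows "augmentation (\<lambda>s. f s + g s) = augmentation f + augmentation g"
proof -
  let ?A = "{s. f s \<noteq> 0} \<union> {s. g s \<noteq> 0}"
  have fin: "finite ?A" using assms by (simp add: monoid_ring_simps)
  have "augmentation (\<lambda>s. f s + g s) = (\<Sum>s\<in>?A. f s + g s)"
    by (rule augmentation_superset[OF fin]) auto
  moreover have "augmentation f = sum f ?A" "augmentation g = sum g ?A"
    by (rule augmentation_superset[OF fin], auto)+
  ultimately show ?thesis by (simp add: sum.distrib)
qed

lemma augmentation_zero: "augmentation (\<lambda>_. 0) = 0"
  by (simp add: augmentation_def)

text \<open>
  The indicator function of \<open>C\<close> on \<open>S\<close>, extended linearly. For a minimal right ideal \<open>C\<close> it is a crossed homomorphism: for \<open>u \<in> U\<close>, \<open>u y\<close> has all its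
  support in the right ideal of \<open>u\<close>, so its mass on \<open>C\<close> is the full augmentation of \<open>y\<close> or 0.
\<close>

definition mass_on :: "'a set \<Rightarrow> ('a option \<Rightarrow> int) \<Rightarrow> int" where
  "mass_on C y = augmentation (\<lambda>s. if s \<in> Some ` C then y s else 0)"

context completely_simple_pointed
begin

lemma restrict_closed: "y \<in> carrier ZS \<Longrightarrow> (\<lambda>s. if s \<in> Some ` C then y s else 0) \<in> carrier ZS"
  by (auto simp: monoid_ring_simps elim!: rev_finite_subset)

lemma mass_on_add:
  assumes "x \<in> carrier ZS" "y \<in> carrier ZS"
  shows "mass_on C (x \<oplus>\<^bsub>ZS\<^esub> y) = mass_on C x + mass_on C y"
proof -
  have "(\<lambda>s. if s \<in> Some ` C then (x \<oplus>\<^bsub>ZS\<^esub> y) s else 0) =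
      (\<lambda>s. (if s \<in> Some ` C then x s else 0) + (if s \<in> Some ` C then y s else 0))"
    by (auto simp: monoid_ring_simps)
  then show ?thesis
    unfolding mass_on_def using augmentation_add[OF assms[THEN restrict_closed]] by simp
qed

lemma mass_on_single_mult:
  assumes "y \<in> carrier ZS" "s \<in> carrier S" "c \<in> carrier U"
  shows "mass_on (principal_right c) (single s \<otimes>\<^bsub>ZS\<^esub> y) =
    (case s of None \<Rightarrow> mass_on (principal_right c) y
     | Some u \<Rightarrow> if principal_right u = principal_right c then augmentation y else 0)"
proof (cases s)
  case None
  interpret R: ring ZS by (rule ZS_ring)
  have "single s \<otimes>\<^bsub>ZS\<^esub> y = y"
    using R.l_one[OF assms(1)] None by (simp add: monoid_ring_simps adjoin_identity_simps)
  then show ?thesis using None by simp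
next
  case (Some u)
  then have u: "u \<in> carrier U" using assms(2) by (auto simp: adjoin_identity_simps)
  have sc: "single s \<in> carrier ZS" by (rule single_closed[OF assms(2)])
  have range: "\<exists>v\<in>carrier U. t = Some v \<and> principal_right v = principal_right u"
    if "(single s \<otimes>\<^bsub>ZS\<^esub> y) t \<noteq> 0" for t
  proof -
    have "t \<in> {t. (single s \<otimes>\<^bsub>ZS\<^esub> y) t \<noteq> 0}" using that by simp
    then obtain r where r: "y r \<noteq> 0" "t = Some u \<otimes>\<^bsub>S\<^esub> r"
      using monoid_ring_mult_support[OF sc assms(1)] Some by (auto simp: single_support)
    have "r \<in> carrier S" using r(1) assms(1) by (auto simp: monoid_ring_simps)
    then show ?thesis
      using r(2) u by (auto simp: adjoin_identity_simps m_closed principal_right_mult)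
  qed
  have mem: "v \<in> principal_right c \<longleftrightarrow> principal_right v = principal_right c" if "v \<in> carrier U" for v
  proof
    assume "v \<in> principal_right c"
    then obtain w where "w \<in> carrier U" "v = c \<otimes> w" unfolding principal_right_def by blast
    then show "principal_right v = principal_right c" using principal_right_mult assms(3) by simp
  next
    assume "principal_right v = principal_right c"
    then show "v \<in> principal_right c" using principal_right_self[OF that] by simp
  qed
  have "(\<lambda>t. if t \<in> Some ` principal_right c then (single s \<otimes>\<^bsub>ZS\<^esub> y) t else 0) =
      (if principal_right u = principal_right c then single s \<otimes>\<^bsub>ZS\<^esub> y else (\<lambda>_. 0))" (is "?f = ?g")
  proof
    fix t
    show "?f t = ?g t"
    proof (cases "(single s \<otimes>\<^bsub>ZS\<^esub> y) t = 0")
      case False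
      then obtain v where "v \<in> carrier U" "t = Some v" "principal_right v = principal_right u"
        using range by blast
      then show ?thesis using mem[of v] by auto
    qed auto
  qed
  then have "mass_on (principal_right c) (single s \<otimes>\<^bsub>ZS\<^esub> y) =
      augmentation (if principal_right u = principal_right c then single s \<otimes>\<^bsub>ZS\<^esub> y else (\<lambda>_. 0))"
    by (simp only: mass_on_def)
  then show ?thesis
    using Some augmentation_mult[OF S_monoid sc assms(1)]
    by (simp add: augmentation_single augmentation_zero)
qed

text \<open>
  Over a basis \<open>B\<close> of \<open>A 0\<close> put \<open>\<Phi> C x = \<Sum> mass_on C (\<kappa> b x) \<cdot> \<epsilon> b\<close>. Then \<open>\<Phi> C (u x)\<close> is
  \<open>\<epsilon> x\<close> or 0 according to whether \<open>u \<in> C\<close>, and \<open>\<Phi> C x = 0\<close> for almost all \<open>C\<close>. On the kernel of \<open>\<epsilon>\<close> the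
  set where \<open>\<Phi> C\<close> vanishes is a submodule, so for all but finitely many \<open>C\<close> it is the whole kernel once that is finitely
  generated. But \<open>\<Phi> C (c x - v x) = 1\<close> if \<open>\<epsilon> x = 1\<close>, \<open>c \<in> C\<close> and \<open>v \<notin> C\<close>.
\<close>

lemma finite_right_ideals_if_FP:
  assumes res: "partial_free_resolution S (Suc 0) A d \<epsilon>"
  shows "finite (principal_right ` carrier U)"
proof (rule ccontr)
  assume infinite: "infinite (principal_right ` carrier U)"
  have res0: "partial_free_resolution S 0 A d \<epsilon>" using res by (simp add: partial_free_resolution_Suc)
  let ?Z = "trivial_module :: ('a option \<Rightarrow> int, int) module"
  interpret \<epsilon>: left_module_map ZS "A 0" ?Z \<epsilon>
    by (rule partial_free_resolution_augmentation[OF S_monoid res])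
  have Z: "carrier ?Z = UNIV" "x \<oplus>\<^bsub>?Z\<^esub> y = x + y" "\<zero>\<^bsub>?Z\<^esub> = 0" "f \<odot>\<^bsub>?Z\<^esub> z = augmentation f * z"
    for x y z f by (simp_all add: trivial_module_def)
  obtain B where B: "finite_basis ZS (A 0) B"
    using res by (auto simp: partial_free_resolution_def fg_free_def)
  obtain \<kappa> where \<kappa>: "\<And>b. b \<in> B \<Longrightarrow> left_module_map ZS (A 0) (regular_module ZS) (\<kappa> b)"
    and expand: "\<And>x. x \<in> carrier (A 0) \<Longrightarrow> x = (\<Oplus>\<^bsub>A 0\<^esub>b\<in>B. \<kappa> b x \<odot>\<^bsub>A 0\<^esub> b)"
    by (rule \<epsilon>.M.coordinates[OF B]) (rule that; assumption)
  have finB: "finite B" and BM: "B \<subseteq> carrier (A 0)" using B by (auto simp: finite_basis_def)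
  have \<kappa>_closed: "\<kappa> b x \<in> carrier ZS" if "b \<in> B" "x \<in> carrier (A 0)" for b x
    using left_module_map.closed[OF \<kappa>] that by fastforce
  have eps: "\<epsilon> x = (\<Sum>b\<in>B. augmentation (\<kappa> b x) * \<epsilon> b)" if x: "x \<in> carrier (A 0)" for x
  proof -
    have "\<epsilon> x = \<epsilon> (\<Oplus>\<^bsub>A 0\<^esub>b\<in>B. \<kappa> b x \<odot>\<^bsub>A 0\<^esub> b)" using expand[OF x] by simp
    also have "\<dots> = (\<Oplus>\<^bsub>?Z\<^esub>b\<in>B. \<epsilon> (\<kappa> b x \<odot>\<^bsub>A 0\<^esub> b))"
      by (rule \<epsilon>.finsum) (use x BM \<kappa>_closed in \<open>auto intro!: \<epsilon>.M.smult_closed\<close>)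
    also have "\<dots> = (\<Sum>b\<in>B. \<epsilon> (\<kappa> b x \<odot>\<^bsub>A 0\<^esub> b))"
      by (rule finsum_trivial_module[OF S_monoid finB])
    also have "\<dots> = (\<Sum>b\<in>B. augmentation (\<kappa> b x) * \<epsilon> b)"
      using x BM \<kappa>_closed by (intro sum.cong) (auto simp: \<epsilon>.smult Z)
    finally show ?thesis .
  qed
  define \<Phi> where "\<Phi> C x = (\<Sum>b\<in>B. mass_on C (\<kappa> b x) * \<epsilon> b)" for C x
  have \<Phi>_add: "\<Phi> C (x \<oplus>\<^bsub>A 0\<^esub> y) = \<Phi> C x + \<Phi> C y"
    if "x \<in> carrier (A 0)" "y \<in> carrier (A 0)" for C x y
    using that \<kappa>_closed left_module_map.add[OF \<kappa>]
    by (simp add: \<Phi>_def mass_on_add sum.distrib[symmetric] algebra_simps)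
  have \<Phi>_single: "\<Phi> (principal_right c) (single s \<odot>\<^bsub>A 0\<^esub> x) =
      (case s of None \<Rightarrow> \<Phi> (principal_right c) x
       | Some u \<Rightarrow> if principal_right u = principal_right c then \<epsilon> x else 0)"
    if "s \<in> carrier S" "c \<in> carrier U" "x \<in> carrier (A 0)" for c s x
  proof -
    have "\<kappa> b (single s \<odot>\<^bsub>A 0\<^esub> x) = single s \<otimes>\<^bsub>ZS\<^esub> \<kappa> b x" if "b \<in> B" for b
      using left_module_map.smult[OF \<kappa>[OF that] single_closed[OF \<open>s \<in> carrier S\<close>] \<open>x \<in> carrier (A 0)\<close>]
      by simp
    then show ?thesis
      using that mass_on_single_mult[OF \<kappa>_closed that(1,2)]
      by (auto simp: \<Phi>_def eps split: option.split)
  qed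
  have \<Phi>_finite: "finite {C \<in> principal_right ` carrier U. \<Phi> C x \<noteq> 0}" if x: "x \<in> carrier (A 0)" for x
  proof (rule finite_subset)
    show "finite ((\<lambda>s. principal_right (the s)) ` (\<Union>b\<in>B. {s. \<kappa> b x s \<noteq> 0}))"
      using finB \<kappa>_closed[OF _ x] by (auto simp: monoid_ring_simps)
    show "{C \<in> principal_right ` carrier U. \<Phi> C x \<noteq> 0} \<subseteq>
        (\<lambda>s. principal_right (the s)) ` (\<Union>b\<in>B. {s. \<kappa> b x s \<noteq> 0})"
    proof
      fix C assume "C \<in> {C \<in> principal_right ` carrier U. \<Phi> C x \<noteq> 0}"
      then obtain c where c: "c \<in> carrier U" "C = principal_right c" and "\<Phi> C x \<noteq> 0" by auto
      have "\<exists>b\<in>B. mass_on C (\<kappa> b x) \<noteq> 0"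
      proof (rule ccontr)
        assume "\<not> (\<exists>b\<in>B. mass_on C (\<kappa> b x) \<noteq> 0)"
        then have "\<Phi> C x = 0" by (simp add: \<Phi>_def)
        then show False using \<open>\<Phi> C x \<noteq> 0\<close> by contradiction
      qed
      then obtain b where b: "b \<in> B" "mass_on C (\<kappa> b x) \<noteq> 0" by blast
      have "\<exists>t\<in>C. \<kappa> b x (Some t) \<noteq> 0"
      proof (rule ccontr)
        assume "\<not> (\<exists>t\<in>C. \<kappa> b x (Some t) \<noteq> 0)"
        then have "(\<lambda>s. if s \<in> Some ` C then \<kappa> b x s else 0) = (\<lambda>_. 0)" by (intro ext) auto
        then have "mass_on C (\<kappa> b x) = 0" by (simp only: mass_on_def augmentation_zero)
        then show False using b(2) by contradiction
      qed
      then obtain t where t: "t \<in> C" "\<kappa> b x (Some t) \<noteq> 0" by blast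
      from t(1) obtain w where "w \<in> carrier U" "t = c \<otimes> w"
        unfolding c(2) principal_right_def by blast
      then have "C = principal_right (the (Some t))" using c principal_right_mult by simp
      then show "C \<in> (\<lambda>s. principal_right (the s)) ` (\<Union>b\<in>B. {s. \<kappa> b x s \<noteq> 0})"
        using b(1) t(2) by blast
    qed
  qed
  let ?K = "resolution_kernel 0 A d \<epsilon>"
  have K: "?K = {x \<in> carrier (A 0). \<epsilon> x = 0}"
    by (simp add: resolution_kernel_def module_kernel_def Z)
  have "finitely_generated ZS (A 0) ?K"
    using finitely_generated_image[OF partial_free_resolution_map[OF res]] res
    by (simp add: partial_free_resolution_Suc)
  then obtain X where X: "finite X" "X \<subseteq> ?K"
    "\<And>N. \<lbrakk>submodule N ZS (A 0); X \<subseteq> N\<rbrakk> \<Longrightarrow> ?K \<subseteq> N"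
    by (auto simp: finitely_generated_def)
  define D where "D = (\<Union>x\<in>X. {C \<in> principal_right ` carrier U. \<Phi> C x \<noteq> 0})"
  have "finite D" using X(1,2) \<Phi>_finite by (auto simp: D_def K)
  then have "principal_right ` carrier U - D \<noteq> {}"
    using Diff_infinite_finite[OF _ infinite] infinite_imp_nonempty by blast
  then obtain c where c: "c \<in> carrier U" and "principal_right c \<notin> D" by blast
  then have cX: "\<Phi> (principal_right c) x = 0" if "x \<in> X" for x
    using that by (auto simp: D_def)
  let ?C = "principal_right c"
  have "infinite (principal_right ` carrier U - {?C})" using infinite by simp
  then obtain v where v: "v \<in> carrier U" "principal_right v \<noteq> ?C"
    using infinite_imp_nonempty by blast
  let ?N = "{x \<in> ?K. \<Phi> ?C x = 0}"
  have "submodule ?N ZS (A 0)"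
  proof (rule submodule_equivariant[OF S_monoid \<epsilon>.M.left_module_axioms])
    have zero: "\<Phi> ?C \<zero>\<^bsub>A 0\<^esub> = 0"
      using \<Phi>_add[of "\<zero>\<^bsub>A 0\<^esub>" "\<zero>\<^bsub>A 0\<^esub>" ?C] by simp
    then show "\<zero>\<^bsub>A 0\<^esub> \<in> ?N" using \<epsilon>.zero by (simp add: K Z)
    show "x \<oplus>\<^bsub>A 0\<^esub> y \<in> ?N" if "x \<in> ?N" "y \<in> ?N" for x y
      using that by (simp add: K \<epsilon>.add \<Phi>_add Z)
    show "\<ominus>\<^bsub>A 0\<^esub> x \<in> ?N" if "x \<in> ?N" for x
    proof -
      have x: "x \<in> carrier (A 0)" "\<epsilon> x = 0" "\<Phi> ?C x = 0" using that by (auto simp: K)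
      have "\<epsilon> (\<ominus>\<^bsub>A 0\<^esub> x) = 0"
        using \<epsilon>.add[of "\<ominus>\<^bsub>A 0\<^esub> x" x] x \<epsilon>.zero by (simp add: \<epsilon>.M.M.l_neg Z)
      moreover have "\<Phi> ?C (\<ominus>\<^bsub>A 0\<^esub> x) = 0"
        using \<Phi>_add[of "\<ominus>\<^bsub>A 0\<^esub> x" x ?C] x zero by (simp add: \<epsilon>.M.M.l_neg)
      ultimately show ?thesis using x by (simp add: K)
    qed
    show "single s \<odot>\<^bsub>A 0\<^esub> x \<in> ?N" if s: "s \<in> carrier S" and x: "x \<in> ?N" for s x
      using x \<Phi>_single[OF s c, of x] \<epsilon>.smult[OF single_closed[OF s], of x]
        \<epsilon>.M.smult_closed[OF single_closed[OF s], of x]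
      by (auto simp: K Z split: option.splits)
  qed (auto simp: K)
  from X(3)[OF this] have KN: "?K \<subseteq> ?N" using X(2) cX by auto
  obtain x where x: "x \<in> carrier (A 0)" "\<epsilon> x = 1"
    using res0 by (auto simp: partial_free_resolution_0) (metis UNIV_I imageE)
  have S: "Some c \<in> carrier S" "Some v \<in> carrier S" using c v by (auto simp: adjoin_identity_simps)
  let ?a = "single (Some c) \<odot>\<^bsub>A 0\<^esub> x" and ?b = "single (Some v) \<odot>\<^bsub>A 0\<^esub> x"
  have ab: "?a \<in> carrier (A 0)" "?b \<in> carrier (A 0)"
    using x S by (auto intro!: \<epsilon>.M.smult_closed single_closed)
  have "\<epsilon> ?a = 1" "\<epsilon> ?b = 1"
    using x S by (simp_all add: \<epsilon>.smult single_closed Z augmentation_single)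
  moreover have sum: "?a = (?a \<ominus>\<^bsub>A 0\<^esub> ?b) \<oplus>\<^bsub>A 0\<^esub> ?b"
    using ab by (simp add: a_minus_def \<epsilon>.M.M.a_assoc \<epsilon>.M.M.l_neg)
  moreover have "\<epsilon> ((?a \<ominus>\<^bsub>A 0\<^esub> ?b) \<oplus>\<^bsub>A 0\<^esub> ?b) = \<epsilon> (?a \<ominus>\<^bsub>A 0\<^esub> ?b) + \<epsilon> ?b"
    using ab by (simp add: \<epsilon>.add Z)
  ultimately have "?a \<ominus>\<^bsub>A 0\<^esub> ?b \<in> ?K" using ab by (simp add: K)
  then have "\<Phi> ?C (?a \<ominus>\<^bsub>A 0\<^esub> ?b) = 0" using KN by auto
  moreover have "\<Phi> ?C ((?a \<ominus>\<^bsub>A 0\<^esub> ?b) \<oplus>\<^bsub>A 0\<^esub> ?b) = \<Phi> ?C (?a \<ominus>\<^bsub>A 0\<^esub> ?b) + \<Phi> ?C ?b"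
    using ab by (simp add: \<Phi>_add)
  moreover have "\<Phi> ?C ?a = 1" "\<Phi> ?C ?b = 0"
    using \<Phi>_single[OF S(1) c x(1)] \<Phi>_single[OF S(2) c x(1)] v(2) x(2) by simp_all
  ultimately show False using sum by simp
qed

end

section \<open>Subgroups under finitely many integer-valued functionals\<close>

lemma subgroup_add_monoidD:
  assumes "abelian_group M" "subgroup N (add_monoid M)"
  shows "N \<subseteq> carrier M" "\<zero>\<^bsub>M\<^esub> \<in> N" "\<lbrakk>x \<in> N; y \<in> N\<rbrakk> \<Longrightarrow> x \<oplus>\<^bsub>M\<^esub> y \<in> N" "x \<in> N \<Longrightarrow> \<ominus>\<^bsub>M\<^esub> x \<in> N"
  using subgroup.subset[OF assms(2)] subgroup.one_closed[OF assms(2)]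
    subgroup.m_closed[OF assms(2)] subgroup.m_inv_closed[OF assms(2)]
  by (auto simp: a_inv_def)

text \<open>
  The image of \<open>K\<close> under the functionals is a subgroup of a finitely generated free abelian group. This proves that
  it is finitely generated, one functional at a time: an element on which the functional takes its least positive value
  generates \<open>K\<close> modulo the elements where it vanishes.
\<close>

lemma subgroup_generated_modulo_functionals:
  fixes \<pi> :: "'j \<Rightarrow> 'm \<Rightarrow> int"
  assumes "abelian_group M" "finite J" "subgroup K (add_monoid M)"
    and "\<And>j x y. \<lbrakk>j \<in> J; x \<in> carrier M; y \<in> carrier M\<rbrakk> \<Longrightarrow> \<pi> j (x \<oplus>\<^bsub>M\<^esub> y) = \<pi> j x + \<pi> j y"
  shows "\<exists>X. finite X \<and> X \<subseteq> K \<and> (\<forall>N. subgroup N (add_monoid M) \<longrightarrow> X \<subseteq> N \<longrightarrow>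
    {x \<in> K. \<forall>j\<in>J. \<pi> j x = 0} \<subseteq> N \<longrightarrow> K \<subseteq> N)"
  using assms(2-4)
proof (induction J arbitrary: K rule: finite_induct)
  case empty
  then show ?case by (intro exI[of _ "{}"]) auto
next
  case (insert j J)
  interpret M: abelian_group M by fact
  note sgD = subgroup_add_monoidD[OF assms(1)]
  note K = sgD[OF insert.prems(1)]
  have add: "\<pi> j (x \<oplus>\<^bsub>M\<^esub> y) = \<pi> j x + \<pi> j y" if "x \<in> carrier M" "y \<in> carrier M" for x y
    using insert.prems(2) that by simp
  have zero: "\<pi> j \<zero>\<^bsub>M\<^esub> = 0" using add[of "\<zero>\<^bsub>M\<^esub>" "\<zero>\<^bsub>M\<^esub>"] by simp
  have uminus: "\<pi> j (\<ominus>\<^bsub>M\<^esub> x) = - \<pi> j x" if "x \<in> carrier M" for x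
    using add[of "\<ominus>\<^bsub>M\<^esub> x" x] that zero by (simp add: M.l_neg)
  let ?K = "{x \<in> K. \<pi> j x = 0}"
  have sub: "subgroup ?K (add_monoid M)"
  proof (rule subgroup.intro)
    fix x assume x: "x \<in> ?K"
    then have "\<ominus>\<^bsub>M\<^esub> x \<in> ?K" using K(1,4) uminus by auto
    then show "inv\<^bsub>add_monoid M\<^esub> x \<in> ?K" by (simp add: a_inv_def)
  qed (use K add zero in \<open>auto simp: subset_iff\<close>)
  have "\<exists>X. finite X \<and> X \<subseteq> ?K \<and> (\<forall>N. subgroup N (add_monoid M) \<longrightarrow> X \<subseteq> N \<longrightarrow>
      {x \<in> ?K. \<forall>j\<in>J. \<pi> j x = 0} \<subseteq> N \<longrightarrow> ?K \<subseteq> N)"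
    by (rule insert.IH[OF sub]) (rule insert.prems(2), simp_all)
  then obtain X where X: "finite X" "X \<subseteq> ?K"
    and XN: "\<forall>N. subgroup N (add_monoid M) \<longrightarrow> X \<subseteq> N \<longrightarrow>
      {x \<in> ?K. \<forall>j\<in>J. \<pi> j x = 0} \<subseteq> N \<longrightarrow> ?K \<subseteq> N"
    by (elim exE conjE)
  have KN: "?K \<subseteq> N"
    if "subgroup N (add_monoid M)" "X \<subseteq> N" "{x \<in> K. \<forall>j\<in>insert j J. \<pi> j x = 0} \<subseteq> N" for N
  proof -
    have "{x \<in> ?K. \<forall>j\<in>J. \<pi> j x = 0} = {x \<in> K. \<forall>j\<in>insert j J. \<pi> j x = 0}" by auto
    then show ?thesis using XN that by simp
  qed
  show ?case
  proof (cases "\<exists>x\<in>K. \<pi> j x \<noteq> 0")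
    case False
    then have "?K = K" by auto
    then show ?thesis using X KN by (intro exI[of _ X]) simp
  next
    case True
    then obtain x where "x \<in> K" "\<pi> j x \<noteq> 0" by blast
    then have "\<exists>m. \<exists>x\<in>K. \<pi> j x = int (Suc m)"
    proof (cases "\<pi> j x > 0")
      case True
      then have "\<pi> j x = int (Suc (nat (\<pi> j x - 1)))" by simp
      then show ?thesis using \<open>x \<in> K\<close> by blast
    next
      case False
      then have "\<pi> j (\<ominus>\<^bsub>M\<^esub> x) = int (Suc (nat (- \<pi> j x - 1)))"
        using \<open>x \<in> K\<close> \<open>\<pi> j x \<noteq> 0\<close> K(1) uminus by auto
      then show ?thesis using K(4)[OF \<open>x \<in> K\<close>] by blast
    qed
    then obtain m where m: "\<exists>x\<in>K. \<pi> j x = int (Suc m)"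
      and least: "\<And>m'. m' < m \<Longrightarrow> \<not> (\<exists>x\<in>K. \<pi> j x = int (Suc m'))"
      using exists_least_iff[of "\<lambda>m. \<exists>x\<in>K. \<pi> j x = int (Suc m)"] by blast
    then obtain x0 where x0: "x0 \<in> K" "\<pi> j x0 = int (Suc m)" by blast
    have min: "\<pi> j x0 \<le> \<pi> j x" if "x \<in> K" "\<pi> j x > 0" for x
    proof (rule ccontr)
      assume "\<not> \<pi> j x0 \<le> \<pi> j x"
      then have "nat (\<pi> j x - 1) < m" "\<pi> j x = int (Suc (nat (\<pi> j x - 1)))"
        using that x0 by auto
      then show False using least that(1) by blast
    qed
    show ?thesis
    proof (intro exI[of _ "insert x0 X"] conjI allI impI)
      show "finite (insert x0 X)" "insert x0 X \<subseteq> K" using X x0 by auto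
      fix N assume N: "subgroup N (add_monoid M)" "insert x0 X \<subseteq> N"
        "{x \<in> K. \<forall>j\<in>insert j J. \<pi> j x = 0} \<subseteq> N"
      note ND = sgD[OF N(1)]
      have KN: "?K \<subseteq> N" by (rule KN[OF N(1)]) (use N in auto)
      have "x \<in> N" if "x \<in> K" for x
        using that
      \<comment> \<open>Adding or subtracting \<open>x0\<close> decreases the absolute value, by minimality of \<open>\<pi> j x0\<close>.\<close>
      proof (induction "nat \<bar>\<pi> j x\<bar>" arbitrary: x rule: less_induct)
        case less
        have x: "x \<in> carrier M" "x0 \<in> carrier M" using less.prems x0 K(1) by auto
        consider "\<pi> j x = 0" | "\<pi> j x > 0" | "\<pi> j x < 0" by linarith
        then show ?case
        proof cases
          case 1
          then show ?thesis using KN less.prems by auto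
        next
          case 2
          let ?y = "x \<oplus>\<^bsub>M\<^esub> \<ominus>\<^bsub>M\<^esub> x0"
          have "\<pi> j ?y = \<pi> j x - \<pi> j x0" using x by (simp add: add uminus)
          then have "?y \<in> N"
            using 2 min[OF less.prems 2] x0 less.prems K(3,4) by (intro less.hyps) auto
          then have "?y \<oplus>\<^bsub>M\<^esub> x0 \<in> N" using ND(3) N(2) by auto
          moreover have "?y \<oplus>\<^bsub>M\<^esub> x0 = x" using x by (simp add: M.a_assoc M.l_neg)
          ultimately show ?thesis by simp
        next
          case 3
          let ?y = "x \<oplus>\<^bsub>M\<^esub> x0"
          have "\<pi> j x0 \<le> \<pi> j (\<ominus>\<^bsub>M\<^esub> x)" using 3 less.prems x K(4) by (intro min) (auto simp: uminus)
          then have "?y \<in> N"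
            using 3 x0 less.prems x K(3) by (intro less.hyps) (auto simp: add uminus)
          then have "?y \<oplus>\<^bsub>M\<^esub> \<ominus>\<^bsub>M\<^esub> x0 \<in> N" using ND(3,4) N(2) by auto
          moreover have "?y \<oplus>\<^bsub>M\<^esub> \<ominus>\<^bsub>M\<^esub> x0 = x" using x by (simp add: M.a_assoc M.r_neg)
          ultimately show ?thesis by simp
        qed
      qed
      then show "K \<subseteq> N" by blast
    qed
  qed
qed

section \<open>Kernels over the monoid with an identity adjoined\<close>

lemma finsum_regular_apply:
  assumes "monoid S" "f \<in> A \<rightarrow> carrier (monoid_ring S)" "finite A"
  shows "finsum (regular_module (monoid_ring S)) f A s = (\<Sum>a\<in>A. f a s)"
  using assms(3,2)
proof (induction A rule: finite_induct)
  interpret R: left_module "monoid_ring S" "regular_module (monoid_ring S)"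
    by (rule left_module_regular[OF monoid_ring_ring[OF assms(1)]])
  {
    case empty
    then show ?case by (simp add: monoid_ring_simps)
  next
    case (insert a A)
    then show ?case by (subst R.M.finsum_insert) (auto simp: monoid_ring_simps(2))
  }
qed

locale completely_simple_transversal = completely_simple_pointed U e for U (structure) and e +
  fixes E
  assumes E_subset: "E \<subseteq> carrier U" and E_nonempty: "E \<noteq> {}" and E_finite: "finite E"
    and E_idempotent: "f \<in> E \<Longrightarrow> f \<otimes> f = f"
    and E_left_unit: "u \<in> carrier U \<Longrightarrow> \<exists>f\<in>E. f \<otimes> u = u"
    and E_disjoint: "\<lbrakk>f \<in> E; f' \<in> E; u \<in> carrier U; v \<in> carrier U; f \<otimes> u = f' \<otimes> v\<rbrakk> \<Longrightarrow> f = f'"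
begin

lemma E_closed: "f \<in> E \<Longrightarrow> single (Some f) \<in> carrier ZS"
  using E_subset by (auto intro: single_Some_closed)

lemma E_square: "f \<in> E \<Longrightarrow> single (Some f) \<otimes>\<^bsub>ZS\<^esub> single (Some f) = single (Some f)"
  by (simp add: single_mult_single adjoin_identity_simps E_idempotent)

text \<open>
  These sums form the submodule generated by all \<open>u \<cdot> x\<close> with \<open>u \<in> U\<close>, since \<open>u = f u\<close> for some \<open>f \<in> E\<close>.
\<close>

definition idempotent_sum :: "('a option \<Rightarrow> int, 'm) module \<Rightarrow> ('a \<Rightarrow> 'm) \<Rightarrow> 'm" where
  "idempotent_sum M a = (\<Oplus>\<^bsub>M\<^esub>f\<in>E. single (Some f) \<odot>\<^bsub>M\<^esub> a f)"

text \<open>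
  For a free module the sum of the groups \<open>fM\<close> is direct. By taking coordinates this reduces to \<open>\<int>S\<close>, where the
  supports of \<open>f y\<close> for different \<open>f\<close> lie in disjoint right ideals.
\<close>

lemma idempotent_sum_eq_zero:
  assumes "fg_free ZS M" and a: "a \<in> E \<rightarrow> carrier M" and zero: "idempotent_sum M a = \<zero>\<^bsub>M\<^esub>"
    and f: "f \<in> E"
  shows "single (Some f) \<odot>\<^bsub>M\<^esub> a f = \<zero>\<^bsub>M\<^esub>"
proof -
  obtain B where M: "left_module ZS M" and B: "finite_basis ZS M B"
    using assms(1) by (auto simp: fg_free_def)
  interpret M: left_module ZS M by fact
  obtain \<kappa> where \<kappa>: "\<And>b. b \<in> B \<Longrightarrow> left_module_map ZS M (regular_module ZS) (\<kappa> b)"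
    and expand: "\<And>x. x \<in> carrier M \<Longrightarrow> x = (\<Oplus>\<^bsub>M\<^esub>b\<in>B. \<kappa> b x \<odot>\<^bsub>M\<^esub> b)"
    by (rule M.coordinates[OF B]) (rule that; assumption)
  have BM: "B \<subseteq> carrier M" using B by (simp add: finite_basis_def)
  let ?t = "\<lambda>f. single (Some f) \<odot>\<^bsub>M\<^esub> a f"
  have t: "?t f \<in> carrier M" if "f \<in> E" for f
    using a that E_closed by (auto intro!: M.smult_closed)
  have "\<kappa> b (?t f) = \<zero>\<^bsub>ZS\<^esub>" if b: "b \<in> B" for b
  proof -
    interpret k: left_module_map ZS M "regular_module ZS" "\<kappa> b" by (rule \<kappa>[OF b])
    have supp: "\<exists>u\<in>carrier U. s = Some (f \<otimes> u)" if f: "f \<in> E" and s: "\<kappa> b (?t f) s \<noteq> 0" for f s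
    proof -
      have af: "\<kappa> b (a f) \<in> carrier ZS" using k.closed a f by auto
      have "\<kappa> b (?t f) = single (Some f) \<otimes>\<^bsub>ZS\<^esub> \<kappa> b (a f)"
        using k.smult[OF E_closed[OF f], of "a f"] a f by auto
      then have "s \<in> {s. (single (Some f) \<otimes>\<^bsub>ZS\<^esub> \<kappa> b (a f)) s \<noteq> 0}" using s by simp
      then obtain r where r: "\<kappa> b (a f) r \<noteq> 0" "s = Some f \<otimes>\<^bsub>S\<^esub> r"
        using monoid_ring_mult_support[OF E_closed[OF f] af] by (auto simp: single_support)
      have "r \<in> carrier S" using r(1) af by (auto simp: monoid_ring_simps)
      then consider "r = None" | u where "r = Some u" "u \<in> carrier U"
        by (auto simp: adjoin_identity_simps)
      then show ?thesis
      proof cases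
        case 1
        then have "s = Some (f \<otimes> f)" using r(2) E_idempotent[OF f] by (simp add: adjoin_identity_simps)
        then show ?thesis using f E_subset by blast
      next
        case 2
        then show ?thesis using r(2) by (auto simp: adjoin_identity_simps)
      qed
    qed
    have "\<kappa> b (?t f) s = 0" for s
    proof (rule ccontr)
      assume nz: "\<kappa> b (?t f) s \<noteq> 0"
      have other: "\<kappa> b (?t f') s = 0" if "f' \<in> E" "f' \<noteq> f" for f'
        using supp[OF f nz] supp[OF that(1)] E_disjoint[OF f that(1)] that(2) by fastforce
      have "0 = \<kappa> b (idempotent_sum M a) s"
        unfolding zero k.zero by (simp add: monoid_ring_simps)
      also have "\<dots> = (\<Oplus>\<^bsub>regular_module ZS\<^esub>f\<in>E. \<kappa> b (?t f)) s"
        unfolding idempotent_sum_def using t by (subst k.finsum) auto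
      also have "\<dots> = (\<Sum>f'\<in>E. \<kappa> b (?t f') s)"
        by (rule finsum_regular_apply[OF S_monoid _ E_finite]) (use t k.closed in auto)
      also have "\<dots> = (\<Sum>f'\<in>{f}. \<kappa> b (?t f') s)"
        using other f E_finite by (intro sum.mono_neutral_right) auto
      finally show False using nz by simp
    qed
    then show ?thesis by (auto simp: monoid_ring_simps)
  qed
  then have "(\<Oplus>\<^bsub>M\<^esub>b\<in>B. \<kappa> b (?t f) \<odot>\<^bsub>M\<^esub> b) = (\<Oplus>\<^bsub>M\<^esub>b\<in>B. \<zero>\<^bsub>M\<^esub>)"
    using BM by (intro M.finsum_cong') (auto simp: M.zero_smult)
  then show ?thesis using expand[OF t[OF f]] by (simp add: M.finsum_zero)
qed

text \<open>
  An element of a free module lies in \<open>UM\<close> if its coordinates lie in \<open>\<int>U\<close>, that is, vanish at the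
  adjoined identity.
\<close>

lemma idempotent_sum_if_constant_coordinates_vanish:
  assumes "left_module ZS M" "B \<subseteq> carrier M" "finite B"
    and y: "\<And>b. b \<in> B \<Longrightarrow> y b \<in> carrier ZS" "\<And>b. b \<in> B \<Longrightarrow> y b None = 0"
  shows "\<exists>a \<in> E \<rightarrow> carrier M. (\<Oplus>\<^bsub>M\<^esub>b\<in>B. y b \<odot>\<^bsub>M\<^esub> b) = idempotent_sum M a"
proof -
  interpret M: left_module ZS M by fact
  have t: "(\<lambda>f. single (Some f) \<odot>\<^bsub>M\<^esub> a f) \<in> E \<rightarrow> carrier M" if "a \<in> E \<rightarrow> carrier M" for a
    using that E_closed by (auto intro!: M.smult_closed)
  define D where "D = {x. \<exists>a \<in> E \<rightarrow> carrier M. x = idempotent_sum M a}"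
  have sub: "D \<subseteq> carrier M"
    using t by (auto simp: D_def idempotent_sum_def intro!: M.M.finsum_closed)
  have zero: "\<zero>\<^bsub>M\<^esub> \<in> D"
  proof -
    have "idempotent_sum M (\<lambda>_. \<zero>\<^bsub>M\<^esub>) = (\<Oplus>\<^bsub>M\<^esub>f\<in>E. \<zero>\<^bsub>M\<^esub>)"
      unfolding idempotent_sum_def using E_closed by (intro M.M.finsum_cong') (auto simp: M.smult_zero)
    then show ?thesis unfolding D_def by (auto simp: M.finsum_zero intro!: bexI[of _ "\<lambda>_. \<zero>\<^bsub>M\<^esub>"])
  qed
  have add: "x \<oplus>\<^bsub>M\<^esub> x' \<in> D" if xx: "x \<in> D" "x' \<in> D" for x x'
  proof -
    obtain a a' where a: "a \<in> E \<rightarrow> carrier M" "x = idempotent_sum M a"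
      and a': "a' \<in> E \<rightarrow> carrier M" "x' = idempotent_sum M a'"
      using xx by (auto simp: D_def)
    have "x \<oplus>\<^bsub>M\<^esub> x' = (\<Oplus>\<^bsub>M\<^esub>f\<in>E. single (Some f) \<odot>\<^bsub>M\<^esub> a f \<oplus>\<^bsub>M\<^esub> single (Some f) \<odot>\<^bsub>M\<^esub> a' f)"
      unfolding a(2) a'(2) idempotent_sum_def by (rule M.M.finsum_addf[symmetric]) (use t a a' in auto)
    also have "\<dots> = idempotent_sum M (\<lambda>f. a f \<oplus>\<^bsub>M\<^esub> a' f)"
      unfolding idempotent_sum_def
      using a a' E_closed by (intro M.M.finsum_cong') (simp_all add: Pi_iff M.smult_r_distr M.smult_closed)
    finally show ?thesis unfolding D_def using a a' by (auto intro!: bexI[of _ "\<lambda>f. a f \<oplus>\<^bsub>M\<^esub> a' f"])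
  qed
  have uminus: "\<ominus>\<^bsub>M\<^esub> x \<in> D" if x: "x \<in> D" for x
  proof -
    obtain a where a: "a \<in> E \<rightarrow> carrier M" "x = idempotent_sum M a"
      using x by (auto simp: D_def)
    have "idempotent_sum M (\<lambda>f. \<ominus>\<^bsub>M\<^esub> a f) = (\<ominus>\<^bsub>ZS\<^esub> \<one>\<^bsub>ZS\<^esub>) \<odot>\<^bsub>M\<^esub> x"
      unfolding a(2) idempotent_sum_def
      using a t E_closed
      by (subst M.finsum_smult)
         (auto simp: M.smult_minus M.minus_one_smult M.smult_closed Pi_iff intro!: M.M.finsum_cong')
    also have "\<dots> = \<ominus>\<^bsub>M\<^esub> x" using x sub by (auto simp: M.minus_one_smult)
    finally show ?thesis unfolding D_def using a by (auto intro!: bexI[of _ "\<lambda>f. \<ominus>\<^bsub>M\<^esub> a f"])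
  qed
  have closed: "z(None := 0) \<in> carrier ZS" if "z \<in> carrier ZS" for z
    using that by (auto simp: monoid_ring_simps elim!: rev_finite_subset)
  have "(z(None := 0)) \<odot>\<^bsub>M\<^esub> b \<in> D" if z: "z \<in> carrier ZS" and b: "b \<in> carrier M" for z b
    using z
  proof (induction z rule: monoid_ring_induct)
    case zero
    have "(\<lambda>_. 0)(None := 0) = \<zero>\<^bsub>ZS\<^esub>" by (auto simp: monoid_ring_simps)
    then show ?case using b \<open>\<zero>\<^bsub>M\<^esub> \<in> D\<close> by (simp add: M.zero_smult)
  next
    case (single s)
    show ?case
    proof (cases s)
      case None
      then have "(single s)(None := 0) = \<zero>\<^bsub>ZS\<^esub>" by (auto simp: monoid_ring_simps single_def)
      then show ?thesis using b \<open>\<zero>\<^bsub>M\<^esub> \<in> D\<close> by (simp add: M.zero_smult)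
    next
      case (Some u)
      then have u: "u \<in> carrier U" using single by (auto simp: adjoin_identity_simps)
      have restricted: "(single s)(None := 0) = single (Some u)" using Some by (auto simp: single_def)
      obtain f where f: "f \<in> E" "f \<otimes> u = u" using E_left_unit[OF u] by blast
      let ?x = "single (Some u) \<odot>\<^bsub>M\<^esub> b"
      let ?a = "\<lambda>f'. if f = f' then ?x else \<zero>\<^bsub>M\<^esub>"
      have x: "?x \<in> carrier M" using u b by (auto intro!: M.smult_closed single_Some_closed)
      have fx: "single (Some f) \<odot>\<^bsub>M\<^esub> ?x = ?x"
        using u b f by (simp add: M.smult_assoc[symmetric] E_closed single_Some_closed
            single_mult_single adjoin_identity_simps)
      have "idempotent_sum M ?a = (\<Oplus>\<^bsub>M\<^esub>f'\<in>E. if f = f' then ?x else \<zero>\<^bsub>M\<^esub>)"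
        unfolding idempotent_sum_def
        using E_closed x fx by (intro M.M.finsum_cong') (auto simp: M.smult_zero)
      also have "\<dots> = ?x" using M.M.finsum_singleton[OF f(1) E_finite, of "\<lambda>_. ?x"] x by auto
      finally have "?x \<in> D" unfolding D_def using x by (auto intro!: bexI[of _ ?a])
      then show ?thesis by (simp only: restricted)
    qed
  next
    case (add z z')
    note zz = closed[OF add(1)] closed[OF add(2)]
    have "(\<lambda>s. z s + z' s)(None := 0) = z(None := 0) \<oplus>\<^bsub>ZS\<^esub> z'(None := 0)"
      by (auto simp: monoid_ring_simps)
    then show ?case
      using add(3,4) zz b \<open>\<And>x x'. \<lbrakk>x \<in> D; x' \<in> D\<rbrakk> \<Longrightarrow> x \<oplus>\<^bsub>M\<^esub> x' \<in> D\<close>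
      by (simp add: M.smult_l_distr del: fun_upd_apply)
  next
    case (uminus z)
    note zz = closed[OF uminus(1)]
    have "(\<lambda>s. - z s)(None := 0) = \<ominus>\<^bsub>ZS\<^esub> (z(None := 0))"
      by (auto simp: monoid_ring_a_inv[OF S_monoid zz])
    then show ?case
      using uminus(2) zz b \<open>\<And>x. x \<in> D \<Longrightarrow> \<ominus>\<^bsub>M\<^esub> x \<in> D\<close>
      by (simp add: M.minus_smult del: fun_upd_apply)
  qed
  then have "y b \<odot>\<^bsub>M\<^esub> b \<in> D" if "b \<in> B" for b
    using y[OF that] assms(2) that by (metis fun_upd_triv subsetD)
  then have "(\<Oplus>\<^bsub>M\<^esub>b\<in>B. y b \<odot>\<^bsub>M\<^esub> b) \<in> D" by (intro M.finsum_mem[OF sub zero add]) auto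
  then show ?thesis by (simp add: D_def)
qed

text \<open>
  The common part of the two kinds of kernels. Generators of \<open>eK\<close> generate every \<open>f \<cdot> x\<close> with \<open>x \<in> K\<close>, because
  \<open>f \<in> U e f\<close>. Finitely many further elements of \<open>K\<close> reduce every element of \<open>K\<close> to one whose coordinates vanish at the
  adjoined identity, which is a sum over \<open>E\<close>. It remains to generate such sums, and this is the last hypothesis.
\<close>

lemma finitely_generated_from_corner:
  assumes free: "fg_free ZS M" and K: "submodule K ZS M"
    and corner: "finitely_generated ZH (corner e M) (K \<inter> carrier (corner e M))"
    and Y: "finite Y" "Y \<subseteq> K"
    and sums: "\<And>N a. \<lbrakk>submodule N ZS M; Y \<subseteq> N; \<And>f x. \<lbrakk>f \<in> E; x \<in> K\<rbrakk> \<Longrightarrow> single (Some f) \<odot>\<^bsub>M\<^esub> x \<in> N;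
        a \<in> E \<rightarrow> carrier M; idempotent_sum M a \<in> K\<rbrakk> \<Longrightarrow> idempotent_sum M a \<in> N"
  shows "finitely_generated ZS M K"
proof -
  obtain B where M: "left_module ZS M" and B: "finite_basis ZS M B"
    using free by (auto simp: fg_free_def)
  interpret M: left_module ZS M by fact
  interpret C: left_module ZH "corner e M" by (rule corner_left_module[OF M])
  note KD = M.submoduleD[OF K]
  obtain \<kappa> where \<kappa>: "\<And>b. b \<in> B \<Longrightarrow> left_module_map ZS M (regular_module ZS) (\<kappa> b)"
    and expand: "\<And>x. x \<in> carrier M \<Longrightarrow> x = (\<Oplus>\<^bsub>M\<^esub>b\<in>B. \<kappa> b x \<odot>\<^bsub>M\<^esub> b)"
    by (rule M.coordinates[OF B]) (rule that; assumption)
  have finB: "finite B" and BM: "B \<subseteq> carrier M" using B by (auto simp: finite_basis_def)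
  obtain X1 where X1: "finite X1" "X1 \<subseteq> K \<inter> carrier (corner e M)"
    "\<And>N. \<lbrakk>submodule N ZH (corner e M); X1 \<subseteq> N\<rbrakk> \<Longrightarrow> K \<inter> carrier (corner e M) \<subseteq> N"
    using corner by (auto simp: finitely_generated_def)
  have "\<kappa> b (x \<oplus>\<^bsub>M\<^esub> y) None = \<kappa> b x None + \<kappa> b y None"
    if "b \<in> B" "x \<in> carrier M" "y \<in> carrier M" for b x y
    using left_module_map.add[OF \<kappa>[OF that(1)] that(2,3)] by (simp add: monoid_ring_simps)
  from subgroup_generated_modulo_functionals[OF M.M.abelian_group_axioms finB submodule.axioms(1)[OF K], of "\<lambda>b x. \<kappa> b x None", OF this]
  obtain X2 where X2: "finite X2" "X2 \<subseteq> K"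
    "\<And>N. \<lbrakk>subgroup N (add_monoid M); X2 \<subseteq> N; {x \<in> K. \<forall>b\<in>B. \<kappa> b x None = 0} \<subseteq> N\<rbrakk> \<Longrightarrow> K \<subseteq> N"
    by blast
  show ?thesis
    unfolding finitely_generated_def
  proof (intro exI[of _ "X1 \<union> X2 \<union> Y"] conjI allI impI)
    show "finite (X1 \<union> X2 \<union> Y)" "X1 \<union> X2 \<union> Y \<subseteq> K" using X1 X2 Y by auto
    fix N assume N: "submodule N ZS M" "X1 \<union> X2 \<union> Y \<subseteq> N"
    note ND = M.submoduleD[OF N(1)]
    have "submodule (N \<inter> carrier (corner e M)) ZH (corner e M)"
    proof (rule C.submodule_introduction)
      show "x \<oplus>\<^bsub>corner e M\<^esub> y \<in> N \<inter> carrier (corner e M)"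
        if "x \<in> N \<inter> carrier (corner e M)" "y \<in> N \<inter> carrier (corner e M)" for x y
        using that ND(3) C.M.a_closed by (simp add: corner_simps(3))
      show "g \<odot>\<^bsub>corner e M\<^esub> x \<in> N \<inter> carrier (corner e M)"
        if "g \<in> carrier ZH" "x \<in> N \<inter> carrier (corner e M)" for g x
        using that ND(6) C.smult_closed extend_by_zero_closed by (simp add: corner_simps(4))
      show "\<zero>\<^bsub>corner e M\<^esub> \<in> N \<inter> carrier (corner e M)"
        using ND(2) C.M.zero_closed by (simp add: corner_simps(2))
    qed auto
    from X1(3)[OF this] have KC: "K \<inter> carrier (corner e M) \<subseteq> N" using N(2) X1(2) by blast
    have EN: "single (Some f) \<odot>\<^bsub>M\<^esub> x \<in> N" if f: "f \<in> E" and x: "x \<in> K" for f x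
    proof -
      have fU: "f \<in> carrier U" using f E_subset by auto
      obtain w where w: "w \<in> carrier U" "w \<otimes> (e \<otimes> f) = f" using left_recover e_closed fU by blast
      have xM: "x \<in> carrier M" using x KD(1) by auto
      let ?y = "single (Some f) \<odot>\<^bsub>M\<^esub> x"
      have y: "?y \<in> K" using KD(6) E_closed[OF f] x by simp
      then have "single (Some e) \<odot>\<^bsub>M\<^esub> ?y \<in> K \<inter> carrier (corner e M)"
        using KD(1,6) Some_e_S e_smult_corner[OF M] by auto
      then have "single (Some w) \<odot>\<^bsub>M\<^esub> (single (Some e) \<odot>\<^bsub>M\<^esub> ?y) \<in> N"
        using KC ND(6) single_Some_closed[OF w(1)] by auto
      moreover have "single (Some w) \<odot>\<^bsub>M\<^esub> (single (Some e) \<odot>\<^bsub>M\<^esub> ?y) =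
          (single (Some w) \<otimes>\<^bsub>ZS\<^esub> (single (Some e) \<otimes>\<^bsub>ZS\<^esub> single (Some f))) \<odot>\<^bsub>M\<^esub> x"
        using xM w(1) f E_closed Some_e_S single_Some_closed by (simp add: M.smult_assoc M.smult_closed)
      moreover have "single (Some w) \<otimes>\<^bsub>ZS\<^esub> (single (Some e) \<otimes>\<^bsub>ZS\<^esub> single (Some f)) = single (Some f)"
        using w(2) by (simp add: single_mult_single adjoin_identity_simps)
      ultimately show ?thesis by simp
    qed
    show "K \<subseteq> N"
    proof (rule X2(3)[OF submodule.axioms(1)[OF N(1)]])
      show "X2 \<subseteq> N" using N(2) by auto
      show "{x \<in> K. \<forall>b\<in>B. \<kappa> b x None = 0} \<subseteq> N"
      proof
        fix x assume "x \<in> {x \<in> K. \<forall>b\<in>B. \<kappa> b x None = 0}"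
        then have x: "x \<in> K" "\<And>b. b \<in> B \<Longrightarrow> \<kappa> b x None = 0" by auto
        have xM: "x \<in> carrier M" using x(1) KD(1) by auto
        have "\<kappa> b x \<in> carrier ZS" if "b \<in> B" for b
          using left_module_map.closed[OF \<kappa>[OF that] xM] by simp
        from idempotent_sum_if_constant_coordinates_vanish[OF M BM finB, of "\<lambda>b. \<kappa> b x", OF this x(2)]
        obtain a where "a \<in> E \<rightarrow> carrier M" "x = idempotent_sum M a"
          using expand[OF xM] by auto
        then show "x \<in> N" using sums[OF N(1) _ EN] N(2) x(1) by auto
      qed
    qed
  qed
qed

text \<open>
  If \<open>\<Sum> f a\<^sub>f\<close> is in the kernel, then \<open>\<Sum> f (d a\<^sub>f) = 0\<close>, and directness in \<open>N\<close> puts each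
  \<open>f a\<^sub>f\<close> into the kernel. As \<open>f f = f\<close>, these terms lie in \<open>UK\<close>.
\<close>

lemma finitely_generated_kernel_of_free:
  fixes N :: "('a option \<Rightarrow> int, 'k) module"
  assumes d: "left_module_map ZS M N d" and free: "fg_free ZS M" "fg_free ZS N"
    and corner: "finitely_generated ZH (corner e M) (module_kernel M N d \<inter> carrier (corner e M))"
  shows "finitely_generated ZS M (module_kernel M N d)"
proof (rule finitely_generated_from_corner[OF free(1) _ corner, of "{}"])
  interpret d: left_module_map ZS M N d by fact
  show "submodule (module_kernel M N d) ZS M" by (rule d.submodule_kernel)
  fix L a
  assume L: "submodule L ZS M"
    and EL: "\<And>f x. \<lbrakk>f \<in> E; x \<in> module_kernel M N d\<rbrakk> \<Longrightarrow> single (Some f) \<odot>\<^bsub>M\<^esub> x \<in> L"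
    and a: "a \<in> E \<rightarrow> carrier M" and sum: "idempotent_sum M a \<in> module_kernel M N d"
  have t: "single (Some f) \<odot>\<^bsub>M\<^esub> a f \<in> carrier M" if "f \<in> E" for f
    using a that E_closed by (auto intro!: d.M.smult_closed)
  have da: "(\<lambda>f. d (a f)) \<in> E \<rightarrow> carrier N" using a d.closed by auto
  have "idempotent_sum N (\<lambda>f. d (a f)) = d (idempotent_sum M a)"
    unfolding idempotent_sum_def using t a da E_closed
    by (subst d.finsum) (auto simp: d.smult Pi_iff intro!: d.N.M.finsum_cong' d.N.smult_closed)
  also have "\<dots> = \<zero>\<^bsub>N\<^esub>" using sum by (simp add: module_kernel_def)
  finally have zero: "idempotent_sum N (\<lambda>f. d (a f)) = \<zero>\<^bsub>N\<^esub>" .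
  have "single (Some f) \<odot>\<^bsub>M\<^esub> a f \<in> L" if f: "f \<in> E" for f
  proof -
    have af: "a f \<in> carrier M" using a f by auto
    have "single (Some f) \<odot>\<^bsub>M\<^esub> a f \<in> module_kernel M N d"
      using idempotent_sum_eq_zero[OF free(2) da zero f] t[OF f] af
      by (simp add: module_kernel_def d.smult E_closed[OF f])
    from EL[OF f this] show ?thesis
      using af E_closed[OF f] by (simp add: d.M.smult_assoc[symmetric] E_square[OF f])
  qed
  then show "idempotent_sum M a \<in> L"
    unfolding idempotent_sum_def by (intro d.M.finsum_mem_submodule[OF L]) auto
qed auto

text \<open>
  If \<open>\<Sum> f a\<^sub>f\<close> is in the kernel, then the integers \<open>z\<^sub>f = \<epsilon> a\<^sub>f\<close> have sum 0. With \<open>\<epsilon> b = 1\<close> and a fixed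
  \<open>g \<in> E\<close>,
  \<open>\<Sum> f a\<^sub>f = \<Sum> f (a\<^sub>f - z\<^sub>f b) + \<Sum> z\<^sub>f (f b - g b)\<close>,
  and all \<open>a\<^sub>f - z\<^sub>f b\<close> and \<open>f b - g b\<close> are in the kernel.
\<close>

lemma finitely_generated_kernel_of_augmentation:
  assumes \<epsilon>: "left_module_map ZS M (trivial_module :: ('a option \<Rightarrow> int, int) module) \<epsilon>"
    and surj: "\<epsilon> ` carrier M = UNIV" and free: "fg_free ZS M"
    and corner: "finitely_generated ZH (corner e M)
      (module_kernel M (trivial_module :: ('a option \<Rightarrow> int, int) module) \<epsilon> \<inter> carrier (corner e M))"
  shows "finitely_generated ZS M (module_kernel M (trivial_module :: ('a option \<Rightarrow> int, int) module) \<epsilon>)"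
proof -
  let ?Z = "trivial_module :: ('a option \<Rightarrow> int, int) module"
  interpret \<epsilon>: left_module_map ZS M ?Z \<epsilon> by fact
  have Z: "x \<oplus>\<^bsub>?Z\<^esub> y = x + y" "\<zero>\<^bsub>?Z\<^esub> = 0" "f \<odot>\<^bsub>?Z\<^esub> z = augmentation f * z" "carrier ?Z = UNIV"
    for x y z f by (simp_all add: trivial_module_def)
  let ?K = "module_kernel M ?Z \<epsilon>"
  have K: "?K = {x \<in> carrier M. \<epsilon> x = 0}" by (simp add: module_kernel_def Z)
  obtain b where b: "b \<in> carrier M" "\<epsilon> b = 1" using surj by (metis UNIV_I imageE)
  obtain g where g: "g \<in> E" using E_nonempty by blast
  let ?w = "\<lambda>f. single (Some f) \<odot>\<^bsub>M\<^esub> b"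
  have w: "?w f \<in> carrier M" "\<epsilon> (?w f) = 1" if "f \<in> E" for f
    using that b E_closed by (simp_all add: \<epsilon>.M.smult_closed \<epsilon>.smult Z augmentation_single)
  have \<epsilon>_uminus: "\<epsilon> (\<ominus>\<^bsub>M\<^esub> x) = - \<epsilon> x" if "x \<in> carrier M" for x
    using \<epsilon>.add[of "\<ominus>\<^bsub>M\<^esub> x" x] that \<epsilon>.zero by (simp add: \<epsilon>.M.M.l_neg Z)
  have \<epsilon>_minus: "\<epsilon> (x \<ominus>\<^bsub>M\<^esub> y) = \<epsilon> x - \<epsilon> y" if "x \<in> carrier M" "y \<in> carrier M" for x y
    using that by (simp add: a_minus_def \<epsilon>.add \<epsilon>_uminus Z)
  \<comment> \<open>Integer multiples are taken inside the ring, where they are central.\<close>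
  define const :: "int \<Rightarrow> 'a option \<Rightarrow> int" where "const z s = (if s = None then z else 0)" for z s
  have const: "const z \<in> carrier ZS" "augmentation (const z) = z" for z
  proof -
    show "const z \<in> carrier ZS" by (auto simp: monoid_ring_simps const_def adjoin_identity_simps)
    have "augmentation (const z) = sum (const z) {None}"
      by (rule augmentation_superset) (auto simp: const_def)
    then show "augmentation (const z) = z" by (simp add: const_def)
  qed
  have const_add: "const (z + z') = const z \<oplus>\<^bsub>ZS\<^esub> const z'" for z z'
    by (auto simp: monoid_ring_simps const_def)
  have const_0: "const 0 = \<zero>\<^bsub>ZS\<^esub>" by (auto simp: monoid_ring_simps const_def)
  have const_commute: "const z \<otimes>\<^bsub>ZS\<^esub> single s = single s \<otimes>\<^bsub>ZS\<^esub> const z" for z s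
  proof
    fix t
    have "(const z \<otimes>\<^bsub>ZS\<^esub> single s) t = (\<Sum>a\<in>{None}. \<Sum>b\<in>{s}. if a \<otimes>\<^bsub>S\<^esub> b = t then const z a * single s b else 0)"
      by (rule monoid_ring_mult) (auto simp: const_def single_support)
    also have "\<dots> = (\<Sum>a\<in>{s}. \<Sum>b\<in>{None}. if a \<otimes>\<^bsub>S\<^esub> b = t then single s a * const z b else 0)"
      by (simp add: adjoin_identity_simps)
    also have "\<dots> = (single s \<otimes>\<^bsub>ZS\<^esub> const z) t"
      by (rule monoid_ring_mult[symmetric]) (auto simp: const_def single_support)
    finally show "(const z \<otimes>\<^bsub>ZS\<^esub> single s) t = (single s \<otimes>\<^bsub>ZS\<^esub> const z) t" .
  qed
  let ?Y = "(\<lambda>f. ?w f \<ominus>\<^bsub>M\<^esub> ?w g) ` E"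
  show ?thesis
  proof (rule finitely_generated_from_corner[OF free \<epsilon>.submodule_kernel corner, of ?Y])
    show "finite ?Y" using E_finite by simp
    show "?Y \<subseteq> ?K" using w g by (auto simp: K \<epsilon>_minus)
    fix L a
    assume L: "submodule L ZS M" and Y: "?Y \<subseteq> L"
      and EL: "\<And>f x. \<lbrakk>f \<in> E; x \<in> ?K\<rbrakk> \<Longrightarrow> single (Some f) \<odot>\<^bsub>M\<^esub> x \<in> L"
      and a: "a \<in> E \<rightarrow> carrier M" and sum: "idempotent_sum M a \<in> ?K"
    note LD = \<epsilon>.M.submoduleD[OF L]
    have t: "single (Some f) \<odot>\<^bsub>M\<^esub> a f \<in> carrier M" if "f \<in> E" for f
      using a that E_closed by (auto intro!: \<epsilon>.M.smult_closed)
    have "0 = \<epsilon> (idempotent_sum M a)" using sum by (simp add: K)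
    also have "\<dots> = (\<Oplus>\<^bsub>?Z\<^esub>f\<in>E. \<epsilon> (single (Some f) \<odot>\<^bsub>M\<^esub> a f))"
      unfolding idempotent_sum_def using t by (subst \<epsilon>.finsum) auto
    also have "\<dots> = (\<Sum>f\<in>E. \<epsilon> (single (Some f) \<odot>\<^bsub>M\<^esub> a f))"
      by (rule finsum_trivial_module[OF S_monoid E_finite])
    also have "\<dots> = (\<Sum>f\<in>E. \<epsilon> (a f))"
      using a E_closed by (intro sum.cong) (simp_all add: Pi_iff \<epsilon>.smult Z augmentation_single)
    finally have total: "(\<Sum>f\<in>E. \<epsilon> (a f)) = 0" by simp
    let ?c = "\<lambda>f. const (\<epsilon> (a f)) \<odot>\<^bsub>M\<^esub> ?w g"
    let ?r = "\<lambda>f. single (Some f) \<odot>\<^bsub>M\<^esub> a f \<ominus>\<^bsub>M\<^esub> ?c f"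
    have c: "?c f \<in> carrier M" for f using const w(1)[OF g] by (simp add: \<epsilon>.M.smult_closed)
    have rL: "?r f \<in> L" if f: "f \<in> E" for f
    proof -
      have af: "a f \<in> carrier M" using a f by auto
      let ?z = "\<epsilon> (a f)"
      have zb: "const ?z \<odot>\<^bsub>M\<^esub> b \<in> carrier M" using const b by (simp add: \<epsilon>.M.smult_closed)
      have "a f \<ominus>\<^bsub>M\<^esub> const ?z \<odot>\<^bsub>M\<^esub> b \<in> ?K"
        using af zb b const by (simp add: K \<epsilon>_minus \<epsilon>.smult Z)
      then have 1: "single (Some f) \<odot>\<^bsub>M\<^esub> (a f \<ominus>\<^bsub>M\<^esub> const ?z \<odot>\<^bsub>M\<^esub> b) \<in> L" by (rule EL[OF f])
      have 2: "const ?z \<odot>\<^bsub>M\<^esub> (?w f \<ominus>\<^bsub>M\<^esub> ?w g) \<in> L"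
        using LD(6)[OF const(1)] Y f by auto
      have "single (Some f) \<odot>\<^bsub>M\<^esub> (const ?z \<odot>\<^bsub>M\<^esub> b) = const ?z \<odot>\<^bsub>M\<^esub> ?w f"
        using E_closed[OF f] const b by (simp add: \<epsilon>.M.smult_assoc[symmetric] const_commute)
      then have "single (Some f) \<odot>\<^bsub>M\<^esub> (a f \<ominus>\<^bsub>M\<^esub> const ?z \<odot>\<^bsub>M\<^esub> b) =
          single (Some f) \<odot>\<^bsub>M\<^esub> a f \<oplus>\<^bsub>M\<^esub> \<ominus>\<^bsub>M\<^esub> (const ?z \<odot>\<^bsub>M\<^esub> ?w f)"
        using E_closed[OF f] af zb by (simp add: a_minus_def \<epsilon>.M.smult_r_distr \<epsilon>.M.smult_minus)
      moreover have "const ?z \<odot>\<^bsub>M\<^esub> (?w f \<ominus>\<^bsub>M\<^esub> ?w g) = const ?z \<odot>\<^bsub>M\<^esub> ?w f \<oplus>\<^bsub>M\<^esub> \<ominus>\<^bsub>M\<^esub> ?c f"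
        using const w f g by (simp add: a_minus_def \<epsilon>.M.smult_r_distr \<epsilon>.M.smult_minus)
      moreover have "p \<oplus>\<^bsub>M\<^esub> \<ominus>\<^bsub>M\<^esub> q \<oplus>\<^bsub>M\<^esub> (q \<oplus>\<^bsub>M\<^esub> r) = p \<oplus>\<^bsub>M\<^esub> r"
        if "p \<in> carrier M" "q \<in> carrier M" "r \<in> carrier M" for p q r
      proof -
        have "\<ominus>\<^bsub>M\<^esub> q \<oplus>\<^bsub>M\<^esub> (q \<oplus>\<^bsub>M\<^esub> r) = r"
          using that by (simp add: \<epsilon>.M.M.a_assoc[symmetric] \<epsilon>.M.M.l_neg)
        then show ?thesis using that by (simp add: \<epsilon>.M.M.a_assoc)
      qed
      ultimately have "?r f = single (Some f) \<odot>\<^bsub>M\<^esub> (a f \<ominus>\<^bsub>M\<^esub> const ?z \<odot>\<^bsub>M\<^esub> b) \<oplus>\<^bsub>M\<^esub>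
          const ?z \<odot>\<^bsub>M\<^esub> (?w f \<ominus>\<^bsub>M\<^esub> ?w g)"
        using t[OF f] c const w(1)[OF f] by (simp add: a_minus_def \<epsilon>.M.smult_closed)
      then show ?thesis using LD(3)[OF 1 2] by simp
    qed
    have cs: "(\<Oplus>\<^bsub>M\<^esub>f\<in>F. ?c f) = const (\<Sum>f\<in>F. \<epsilon> (a f)) \<odot>\<^bsub>M\<^esub> ?w g" if "finite F" for F
      using that
    proof (induction F rule: finite_induct)
      case empty
      then show ?case using w(1)[OF g] by (simp add: const_0 \<epsilon>.M.zero_smult)
    next
      case (insert f F)
      then show ?case
        using c w(1)[OF g] const by (simp add: const_add \<epsilon>.M.M.finsum_insert \<epsilon>.M.smult_l_distr)
    qed
    have rM: "?r f \<in> carrier M" if "f \<in> E" for f using t[OF that] c by simp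
    have "idempotent_sum M a = (\<Oplus>\<^bsub>M\<^esub>f\<in>E. ?r f \<oplus>\<^bsub>M\<^esub> ?c f)"
      unfolding idempotent_sum_def
      using t c by (intro \<epsilon>.M.M.finsum_cong') (auto simp: a_minus_def \<epsilon>.M.M.a_assoc \<epsilon>.M.M.l_neg)
    also have "\<dots> = (\<Oplus>\<^bsub>M\<^esub>f\<in>E. ?r f) \<oplus>\<^bsub>M\<^esub> (\<Oplus>\<^bsub>M\<^esub>f\<in>E. ?c f)"
      using rM c by (intro \<epsilon>.M.M.finsum_addf) auto
    also have "\<dots> = (\<Oplus>\<^bsub>M\<^esub>f\<in>E. ?r f)"
      using w(1)[OF g] rM
      by (subst cs[OF E_finite]) (auto simp: total const_0 \<epsilon>.M.zero_smult intro!: \<epsilon>.M.M.finsum_closed)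
    also have "\<dots> \<in> L" by (rule \<epsilon>.M.finsum_mem_submodule[OF L]) (use rL in auto)
    finally show "idempotent_sum M a \<in> L" .
  qed
qed

lemma left_FP_if_group:
  assumes "left_FP H n" "finite {L. left_ideal L U}"
  shows "left_FP S n"
proof (rule left_FP_if_kernels_finitely_generated[OF S_monoid])
  fix k and A :: "nat \<Rightarrow> ('a option \<Rightarrow> int, nat \<Rightarrow> 'a option \<Rightarrow> int) module" and d \<epsilon>
  assume k: "k < n" and A: "partial_free_resolution S k A d \<epsilon>"
  obtain P :: "nat \<Rightarrow> ('a \<Rightarrow> int, nat \<Rightarrow> 'a \<Rightarrow> int) module" and dP \<epsilon>P
    where P: "partial_free_resolution H n P dP \<epsilon>P"
    using assms(1) unfolding left_FP_def by blast
  have "finitely_generated ZH (corner e (A k)) (resolution_kernel k (\<lambda>i. corner e (A i)) d \<epsilon>)"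
    by (rule finitely_generated_resolution_kernel[OF H_monoid
          partial_free_resolution_mono[OF P Suc_leI[OF k]] corner_resolution(1)[OF A assms(2)]])
  then have fg: "finitely_generated ZH (corner e (A k)) (resolution_kernel k A d \<epsilon> \<inter> carrier (corner e (A k)))"
    by (simp add: corner_resolution(2)[OF A assms(2)])
  show "finitely_generated ZS (A k) (resolution_kernel k A d \<epsilon>)"
  proof (cases k)
    case 0
    then show ?thesis
      using finitely_generated_kernel_of_augmentation[OF partial_free_resolution_augmentation[OF S_monoid A]]
        A fg partial_free_resolution_0[of S A d \<epsilon>]
      by (simp add: resolution_kernel_def)
  next
    case (Suc i)
    then have A': "partial_free_resolution S (Suc i) A d \<epsilon>" using A by simp
    then have "partial_free_resolution S i A d \<epsilon>" by (simp add: partial_free_resolution_Suc)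
    then show ?thesis
      using finitely_generated_kernel_of_free[OF partial_free_resolution_map[OF A']]
        partial_free_resolution_fg_free[OF A'] partial_free_resolution_fg_free[of S i A d \<epsilon>] fg Suc
      by (simp add: resolution_kernel_def)
  qed
qed

end

section \<open>The semigroup and its maximal subgroup\<close>

lemma left_FP_cong:
  assumes "monoid_ring S = monoid_ring S'"
  shows "left_FP S n = left_FP S' n"
  using assms unfolding left_FP_def partial_free_resolution_def by simp

context completely_simple_pointed
begin

lemma left_FP_adjoin_identity_iff:
  assumes "finite {L. left_ideal L U}" "1 \<le> n"
  shows "left_FP S n \<longleftrightarrow> finite {R. right_ideal R U} \<and> left_FP H n"
proof
  assume "left_FP S n"
  then obtain A :: "nat \<Rightarrow> ('a option \<Rightarrow> int, nat \<Rightarrow> 'a option \<Rightarrow> int) module" and d \<epsilon>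
    where A: "partial_free_resolution S n A d \<epsilon>"
    unfolding left_FP_def by blast
  have "partial_free_resolution S (Suc 0) A d \<epsilon>"
    using partial_free_resolution_mono[OF A] assms(2) by simp
  then have "finite {R. right_ideal R U}"
    using finite_right_ideals_if_FP finite_right_ideals_iff by blast
  moreover have "left_FP H n"
    by (rule left_FP_I[OF corner_resolution(1)[OF A assms(1)]])
  ultimately show "finite {R. right_ideal R U} \<and> left_FP H n" by simp
next
  assume asm: "finite {R. right_ideal R U} \<and> left_FP H n"
  obtain E where "E \<subseteq> carrier U" "E \<noteq> {}" "finite (principal_right ` carrier U) \<Longrightarrow> finite E"
    "\<And>f. f \<in> E \<Longrightarrow> f \<otimes> f = f" "\<And>u. u \<in> carrier U \<Longrightarrow> \<exists>f\<in>E. f \<otimes> u = u"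
    "\<And>f f' u v. \<lbrakk>f \<in> E; f' \<in> E; u \<in> carrier U; v \<in> carrier U; f \<otimes> u = f' \<otimes> v\<rbrakk> \<Longrightarrow> f = f'"
    by (rule idempotent_transversal) (rule that; assumption)
  then interpret completely_simple_transversal U e E
    using asm finite_right_ideals_iff by unfold_locales auto
  show "left_FP S n" using left_FP_if_group assms(1) asm by blast
qed

text \<open>
  If \<open>i\<close> is an identity, recovering \<open>i\<close> from \<open>e i\<close> gives \<open>w e = i\<close>, and then \<open>e = i e = w e e = i\<close>.
\<close>

lemma group_if_identity:
  assumes "is_identity i U"
  shows "carrier H = carrier U" "e = i" "{R. right_ideal R U} = {carrier U}"
proof -
  have i: "i \<in> carrier U" "\<And>x. x \<in> carrier U \<Longrightarrow> i \<otimes> x = x" "\<And>x. x \<in> carrier U \<Longrightarrow> x \<otimes> i = x"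
    using assms by (auto simp: is_identity_def)
  obtain w where w: "w \<in> carrier U" "w \<otimes> (e \<otimes> i) = i"
    using left_recover e_closed i(1) by blast
  have "w \<otimes> e = i" using w e_closed i by simp
  then have "i \<otimes> e = w \<otimes> (e \<otimes> e)" using w(1) e_closed by (simp add: m_assoc[symmetric])
  then have "e = i" using \<open>w \<otimes> e = i\<close> e_e e_closed i by simp
  then show "e = i" .
  then show "carrier H = carrier U" unfolding H_carrier using i by auto
  have "R = carrier U" if R: "right_ideal R U" for R
  proof -
    obtain x where x: "x \<in> R" "x \<in> carrier U" using R by (auto simp: right_ideal_def)
    obtain v where v: "v \<in> carrier U" "i \<otimes> x \<otimes> v = i" using right_recover i(1) x(2) by blast
    have "x \<otimes> v \<in> R" using R x v by (auto simp: right_ideal_def)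
    then have "i \<in> R" using v x i by simp
    then have "i \<otimes> y \<in> R" if "y \<in> carrier U" for y using R that by (auto simp: right_ideal_def)
    then show ?thesis using R i(2) by (auto simp: right_ideal_def)
  qed
  moreover have "right_ideal (carrier U) U" using nonempty m_closed by (auto simp: right_ideal_def)
  ultimately show "{R. right_ideal R U} = {carrier U}" by blast
qed

end

theorem theorem4:
  fixes U :: "('a, 'b) monoid_scheme" and H :: "'a monoid" and n :: nat
  assumes "completely_simple U"
    and "finite {L. left_ideal L U}"
    and "maximal_subgroup H U"
    and "1 \<le> n"
  shows "semigroup_left_FP U n \<longleftrightarrow> finite {R. right_ideal R U} \<and> left_FP H n"
proof -
  obtain e where e: "idempotent_in e U" and H: "H = units_of (local_monoid U e)"
    using assms(3) by (auto simp: maximal_subgroup_def)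
  interpret cs: completely_simple_pointed U e
    by (intro completely_simple_pointed.intro completely_simple_pointed_axioms.intro
        completely_simple_semigroup[OF assms(1)] e)
  show ?thesis
  proof (cases "\<exists>i. is_identity i U")
    case False
    then have "semigroup_left_FP U n = left_FP (adjoin_identity U) n"
      unfolding semigroup_left_FP_def by simp
    then show ?thesis
      using cs.left_FP_adjoin_identity_iff[OF assms(2,4)] unfolding H by simp
  next
    case True
    then obtain i where i: "is_identity i U" by blast
    have "(THE i. is_identity i U) = i"
      using i cs.group_if_identity(2) by (intro the_equality) auto
    then have "(THE i. is_identity i U) = e" using cs.group_if_identity(2)[OF i] by simp
    then have "monoid_ring (U\<lparr>one := THE i. is_identity i U\<rparr>) = monoid_ring H"
      using cs.group_if_identity(1)[OF i] cs.H_mult cs.H_one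
      unfolding H by (simp add: monoid_ring_def)
    from left_FP_cong[OF this] have "semigroup_left_FP U n = left_FP H n"
      using True unfolding semigroup_left_FP_def by simp
    then show ?thesis using cs.group_if_identity(3)[OF i] by simp
  qed
qed

end
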